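(* Let $m\geq 2$, let $k_2,\dots,k_m\geq 2$ be integers, and let $P(z)\in\mathbb{K}[z]$ be a monic polynomial of degree $d\geq 2$ with zero coefficient of $z^{d-1}$. Let $Y=\{y_1y_2^{k_2}\cdots y_m^{k_m}=P(z)\}\subset\mathbb{K}^{m+1}$. Let $\mathbb{T}$ be the proper torus of $Y$, $\mathbb{D}$ the additional quasitorus of $Y$, $S(Y)$ the symmetric group of $Y$, and $\mathbb{U}(\widehat{\partial})$ the big unipotent subgroup corresponding to the canonical locally nilpotent derivation $\widehat{\partial}$ on $Y$. Then the automorphism group of $Y$ is isomorphic to $$S(Y)\ltimes\left((\mathbb{T}\times\mathbb{D})\ltimes\mathbb{U}(\widehat{\partial})\right),$$ where in each semidirect product $A\ltimes B$ the factor $B$ is normal.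
   Context: $\mathbb{K}$ is an algebraically closed field of characteristic zero. Automorphisms of the variety $Y$ and of the algebra $\mathbb{K}[Y]$ are identified as usual. Proper torus: $\mathbb{T}=\{(t_1,\dots,t_m)\in(\mathbb{K}^\times)^m\mid t_1t_2^{k_2}\cdots t_m^{k_m}=1\}$, acting on $Y$ by $y_i\mapsto t_iy_i$, $z\mapsto z$. Additional quasitorus: $\mathbb{D}=\{t\in\mathbb{K}^\times\mid P(tz)=t^dP(z)\}$, acting on $Y$ by $t\cdot(y_1,y_2,\dots,y_m,z)=(t^dy_1,y_2,\dots,y_m,tz)$. Symmetric group: $S(Y)\subset\mathrm{S}_m$ is the stabilizer of the monomial $y_1y_2^{k_2}\cdots y_m^{k_m}$ under permutations of $y_1,\dots,y_m$, acting on $Y$ by permuting the $y_i$ and fixing $z$. A derivation is locally nilpotent (LND) if each element is annihilated by some power of it. The canonical LND $\widehat{\partial}$ of $\mathbb{K}[Y]$ is given by $\widehat{\partial}(y_1)=P'(z)$, $\widehat{\partial}(z)=y_2^{k_2}\cdots y_m^{k_m}$, $\widehat{\partial}(y_j)=0$ for $j\geq2$. The big unipotent subgroup is $\mathbb{U}(\widehat{\partial})=\{\exp(f\widehat{\partial})\mid f\in\mathrm{Ker}\,\widehat{\partial}\}$, where $\mathrm{Ker}\,\widehat{\partial}=\mathbb{K}[y_2,\dots,y_m]$. *)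

theory Defs
  imports
    "HOL-Computational_Algebra.Polynomial"
    "HOL-Algebra.Ring"
    "HOL-Algebra.Bij"
    "HOL-Algebra.Product_Groups"
    "HOL-Algebra.Sym_Groups"
begin

section \<open>Affine sets, regular functions and automorphisms\<close>

text \<open>
  A point of affine space of dimension \<open>m + 1\<close> is an extensional function on \<open>{0..m}\<close>.
  Coordinate \<open>0\<close> is \<open>z\<close>, and coordinate \<open>i\<close> is \<open>y\<^sub>i\<close> for \<open>i \<in> {1..m}\<close>.
\<close>

definition affine_pts :: "nat \<Rightarrow> (nat \<Rightarrow> 'a) set" where
  "affine_pts m = {0..m} \<rightarrow>\<^sub>E UNIV"

text \<open>Over an algebraically closed field, the coordinate algebra \<open>\<K>[X]\<close> of a closed set \<open>X\<close>
  consists of the restrictions to \<open>X\<close> of polynomial functions. Below, \<open>E\<close> is the set of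
  exponent vectors of the monomials of such a polynomial and \<open>c\<close> gives their coefficients.\<close>

definition regular_funs :: "nat \<Rightarrow> (nat \<Rightarrow> 'a::field) set \<Rightarrow> ((nat \<Rightarrow> 'a) \<Rightarrow> 'a) set" where
  "regular_funs m X =
     {f. \<exists>E c. finite (E :: (nat \<Rightarrow> nat) set) \<and>
           f = (\<lambda>p\<in>X. \<Sum>e\<in>E. c e * (\<Prod>i\<in>{0..m}. p i ^ e i))}"

definition coord_ring :: "nat \<Rightarrow> (nat \<Rightarrow> 'a::field) set \<Rightarrow> ((nat \<Rightarrow> 'a) \<Rightarrow> 'a) ring" where
  "coord_ring m X =
     \<lparr>carrier = regular_funs m X,
      monoid.mult = (\<lambda>f g. \<lambda>p\<in>X. f p * g p),
      one = (\<lambda>p\<in>X. 1),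
      zero = (\<lambda>p\<in>X. 0),
      add = (\<lambda>f g. \<lambda>p\<in>X. f p + g p)\<rparr>"

definition coord_fun :: "(nat \<Rightarrow> 'a) set \<Rightarrow> nat \<Rightarrow> (nat \<Rightarrow> 'a) \<Rightarrow> 'a" where
  "coord_fun X i = (\<lambda>p\<in>X. p i)"

definition regular_map :: "nat \<Rightarrow> (nat \<Rightarrow> 'a::field) set \<Rightarrow> ((nat \<Rightarrow> 'a) \<Rightarrow> (nat \<Rightarrow> 'a)) \<Rightarrow> bool" where
  "regular_map m X \<phi> \<longleftrightarrow> \<phi> \<in> X \<rightarrow>\<^sub>E X \<and> (\<forall>i\<in>{0..m}. (\<lambda>p\<in>X. \<phi> p i) \<in> regular_funs m X)"

definition variety_aut :: "nat \<Rightarrow> (nat \<Rightarrow> 'a::field) set \<Rightarrow> ((nat \<Rightarrow> 'a) \<Rightarrow> (nat \<Rightarrow> 'a)) monoid" where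
  "variety_aut m X = BijGroup X
     \<lparr>carrier := {\<phi> \<in> Bij X. regular_map m X \<phi> \<and> regular_map m X (restrict (inv_into X \<phi>) X)}\<rparr>"

text \<open>Automorphisms of \<open>X\<close> and of \<open>\<K>[X]\<close> are identified through \<open>\<alpha> f = f \<circ> \<phi>\<close>. Here \<open>\<phi>\<close> is
  recovered from \<open>\<alpha>\<close>: the \<open>i\<close>-th coordinate of \<open>\<phi> p\<close> is \<open>\<alpha>\<close> of the \<open>i\<close>-th coordinate function,
  evaluated at \<open>p\<close>.\<close>

definition map_of_algebra_map ::
  "nat \<Rightarrow> (nat \<Rightarrow> 'a) set \<Rightarrow> (((nat \<Rightarrow> 'a) \<Rightarrow> 'a) \<Rightarrow> ((nat \<Rightarrow> 'a) \<Rightarrow> 'a)) \<Rightarrow> (nat \<Rightarrow> 'a) \<Rightarrow> (nat \<Rightarrow> 'a)" where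
  "map_of_algebra_map m X \<alpha> = (\<lambda>p\<in>X. \<lambda>i\<in>{0..m}. \<alpha> (coord_fun X i) p)"


section \<open>Derivations and exponentials\<close>

definition derivation ::
  "nat \<Rightarrow> (nat \<Rightarrow> 'a::field) set \<Rightarrow> (((nat \<Rightarrow> 'a) \<Rightarrow> 'a) \<Rightarrow> ((nat \<Rightarrow> 'a) \<Rightarrow> 'a)) \<Rightarrow> bool" where
  "derivation m X \<delta> \<longleftrightarrow> (let R = coord_ring m X in
     \<delta> \<in> carrier R \<rightarrow>\<^sub>E carrier R \<and>
     (\<forall>f\<in>carrier R. \<forall>g\<in>carrier R. \<delta> (f \<oplus>\<^bsub>R\<^esub> g) = \<delta> f \<oplus>\<^bsub>R\<^esub> \<delta> g) \<and>
     (\<forall>c. \<forall>f\<in>carrier R. \<delta> (\<lambda>p\<in>X. c * f p) = (\<lambda>p\<in>X. c * \<delta> f p)) \<and>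
     (\<forall>f\<in>carrier R. \<forall>g\<in>carrier R.
        \<delta> (f \<otimes>\<^bsub>R\<^esub> g) = (f \<otimes>\<^bsub>R\<^esub> \<delta> g) \<oplus>\<^bsub>R\<^esub> (g \<otimes>\<^bsub>R\<^esub> \<delta> f)))"

text \<open>The exponential is meaningful for a locally nilpotent \<open>\<delta>\<close>, where the index set of the sum
  is finite for every \<open>f\<close>.\<close>

definition exp_deriv ::
  "nat \<Rightarrow> (nat \<Rightarrow> 'a::field_char_0) set \<Rightarrow> (((nat \<Rightarrow> 'a) \<Rightarrow> 'a) \<Rightarrow> ((nat \<Rightarrow> 'a) \<Rightarrow> 'a)) \<Rightarrow>
     ((nat \<Rightarrow> 'a) \<Rightarrow> 'a) \<Rightarrow> ((nat \<Rightarrow> 'a) \<Rightarrow> 'a)" where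
  "exp_deriv m X \<delta> = (\<lambda>f\<in>carrier (coord_ring m X). \<lambda>p\<in>X.
     \<Sum>n | (\<delta> ^^ n) f \<noteq> \<zero>\<^bsub>coord_ring m X\<^esub>. (\<delta> ^^ n) f p / fact n)"


section \<open>The variety \<open>Y\<close> and its canonical derivation\<close>

definition y_monomial :: "nat \<Rightarrow> (nat \<Rightarrow> nat) \<Rightarrow> (nat \<Rightarrow> 'a::field) \<Rightarrow> 'a" where
  "y_monomial m k y = y 1 * (\<Prod>i\<in>{2..m}. y i ^ k i)"

definition Y_var :: "nat \<Rightarrow> (nat \<Rightarrow> nat) \<Rightarrow> 'a::field poly \<Rightarrow> (nat \<Rightarrow> 'a) set" where
  "Y_var m k P = {p \<in> affine_pts m. y_monomial m k p = poly P (p 0)}"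

text \<open>The derivation is determined by its values on the generators \<open>y\<^sub>1, \<dots>, y\<^sub>m, z\<close>.\<close>

definition canonical_deriv ::
  "nat \<Rightarrow> (nat \<Rightarrow> nat) \<Rightarrow> 'a::field poly \<Rightarrow> ((nat \<Rightarrow> 'a) \<Rightarrow> 'a) \<Rightarrow> ((nat \<Rightarrow> 'a) \<Rightarrow> 'a)" where
  "canonical_deriv m k P = (let Y = Y_var m k P in
     (THE \<delta>. derivation m Y \<delta> \<and>
        \<delta> (coord_fun Y 1) = (\<lambda>p\<in>Y. poly (pderiv P) (p 0)) \<and>
        \<delta> (coord_fun Y 0) = (\<lambda>p\<in>Y. \<Prod>i\<in>{2..m}. p i ^ k i) \<and>
        (\<forall>j\<in>{2..m}. \<delta> (coord_fun Y j) = \<zero>\<^bsub>coord_ring m Y\<^esub>)))"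

abbreviation Aut_Y :: "nat \<Rightarrow> (nat \<Rightarrow> nat) \<Rightarrow> 'a::field poly \<Rightarrow> ((nat \<Rightarrow> 'a) \<Rightarrow> (nat \<Rightarrow> 'a)) monoid" where
  "Aut_Y m k P \<equiv> variety_aut m (Y_var m k P)"

definition big_unipotent ::
  "nat \<Rightarrow> (nat \<Rightarrow> nat) \<Rightarrow> 'a::field_char_0 poly \<Rightarrow> ((nat \<Rightarrow> 'a) \<Rightarrow> (nat \<Rightarrow> 'a)) monoid" where
  "big_unipotent m k P =
     (let Y = Y_var m k P; R = coord_ring m Y; \<delta> = canonical_deriv m k P in
      (Aut_Y m k P)\<lparr>carrier :=
        {map_of_algebra_map m Y (exp_deriv m Y (\<lambda>g\<in>carrier R. f \<otimes>\<^bsub>R\<^esub> \<delta> g)) | f.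
           f \<in> carrier R \<and> \<delta> f = \<zero>\<^bsub>R\<^esub>}\<rparr>)"


section \<open>The torus, the quasitorus and the symmetric group, with their actions on \<open>Y\<close>\<close>

definition field_units :: "'a::field monoid" where
  "field_units = \<lparr>carrier = UNIV - {0}, monoid.mult = (*), one = 1\<rparr>"

definition proper_torus :: "nat \<Rightarrow> (nat \<Rightarrow> nat) \<Rightarrow> (nat \<Rightarrow> 'a::field) monoid" where
  "proper_torus m k = (product_group {1..m} (\<lambda>_. field_units))
     \<lparr>carrier := {t \<in> {1..m} \<rightarrow>\<^sub>E (UNIV - {0}). y_monomial m k t = 1}\<rparr>"

definition quasitorus :: "'a::field poly \<Rightarrow> 'a monoid" where
  "quasitorus P = field_units
     \<lparr>carrier := {t. t \<noteq> 0 \<and> pcompose P [:0, t:] = smult (t ^ degree P) P}\<rparr>"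

definition sym_Y :: "'a::field itself \<Rightarrow> nat \<Rightarrow> (nat \<Rightarrow> nat) \<Rightarrow> (nat \<Rightarrow> nat) monoid" where
  "sym_Y _ m k = (sym_group m)
     \<lparr>carrier := {\<sigma>. \<sigma> permutes {1..m} \<and>
        (\<forall>y :: nat \<Rightarrow> 'a. y_monomial m k (y \<circ> \<sigma>) = y_monomial m k y)}\<rparr>"

definition torus_act ::
  "nat \<Rightarrow> (nat \<Rightarrow> nat) \<Rightarrow> 'a::field poly \<Rightarrow> (nat \<Rightarrow> 'a) \<Rightarrow> (nat \<Rightarrow> 'a) \<Rightarrow> (nat \<Rightarrow> 'a)" where
  "torus_act m k P t = (\<lambda>p\<in>Y_var m k P. \<lambda>i\<in>{0..m}. if i = 0 then p 0 else t i * p i)"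

definition quasitorus_act ::
  "nat \<Rightarrow> (nat \<Rightarrow> nat) \<Rightarrow> 'a::field poly \<Rightarrow> 'a \<Rightarrow> (nat \<Rightarrow> 'a) \<Rightarrow> (nat \<Rightarrow> 'a)" where
  "quasitorus_act m k P s = (\<lambda>p\<in>Y_var m k P. \<lambda>i\<in>{0..m}.
     if i = 0 then s * p 0 else if i = 1 then s ^ degree P * p 1 else p i)"

text \<open>The inverse makes this a left action; \<open>\<sigma>\<close> permutes \<open>{1..m}\<close> and so fixes the
  coordinate \<open>0\<close>.\<close>

definition sym_act ::
  "nat \<Rightarrow> (nat \<Rightarrow> nat) \<Rightarrow> 'a::field poly \<Rightarrow> (nat \<Rightarrow> nat) \<Rightarrow> (nat \<Rightarrow> 'a) \<Rightarrow> (nat \<Rightarrow> 'a)" where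
  "sym_act m k P \<sigma> = (\<lambda>p\<in>Y_var m k P. \<lambda>i\<in>{0..m}. p (inv_into UNIV \<sigma> i))"


section \<open>Semidirect products\<close>

text \<open>\<open>semidirect A B \<theta>\<close> is the external semidirect product \<open>A \<ltimes> B\<close>, with \<open>B\<close> normal and
  \<open>A\<close> acting on \<open>B\<close> through \<open>\<theta>\<close>. The pair \<open>(a, b)\<close> stands for the product \<open>b a\<close>, with
  \<open>a b a\<^sup>-\<^sup>1 = \<theta> a b\<close>.\<close>

definition semidirect ::
  "('a, 'c) monoid_scheme \<Rightarrow> ('b, 'd) monoid_scheme \<Rightarrow> ('a \<Rightarrow> 'b \<Rightarrow> 'b) \<Rightarrow> ('a \<times> 'b) monoid" where
  "semidirect A B \<theta> =
     \<lparr>carrier = carrier A \<times> carrier B,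
      monoid.mult = (\<lambda>(a, b) (a', b'). (a \<otimes>\<^bsub>A\<^esub> a', b \<otimes>\<^bsub>B\<^esub> \<theta> a b')),
      one = (\<one>\<^bsub>A\<^esub>, \<one>\<^bsub>B\<^esub>)\<rparr>"

definition conj_by :: "('a, 'b) monoid_scheme \<Rightarrow> 'a \<Rightarrow> 'a \<Rightarrow> 'a" where
  "conj_by G g x = g \<otimes>\<^bsub>G\<^esub> x \<otimes>\<^bsub>G\<^esub> inv\<^bsub>G\<^esub> g"

definition TD_conj ::
  "nat \<Rightarrow> (nat \<Rightarrow> nat) \<Rightarrow> 'a::field_char_0 poly \<Rightarrow> (nat \<Rightarrow> 'a) \<times> 'a \<Rightarrow>
     ((nat \<Rightarrow> 'a) \<Rightarrow> (nat \<Rightarrow> 'a)) \<Rightarrow> ((nat \<Rightarrow> 'a) \<Rightarrow> (nat \<Rightarrow> 'a))" where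
  "TD_conj m k P = (\<lambda>(t, s). \<lambda>u\<in>carrier (big_unipotent m k P).
     conj_by (Aut_Y m k P) (torus_act m k P t \<otimes>\<^bsub>Aut_Y m k P\<^esub> quasitorus_act m k P s) u)"

definition TDU ::
  "nat \<Rightarrow> (nat \<Rightarrow> nat) \<Rightarrow> 'a::field_char_0 poly \<Rightarrow>
     (((nat \<Rightarrow> 'a) \<times> 'a) \<times> ((nat \<Rightarrow> 'a) \<Rightarrow> (nat \<Rightarrow> 'a))) monoid" where
  "TDU m k P = semidirect (proper_torus m k \<times>\<times> quasitorus P) (big_unipotent m k P) (TD_conj m k P)"

text \<open>Conjugation by \<open>\<sigma>\<close> in the automorphism group of \<open>Y\<close>, in terms of the components: it permutes
  the entries of an element of the torus, and it centralizes the quasitorus because \<open>\<sigma>\<close> fixes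
  \<open>y\<^sub>1\<close> and \<open>z\<close>, as all \<open>k\<^sub>i \<ge> 2\<close>.\<close>

definition sym_conj ::
  "nat \<Rightarrow> (nat \<Rightarrow> nat) \<Rightarrow> 'a::field_char_0 poly \<Rightarrow> (nat \<Rightarrow> nat) \<Rightarrow>
     ((nat \<Rightarrow> 'a) \<times> 'a) \<times> ((nat \<Rightarrow> 'a) \<Rightarrow> (nat \<Rightarrow> 'a)) \<Rightarrow>
     ((nat \<Rightarrow> 'a) \<times> 'a) \<times> ((nat \<Rightarrow> 'a) \<Rightarrow> (nat \<Rightarrow> 'a))" where
  "sym_conj m k P \<sigma> = (\<lambda>((t, s), u)\<in>carrier (TDU m k P).
     ((\<lambda>i\<in>{1..m}. t (inv_into UNIV \<sigma> i), s), conj_by (Aut_Y m k P) (sym_act m k P \<sigma>) u))"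

end

theory Submission
  imports Defs "HOL-Library.Poly_Mapping"
begin

text \<open>The coordinate ring of \<open>Y\<close> is embedded into the Laurent polynomials in \<open>z, y\<^sub>2, \<dots>, y\<^sub>m\<close> by
  \<open>y\<^sub>1 = P(z) / M\<close>, where \<open>M\<close> is the product of the \<open>y\<^sub>j\<close> to the powers \<open>k\<^sub>j\<close>, \<open>j \<ge> 2\<close>. Since \<open>y\<^sub>1 M = P(z)\<close>
  eliminates the powers of \<open>z\<close> from the \<open>d\<close>-th on, an element is uniquely a sum of terms \<open>y\<^sub>1\<^sup>a R\<^sub>a\<close>
  with polynomials \<open>R\<^sub>a\<close> in \<open>z, y\<^sub>2, \<dots>, y\<^sub>m\<close> of degree less than \<open>d\<close> in \<open>z\<close>. When exponents are compared
  lexicographically, \<open>z\<close> first, the nonzero summand with the largest \<open>a\<close> contains the leading term.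
  This determines the semigroup of leading exponents (lemma \<open>A_top\<close>), and shows that an element of degree
  less than \<open>d\<close> in \<open>z\<close> is a polynomial in \<open>z, y\<^sub>2, \<dots>, y\<^sub>m\<close> (lemma \<open>rep_low\<close>).

  The heart of the proof is that every automorphism \<open>\<alpha>\<close> preserves \<open>B = \<K>[y\<^sub>2, \<dots>, y\<^sub>m]\<close>. The subalgebra
  \<open>\<alpha>(B)\<close> is the kernel of the conjugate of the canonical derivation by \<open>\<alpha>\<close>, so it suffices that the
  kernel of any nonzero locally nilpotent derivation \<open>\<delta>\<close> lies in \<open>B\<close>. On leading terms \<open>\<delta>\<close> acts by
  \<open>\<chi>\<^sup>s \<mapsto> \<lambda>(s) \<chi>\<^sup>s\<^sup>+\<^sup>e\<close> with a linear form \<open>\<lambda>\<close>. Nilpotence makes \<open>\<lambda>\<close>, suitably scaled, integral and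
  nonnegative on the semigroup of leading exponents, with \<open>\<lambda>(e) = -1\<close>, and the semigroup is so narrow
  that \<open>\<lambda>\<close> has to be the degree in \<open>z\<close> (lemmas \<open>root_arith\<close> and \<open>lnd_top\<close>); this is where \<open>k\<^sub>j \<ge> 2\<close> and
  \<open>d \<ge> 2\<close> enter. Hence elements of the kernel have degree \<open>0\<close> in \<open>z\<close>, and elements killed by \<open>\<delta>\<^sup>2\<close> have
  degree at most \<open>1\<close>.

  The latter applies to \<open>\<alpha>(z)\<close>, so \<open>\<alpha>(z) = a z + H\<close> with \<open>a\<close> constant and \<open>H\<close> in \<open>B\<close>. As \<open>\<delta>(y\<^sub>1)\<close> belongs to
  the coordinate ring, \<open>M\<close> divides \<open>\<alpha>(M)\<close>, hence \<open>\<alpha>(M)\<close> is a constant multiple of \<open>M\<close> and \<open>\<alpha>\<close> permutes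
  \<open>y\<^sub>2, \<dots>, y\<^sub>m\<close> up to scalars. Finally \<open>P(a z + H)\<close> is \<open>\<alpha>(y\<^sub>1)\<close> times a multiple of \<open>M\<close>; since \<open>P\<close> has no term of
  degree \<open>d - 1\<close>, this forces \<open>H\<close> into \<open>M B\<close> and \<open>P(a z) = a\<^sup>d P(z)\<close> (theorem \<open>aut_structure\<close>).

  It follows that the big unipotent subgroup consists exactly of the automorphisms that fix
  \<open>y\<^sub>2, \<dots>, y\<^sub>m\<close> and change \<open>z\<close> by a function of these (lemma \<open>big_unipotent_eq\<close>). In this form its
  normality is evident, and dividing an arbitrary automorphism by the torus, quasitorus and symmetric
  parts read off from its coordinates leaves an element of it (lemma \<open>G_decomposition\<close>). The two
  semidirect products are instances of one statement about conjugation in a group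
  (locale \<open>conjugation_action\<close>).\<close>

section \<open>Laurent polynomials\<close>

text \<open>Exponent vectors are finitely supported functions, ordered lexicographically with index \<open>0\<close> first.
  The variable with index \<open>0\<close> is \<open>z\<close>, so that the leading exponent has the largest degree in \<open>z\<close>.\<close>

type_synonym 'a laurent = "(nat \<Rightarrow>\<^sub>0 int) \<Rightarrow>\<^sub>0 'a"

abbreviation coef :: "('b \<Rightarrow>\<^sub>0 'a::zero) \<Rightarrow> 'b \<Rightarrow> 'a" where "coef \<equiv> Poly_Mapping.lookup"
abbreviation expts :: "('b \<Rightarrow>\<^sub>0 'a::zero) \<Rightarrow> 'b set" where "expts \<equiv> Poly_Mapping.keys"
abbreviation mon :: "'b \<Rightarrow> 'a \<Rightarrow> ('b \<Rightarrow>\<^sub>0 'a::zero)" where "mon \<equiv> Poly_Mapping.single"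

lemma laurent_sum_monos:
  fixes F :: "'b \<Rightarrow>\<^sub>0 'a::comm_monoid_add"
  shows "F = (\<Sum>s\<in>expts F. mon s (coef F s))"
proof (rule poly_mapping_eqI)
  fix t
  have "(\<Sum>s\<in>expts F. coef (mon s (coef F s)) t) = (\<Sum>s\<in>expts F. if s = t then coef F t else 0)"
    by (rule sum.cong) (auto simp: lookup_single)
  also have "\<dots> = coef F t"
    by (simp add: sum.delta' not_in_keys_iff_lookup_eq_zero)
  finally show "coef F t = coef (\<Sum>s\<in>expts F. mon s (coef F s)) t"
    by (simp add: lookup_sum)
qed

lemma laurent_induct [consumes 1, case_names zero mon add]:
  fixes F :: "'b \<Rightarrow>\<^sub>0 'a::comm_monoid_add"
  assumes "expts F \<subseteq> S" "Q 0" "\<And>s c. s \<in> S \<Longrightarrow> c \<noteq> 0 \<Longrightarrow> Q (mon s c)"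
    "\<And>F G. expts F \<subseteq> S \<Longrightarrow> expts G \<subseteq> S \<Longrightarrow> Q F \<Longrightarrow> Q G \<Longrightarrow> Q (F + G)"
  shows "Q F"
proof -
  have "expts (\<Sum>s\<in>T. mon s (coef F s)) \<subseteq> S \<and> Q (\<Sum>s\<in>T. mon s (coef F s))"
    if "finite T" "T \<subseteq> expts F" for T
    using that
  proof (induction T rule: finite_induct)
    case empty
    then show ?case using assms by simp
  next
    case (insert s T)
    have 1: "expts (mon s (coef F s)) \<subseteq> S" "Q (mon s (coef F s))"
      using insert assms by (auto simp: in_keys_iff)
    have 2: "expts (mon s (coef F s) + (\<Sum>s\<in>T. mon s (coef F s))) \<subseteq> S"
      using keys_add[of "mon s (coef F s)" "\<Sum>s\<in>T. mon s (coef F s)"] 1 insert by blast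
    show ?case using 1 2 insert assms(4)[of "mon s (coef F s)" "\<Sum>s\<in>T. mon s (coef F s)"] by simp
  qed
  from this[of "expts F"] show ?thesis using laurent_sum_monos[of F] by simp
qed

lemma expts_mult_subset:
  assumes "expts F \<subseteq> S" "expts G \<subseteq> S" "\<And>s t. s \<in> S \<Longrightarrow> t \<in> S \<Longrightarrow> s + t \<in> S"
  shows "expts (F * G) \<subseteq> S"
  using keys_mult[of F G] assms by blast

lemma expts_add_subset: "expts F \<subseteq> S \<Longrightarrow> expts G \<subseteq> S \<Longrightarrow> expts (F + G) \<subseteq> S"
  using keys_add[of F G] by blast

lemma expts_diff_subset:
  fixes F G :: "'b \<Rightarrow>\<^sub>0 'a::ab_group_add"
  assumes "expts F \<subseteq> S" "expts G \<subseteq> S"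
  shows "expts (F - G) \<subseteq> S"
proof
  fix x assume "x \<in> expts (F - G)"
  then have "x \<in> expts F \<or> x \<in> expts G"
    unfolding in_keys_iff lookup_minus by (cases "coef F x = 0") auto
  then show "x \<in> S" using assms by blast
qed

lemma expts_sum_subset: "(\<And>i. i \<in> I \<Longrightarrow> expts (F i) \<subseteq> S) \<Longrightarrow> expts (\<Sum>i\<in>I. F i) \<subseteq> S"
  by (induction I rule: infinite_finite_induct) (simp_all add: expts_add_subset)

lemma expts_mono_subset: "s \<in> S \<Longrightarrow> expts (mon s c) \<subseteq> S"
  by (auto simp: in_keys_iff lookup_single when_def split: if_splits)

lemma coef_mono_mult:
  fixes F :: "'b::ab_group_add \<Rightarrow>\<^sub>0 'a::semiring_0"
  shows "coef (mon s c * F) t = c * coef F (t - s)"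
proof -
  have "coef (mon s c * F) t = (\<Sum>l. (c when s = l) * (\<Sum>q. coef F q when t = l + q))"
    by (simp add: lookup_mult lookup_single)
  also have "\<dots> = (\<Sum>l. (c * (\<Sum>q. coef F q when t = l + q)) when l = s)"
    by (intro Sum_any.cong) (auto simp: when_def)
  also have "\<dots> = c * (\<Sum>q. coef F q when t = s + q)"
    by simp
  also have "(\<Sum>q. coef F q when t = s + q) = (\<Sum>q. coef F q when q = t - s)"
    by (intro Sum_any.cong) (auto simp: when_def algebra_simps)
  finally show ?thesis by simp
qed

lemma mono_power: "mon s c ^ n = mon (\<Sum>i<n. s) (c ^ n)"
  by (induction n) (simp_all add: mult_single add_ac lessThan_Suc)

lemma mono_prod:
  fixes c :: "'i \<Rightarrow> 'a::comm_semiring_1"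
  shows "finite I \<Longrightarrow> (\<Prod>i\<in>I. mon (s i) (c i)) = mon (\<Sum>i\<in>I. s i) (\<Prod>i\<in>I. c i)"
  by (induction I rule: finite_induct) (simp_all add: mult_single)

text \<open>The coefficient \<open>c\<close> may be \<open>0\<close>, so that a candidate for the leading term can be followed through
  products and sums before it is known whether it cancels.\<close>

definition has_top :: "('b::linorder \<Rightarrow>\<^sub>0 'a::zero) \<Rightarrow> 'b \<Rightarrow> 'a \<Rightarrow> bool" where
  "has_top F s c \<longleftrightarrow> coef F s = c \<and> (\<forall>t\<in>expts F. t \<le> s)"

lemma has_top_mono [simp]: "has_top (mon s c) s c"
  by (auto simp: has_top_def)

lemma has_top_exists:
  assumes "F \<noteq> 0"
  obtains s c where "has_top F s c" "c \<noteq> 0" "s \<in> expts F"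
proof -
  have "expts F \<noteq> {}" using assms by simp
  then have "Max (expts F) \<in> expts F" by simp
  then show ?thesis
    using that[of "Max (expts F)" "coef F (Max (expts F))"] by (auto simp: has_top_def in_keys_iff)
qed

lemma has_top_mult:
  fixes F G :: "'b::linordered_ab_group_add \<Rightarrow>\<^sub>0 'a::comm_ring_1"
  assumes "has_top F s c" "has_top G t c'"
  shows "has_top (F * G) (s + t) (c * c')"
proof -
  define F' where "F' = F - mon s c"
  have F: "F = mon s c + F'" by (simp add: F'_def)
  have F': "\<forall>u\<in>expts F'. u < s"
    using assms(1) by (auto simp: F'_def in_keys_iff lookup_minus lookup_single has_top_def when_def
      split: if_splits) (metis in_keys_iff order_le_neq_trans)
  have "u < s + t" if "u \<in> expts (F' * G)" for u
  proof -
    obtain a b where "u = a + b" "a \<in> expts F'" "b \<in> expts G"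
      using \<open>u \<in> expts (F' * G)\<close> keys_mult[of F' G] by blast
    then show ?thesis using F' assms(2) by (auto simp: has_top_def intro: add_less_le_mono)
  qed
  then have 1: "coef (F' * G) u = 0" if "u \<ge> s + t" for u
    using that by (meson in_keys_iff leD)
  have 2: "coef (F * G) u = c * coef G (u - s) + coef (F' * G) u" for u
    by (subst F) (simp add: distrib_right lookup_add coef_mono_mult)
  have "coef (F * G) (s + t) = c * c'"
    using assms(2) 1[of "s + t"] by (simp add: 2 has_top_def)
  moreover have "u \<le> s + t" if "u \<in> expts (F * G)" for u
  proof (rule ccontr)
    assume "\<not> u \<le> s + t"
    then have "u > s + t" by simp
    moreover from this have "u - s > t" by (simp add: less_diff_eq add.commute)
    then have "coef G (u - s) = 0"
      using assms(2) by (meson has_top_def in_keys_iff leD)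
    ultimately show False using that 1[of u] by (simp add: in_keys_iff 2)
  qed
  ultimately show ?thesis by (simp add: has_top_def)
qed

lemma has_top_sum:
  fixes F :: "'i \<Rightarrow> 'b::linorder \<Rightarrow>\<^sub>0 'a::comm_monoid_add"
  assumes "finite I" "\<And>i. i \<in> I \<Longrightarrow> has_top (F i) s (c i)"
  shows "has_top (\<Sum>i\<in>I. F i) s (\<Sum>i\<in>I. c i)"
proof -
  have "expts (\<Sum>i\<in>I. F i) \<subseteq> {..s}"
    using assms by (intro expts_sum_subset) (auto simp: has_top_def)
  then show ?thesis using assms by (auto simp: has_top_def lookup_sum intro!: sum.cong)
qed

text \<open>In a factorization of a monomial the largest exponents of the factors add up to its exponent,
  and so do the smallest ones. Hence they coincide in each factor.\<close>

lemma mono_factor_is_mono: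
  fixes F G :: "'b::linordered_ab_group_add \<Rightarrow>\<^sub>0 'a::idom"
  assumes FG: "F * G = mon s c" and "c \<noteq> 0"
  obtains t b where "F = mon t b" "b \<noteq> 0"
proof -
  have "mon s c \<noteq> 0" using \<open>c \<noteq> 0\<close> keys_single[of s c] by (metis insert_not_empty keys_zero)
  then have nz: "F \<noteq> 0" "G \<noteq> 0" using FG by auto
  have *: "a + b \<in> expts (F * G)" if "a \<in> expts F" "b \<in> expts G"
     and ext: "(\<forall>t\<in>expts F. t \<le> a) \<and> (\<forall>t\<in>expts G. t \<le> b)" for a b
  proof -
    have "has_top (F * G) (a + b) (coef F a * coef G b)"
      by (rule has_top_mult) (use ext in \<open>auto simp: has_top_def\<close>)
    then show ?thesis using that by (auto simp: has_top_def in_keys_iff)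
  qed
  have **: "a + b \<in> expts (F * G)" if "a \<in> expts F" "b \<in> expts G"
     and ext: "(\<forall>t\<in>expts F. t \<ge> a) \<and> (\<forall>t\<in>expts G. t \<ge> b)" for a b
  proof -
    have "coef (F * G) (a + b) = coef F a * coef G b"
    proof -
      define F' where "F' = F - mon a (coef F a)"
      have F: "F = mon a (coef F a) + F'" by (simp add: F'_def)
      have F': "\<forall>u\<in>expts F'. u > a"
        using ext that(1) by (auto simp: F'_def in_keys_iff lookup_minus lookup_single when_def
          split: if_splits) (metis in_keys_iff order_le_neq_trans)
      have "a + b \<notin> expts (F' * G)"
      proof
        assume "a + b \<in> expts (F' * G)"
        then obtain a' b' where "a + b = a' + b'" "a' \<in> expts F'" "b' \<in> expts G"
          using keys_mult[of F' G] by blast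
        moreover from this have "a' > a" "b' \<ge> b" using F' ext by auto
        ultimately show False using add_less_le_mono by fastforce
      qed
      then show ?thesis
        by (subst F) (simp add: distrib_right lookup_add coef_mono_mult in_keys_iff)
    qed
    then show ?thesis using that by (simp add: in_keys_iff)
  qed
  have fin: "finite (expts F)" "finite (expts G)" "expts F \<noteq> {}" "expts G \<noteq> {}" using nz by auto
  have "Max (expts F) + Max (expts G) \<in> expts (F * G)" using fin by (intro *) auto
  moreover have "Min (expts F) + Min (expts G) \<in> expts (F * G)" using fin by (intro **) auto
  ultimately have eq: "Max (expts F) + Max (expts G) = Min (expts F) + Min (expts G)"
    using \<open>c \<noteq> 0\<close> by (simp add: FG)
  have "Min (expts F) \<le> Max (expts F)" "Min (expts G) \<le> Max (expts G)"
    using fin by auto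
  with eq have "Min (expts F) = Max (expts F)"
    by (metis add_less_le_mono less_irrefl order_le_less)
  then have "expts F = {Max (expts F)}"
    using fin by (metis Max_ge Max_in Min_le antisym insertI1 singletonD subsetI subset_singleton_iff)
  then obtain t where t: "expts F = {t}" by blast
  then have "F = mon t (coef F t)"
    using laurent_sum_monos[of F] by simp
  moreover have "coef F t \<noteq> 0" using t by (metis in_keys_iff insertI1)
  ultimately show ?thesis using that by blast
qed

text \<open>The Euler derivation \<open>x\<^sub>i \<partial>/\<partial>x\<^sub>i\<close>.\<close>

definition euler :: "nat \<Rightarrow> 'a::comm_ring_1 laurent \<Rightarrow> 'a laurent" where
  "euler i F = Poly_Mapping.mapp (\<lambda>s c. of_int (coef s i) * c) F"

lemma coef_euler: "coef (euler i F) s = of_int (coef s i) * coef F s"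
  by (auto simp: euler_def lookup_mapp when_def in_keys_iff)

lemma euler_mono: "euler i (mon s c) = mon s (of_int (coef s i) * c)"
  by (rule poly_mapping_eqI) (auto simp: coef_euler lookup_single when_def)

lemma euler_add: "euler i (F + G) = euler i F + euler i G"
  by (rule poly_mapping_eqI) (auto simp: coef_euler lookup_add algebra_simps)

lemma euler_0 [simp]: "euler i 0 = 0"
  by (rule poly_mapping_eqI) (auto simp: coef_euler)

lemma euler_mult: "euler i (F * G) = euler i F * G + F * euler i G"
proof -
  have 1: "euler i (mon s c * G) = euler i (mon s c) * G + mon s c * euler i G" for s c
    by (rule poly_mapping_eqI, simp only: coef_euler euler_mono lookup_add coef_mono_mult lookup_minus)
      (simp add: algebra_simps)
  have "expts F \<subseteq> UNIV" by simp
  then show ?thesis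
    by (induction F rule: laurent_induct) (simp_all only: 1 euler_add euler_0 distrib_right mult_zero_left add_0_left add_ac)
qed

lemma lex_less: "coef s 0 < coef t 0 \<Longrightarrow> s < t" for s t :: "nat \<Rightarrow>\<^sub>0 int"
  by transfer (auto simp: less_fun_def)

lemma lex_le: "s \<le> t \<Longrightarrow> coef s 0 \<le> coef t 0" for s t :: "nat \<Rightarrow>\<^sub>0 int"
  using lex_less[of t s] by (meson leD leI)

subsection \<open>Evaluation\<close>

definition mono_at :: "(nat \<Rightarrow> 'a::field) \<Rightarrow> (nat \<Rightarrow>\<^sub>0 int) \<Rightarrow> 'a" where
  "mono_at p s = (\<Prod>i\<in>expts s. p i powi coef s i)"

definition laurent_at :: "(nat \<Rightarrow> 'a::field) \<Rightarrow> 'a laurent \<Rightarrow> 'a" where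
  "laurent_at p F = (\<Sum>s\<in>expts F. coef F s * mono_at p s)"

text \<open>The exponents of monomials without a negative power of a vanishing coordinate. On these,
  evaluation is multiplicative; otherwise it need not be, as negative powers of \<open>0\<close> are \<open>0\<close>.\<close>

definition defined_at :: "(nat \<Rightarrow> 'a::field) \<Rightarrow> (nat \<Rightarrow>\<^sub>0 int) set" where
  "defined_at p = {s. \<forall>i. p i = 0 \<longrightarrow> coef s i \<ge> 0}"

lemma mono_at_superset: "finite J \<Longrightarrow> expts s \<subseteq> J \<Longrightarrow> mono_at p s = (\<Prod>i\<in>J. p i powi coef s i)"
  unfolding mono_at_def by (intro prod.mono_neutral_left) (auto simp: in_keys_iff)

lemma mono_at_cong: "(\<And>i. i \<in> expts s \<Longrightarrow> p i = q i) \<Longrightarrow> mono_at p s = mono_at q s"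
  by (simp add: mono_at_def)

lemma laurent_at_cong:
  "(\<And>s i. s \<in> expts F \<Longrightarrow> i \<in> expts s \<Longrightarrow> p i = q i) \<Longrightarrow> laurent_at p F = laurent_at q F"
  unfolding laurent_at_def by (intro sum.cong refl arg_cong2[of _ _ _ _ "(*)"] mono_at_cong) auto

lemma mono_at_0 [simp]: "mono_at p 0 = 1"
  by (simp add: mono_at_def)

lemma powi_add_nonneg:
  fixes x :: "'a::field"
  shows "x \<noteq> 0 \<or> (a \<ge> 0 \<and> b \<ge> 0) \<Longrightarrow> x powi (a + b) = x powi a * x powi b"
  by (cases "x = 0") (auto simp: power_int_add power_int_0_left_if)

lemma mono_at_add:
  assumes "s \<in> defined_at p" "t \<in> defined_at p"
  shows "mono_at p (s + t) = mono_at p s * mono_at p t"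
proof -
  let ?J = "expts s \<union> expts t"
  have "mono_at p (s + t) = (\<Prod>i\<in>?J. p i powi coef (s + t) i)"
    by (rule mono_at_superset) (use keys_add[of s t] in auto)
  also have "\<dots> = (\<Prod>i\<in>?J. p i powi coef s i * p i powi coef t i)"
    by (rule prod.cong[OF refl], unfold lookup_add, rule powi_add_nonneg)
       (use assms in \<open>auto simp: defined_at_def\<close>)
  also have "\<dots> = mono_at p s * mono_at p t"
    by (simp add: prod.distrib mono_at_superset[of ?J])
  finally show ?thesis .
qed

lemma defined_at_closed:
  "0 \<in> defined_at p" "s \<in> defined_at p \<Longrightarrow> t \<in> defined_at p \<Longrightarrow> s + t \<in> defined_at p"
  by (auto simp: defined_at_def lookup_add)

lemma laurent_at_superset:
  "finite T \<Longrightarrow> expts F \<subseteq> T \<Longrightarrow> laurent_at p F = (\<Sum>s\<in>T. coef F s * mono_at p s)"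
  unfolding laurent_at_def by (intro sum.mono_neutral_left) (auto simp: in_keys_iff)

lemma laurent_at_0 [simp]: "laurent_at p 0 = 0"
  by (simp add: laurent_at_def)

lemma laurent_at_mono [simp]: "laurent_at p (mon s c) = c * mono_at p s"
  by (cases "c = 0") (simp_all add: laurent_at_def)

lemma laurent_at_1 [simp]: "laurent_at p 1 = 1"
  using laurent_at_mono[of p 0 1] by simp

lemma laurent_at_add: "laurent_at p (F + G) = laurent_at p F + laurent_at p G"
proof -
  let ?T = "expts F \<union> expts G"
  have "laurent_at p (F + G) = (\<Sum>s\<in>?T. coef (F + G) s * mono_at p s)"
    by (rule laurent_at_superset) (use keys_add[of F G] in auto)
  also have "\<dots> = laurent_at p F + laurent_at p G"
    by (simp add: lookup_add algebra_simps sum.distrib laurent_at_superset[of ?T])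
  finally show ?thesis .
qed

lemma laurent_at_mult:
  assumes "expts F \<subseteq> defined_at p" "expts G \<subseteq> defined_at p"
  shows "laurent_at p (F * G) = laurent_at p F * laurent_at p G"
proof -
  have 1: "laurent_at p (mon s c * G) = laurent_at p (mon s c) * laurent_at p G"
    if "s \<in> defined_at p" for s c
    using assms(2)
    by (induction G rule: laurent_induct)
       (auto simp: mult_single mono_at_add that laurent_at_add distrib_left)
  show ?thesis
    using assms(1)
    by (induction F rule: laurent_induct) (auto simp: 1 laurent_at_add distrib_right)
qed

lemma laurent_at_sum: "laurent_at p (\<Sum>i\<in>I. F i) = (\<Sum>i\<in>I. laurent_at p (F i))"
  by (induction I rule: infinite_finite_induct) (auto simp: laurent_at_add)

text \<open>Monomials are characters of the torus, so this is linear independence of characters.\<close>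

lemma laurent_at_eq_0_imp:
  fixes F :: "'a::field_char_0 laurent"
  assumes "\<And>p. (\<And>i. p i \<noteq> 0) \<Longrightarrow> laurent_at p F = 0"
  shows "F = 0"
  using assms
proof (induction "card (expts F)" arbitrary: F rule: less_induct)
  case less
  show ?case
  proof (rule ccontr)
    assume "F \<noteq> 0"
    then obtain s where s: "s \<in> expts F" by (metis keys_eq_empty all_not_in_conv)
    have "\<exists>t. t \<in> expts F \<and> t \<noteq> s"
    proof (rule ccontr)
      assume "\<not> ?thesis"
      then have "expts F = {s}" using s by blast
      then have "laurent_at (\<lambda>_. 1) F = coef F s"
        by (simp add: laurent_at_def mono_at_def)
      then show False using less.prems[of "\<lambda>_. 1"] s by (simp add: in_keys_iff)
    qed
    then obtain t where t: "t \<in> expts F" "t \<noteq> s" by blast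
    then obtain i where i: "coef t i \<noteq> coef s i" by (metis poly_mapping_eqI)
    \<comment> \<open>The characters with exponents \<open>s\<close> and \<open>t\<close> differ at the point \<open>q\<close>.\<close>
    define q where "q = (\<lambda>j. if j = i then 2 else (1::'a))"
    have q0: "q j \<noteq> 0" for j by (simp add: q_def)
    have q: "mono_at q u = 2 powi coef u i" for u
    proof -
      have "mono_at q u = (\<Prod>j\<in>insert i (expts u). q j powi coef u j)"
        by (rule mono_at_superset) auto
      also have "\<dots> = (\<Prod>j\<in>insert i (expts u). if j = i then 2 powi coef u i else 1)"
        by (rule prod.cong) (auto simp: q_def)
      also have "\<dots> = 2 powi coef u i" by (subst prod.delta) auto
      finally show ?thesis .
    qed
    have ne: "mono_at q t \<noteq> mono_at q s"
    proof
      assume "mono_at q t = mono_at q s"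
      then have "(2::'a) powi (coef t i - coef s i) = 1"
        by (simp add: q power_int_diff)
      moreover have "(2::'a) ^ n \<noteq> 1" if "n > 0" for n
      proof -
        have "(2::nat) ^ n \<noteq> 1" using that by simp
        then have "of_nat (2 ^ n) \<noteq> (of_nat 1 :: 'a)" by (subst of_nat_eq_iff)
        then show ?thesis by simp
      qed
      ultimately show False
        using i by (cases "coef t i - coef s i" rule: int_cases2)
          (auto simp: power_int_minus)
    qed
    \<comment> \<open>Translating \<open>F\<close> by \<open>q\<close> and subtracting a multiple of \<open>F\<close> cancels the term with exponent \<open>s\<close>.\<close>
    define G where "G = Poly_Mapping.mapp (\<lambda>u c. c * (mono_at q u - mono_at q s)) F"
    have cG: "coef G u = coef F u * (mono_at q u - mono_at q s)" for u
      by (auto simp: G_def lookup_mapp when_def in_keys_iff)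
    have subG: "expts G \<subseteq> expts F - {s}" by (auto simp: in_keys_iff cG)
    then have "card (expts G) < card (expts F)"
      using s by (intro psubset_card_mono) auto
    moreover have "laurent_at p G = 0" if p: "\<And>j. p j \<noteq> 0" for p
    proof -
      have pq: "mono_at (\<lambda>j. p j * q j) u = mono_at p u * mono_at q u" for u
        by (simp add: mono_at_def power_int_mult_distrib prod.distrib)
      have "laurent_at p G = (\<Sum>u\<in>expts F. coef G u * mono_at p u)"
        by (rule laurent_at_superset) (use subG in auto)
      also have "\<dots> = (\<Sum>u\<in>expts F. coef F u * mono_at (\<lambda>j. p j * q j) u)
          - mono_at q s * (\<Sum>u\<in>expts F. coef F u * mono_at p u)"
        by (simp add: cG pq algebra_simps sum_subtractf sum_distrib_left)
      also have "\<dots> = laurent_at (\<lambda>j. p j * q j) F - mono_at q s * laurent_at p F"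
        by (simp add: laurent_at_def)
      also have "\<dots> = 0" using less.prems p q0 by simp
      finally show ?thesis .
    qed
    ultimately have "G = 0" by (rule less.hyps)
    then have "coef G t = 0" by simp
    then show False using cG[of t] ne t by (simp add: in_keys_iff)
  qed
qed

section \<open>The coordinate ring as a ring of Laurent polynomials\<close>

lemma has_top_unique: "has_top F s c \<Longrightarrow> has_top F s' c' \<Longrightarrow> c \<noteq> 0 \<Longrightarrow> c' \<noteq> 0 \<Longrightarrow> s = s'"
  unfolding has_top_def by (metis antisym in_keys_iff)

lemma has_top_add_lower:
  fixes F G :: "'b::linorder \<Rightarrow>\<^sub>0 'a::comm_monoid_add"
  assumes "has_top F s c" "\<And>t. t \<in> expts G \<Longrightarrow> t < s"
  shows "has_top (F + G) s c"
proof -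
  have "s \<notin> expts G" using assms(2) by blast
  moreover have "expts (F + G) \<subseteq> {..s}"
    using assms by (intro expts_add_subset) (auto simp: has_top_def intro: less_imp_le)
  ultimately show ?thesis using assms(1) by (auto simp: has_top_def lookup_add in_keys_iff)
qed

lemma has_top_power:
  fixes F :: "'b::linordered_ab_group_add \<Rightarrow>\<^sub>0 'a::comm_ring_1"
  shows "has_top F s c \<Longrightarrow> has_top (F ^ n) (\<Sum>i<n. s) (c ^ n)"
proof (induction n)
  case 0
  show ?case using has_top_mono[of 0 "1::'a"] by simp
next
  case (Suc n)
  then show ?case using has_top_mult[of F s c "F ^ n" "\<Sum>i<n. s" "c ^ n"]
    by (simp add: lessThan_Suc)
qed

abbreviation lift_poly :: "'a::comm_ring_1 poly \<Rightarrow> 'a laurent poly" where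
  "lift_poly Q \<equiv> map_poly (mon 0) Q"

definition unit_exp :: "nat \<Rightarrow> (nat \<Rightarrow>\<^sub>0 int)" where
  "unit_exp i = mon i 1"

definition z_exp :: "nat \<Rightarrow> (nat \<Rightarrow>\<^sub>0 int)" where
  "z_exp n = mon 0 (int n)"

abbreviation lvar :: "nat \<Rightarrow> 'a::comm_ring_1 laurent" where
  "lvar i \<equiv> mon (unit_exp i) 1"

lemma coef_unit_exp: "coef (unit_exp i) j = (if i = j then 1 else 0)"
  by (simp add: unit_exp_def lookup_single when_def)

lemma coef_z_exp: "coef (z_exp n) j = (if j = 0 then int n else 0)"
  by (simp add: z_exp_def lookup_single when_def del: single_of_nat)

lemma expts_unit_exp [simp]: "expts (unit_exp i) = {i}"
  by (simp add: unit_exp_def del: single_one)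

lemma expts_z_exp: "expts (z_exp n) \<subseteq> {0}"
  by (simp add: z_exp_def del: single_of_nat)

lemma z_exp_add: "z_exp a + z_exp b = z_exp (a + b)"
  by (simp add: z_exp_def single_add del: single_of_nat)

lemma z_exp_0 [simp]: "z_exp 0 = 0"
  by (simp add: z_exp_def)

lemma z_exp_1: "z_exp (Suc 0) = unit_exp 0"
  by (simp add: z_exp_def unit_exp_def)

lemma regular_funs_const: "(\<lambda>p\<in>X. c) \<in> regular_funs m X"
  unfolding regular_funs_def
  by (rule CollectI, rule exI[of _ "{\<lambda>_. 0}"], rule exI[of _ "\<lambda>_. c"]) simp

lemma regular_funs_monomial: "(\<lambda>p\<in>X. c * (\<Prod>i\<in>{0..m}. p i ^ e i)) \<in> regular_funs m X"
  unfolding regular_funs_def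
  by (rule CollectI, rule exI[of _ "{e}"], rule exI[of _ "\<lambda>_. c"]) simp

lemma regular_funs_add:
  assumes "f \<in> regular_funs m X" "g \<in> regular_funs m X"
  shows "(\<lambda>p\<in>X. f p + g p) \<in> regular_funs m X"
proof -
  obtain E c where E: "finite E" "f = (\<lambda>p\<in>X. \<Sum>e\<in>E. c e * (\<Prod>i\<in>{0..m}. p i ^ e i))"
    using assms(1) unfolding regular_funs_def by blast
  obtain E' c' where E': "finite E'" "g = (\<lambda>p\<in>X. \<Sum>e\<in>E'. c' e * (\<Prod>i\<in>{0..m}. p i ^ e i))"
    using assms(2) unfolding regular_funs_def by blast
  define d where "d e = (if e \<in> E then c e else 0) + (if e \<in> E' then c' e else 0)" for e
  have *: "(\<Sum>e\<in>E. c e * x e) + (\<Sum>e\<in>E'. c' e * x e) = (\<Sum>e\<in>E \<union> E'. d e * x e)" for x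
  proof -
    have "(\<Sum>e\<in>E. c e * x e) = (\<Sum>e\<in>E \<union> E'. (if e \<in> E then c e else 0) * x e)"
      by (rule sum.mono_neutral_cong_left) (use E E' in auto)
    moreover have "(\<Sum>e\<in>E'. c' e * x e) = (\<Sum>e\<in>E \<union> E'. (if e \<in> E' then c' e else 0) * x e)"
      by (rule sum.mono_neutral_cong_left) (use E E' in auto)
    ultimately show ?thesis by (simp add: d_def sum.distrib distrib_right)
  qed
  have "(\<lambda>p\<in>X. f p + g p) = (\<lambda>p\<in>X. \<Sum>e\<in>E \<union> E'. d e * (\<Prod>i\<in>{0..m}. p i ^ e i))"
    using * by (auto simp: E E' restrict_def)
  then show ?thesis
    unfolding regular_funs_def using E E' by (intro CollectI exI[of _ "E \<union> E'"] exI[of _ d]) auto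
qed

lemma regular_funs_sum:
  fixes X :: "(nat \<Rightarrow> 'a::field) set"
  assumes "finite J" "\<And>j. j \<in> J \<Longrightarrow> f j \<in> regular_funs m X"
  shows "(\<lambda>p\<in>X. \<Sum>j\<in>J. f j p) \<in> regular_funs m X"
  using assms
proof (induction J rule: finite_induct)
  case empty
  show ?case unfolding sum.empty by (rule regular_funs_const)
next
  case (insert x F)
  have "(\<lambda>p\<in>X. f x p + (\<lambda>p\<in>X. \<Sum>j\<in>F. f j p) p) \<in> regular_funs m X"
    using insert by (intro regular_funs_add) auto
  also have "(\<lambda>p\<in>X. f x p + (\<lambda>p\<in>X. \<Sum>j\<in>F. f j p) p) = (\<lambda>p\<in>X. \<Sum>j\<in>insert x F. f j p)"
    using insert by (auto simp: restrict_def)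
  finally show ?case .
qed

lemma regular_funs_mult:
  assumes "f \<in> regular_funs m X" "g \<in> regular_funs m X"
  shows "(\<lambda>p\<in>X. f p * g p) \<in> regular_funs m X"
proof -
  obtain E c where E: "finite E" "f = (\<lambda>p\<in>X. \<Sum>e\<in>E. c e * (\<Prod>i\<in>{0..m}. p i ^ e i))"
    using assms(1) unfolding regular_funs_def by blast
  obtain E' c' where E': "finite E'" "g = (\<lambda>p\<in>X. \<Sum>e\<in>E'. c' e * (\<Prod>i\<in>{0..m}. p i ^ e i))"
    using assms(2) unfolding regular_funs_def by blast
  have "(\<lambda>p\<in>X. f p * g p) = (\<lambda>p\<in>X. \<Sum>j\<in>E \<times> E'.
     (\<lambda>p\<in>X. (c (fst j) * c' (snd j)) * (\<Prod>i\<in>{0..m}. p i ^ (fst j i + snd j i))) p)"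
    by (rule restrict_ext, simp add: E E' sum_product sum.cartesian_product split_beta, rule sum.cong)
       (simp_all add: power_add prod.distrib mult_ac)
  also have "\<dots> \<in> regular_funs m X"
    using E E' by (intro regular_funs_sum regular_funs_monomial) auto
  finally show ?thesis .
qed

lemma coord_fun_regular:
  assumes "i \<le> m"
  shows "coord_fun X i \<in> regular_funs m X"
proof -
  have eq: "(\<lambda>p\<in>X. 1 * (\<Prod>j\<in>{0..m}. p j ^ (if j = i then 1 else 0))) = coord_fun X i"
  proof -
    have "(\<Prod>j\<in>{0..m}. p j ^ (if j = i then 1 else 0)) = p i" for p :: "nat \<Rightarrow> 'a"
    proof -
      have "(\<Prod>j\<in>{0..m}. p j ^ (if j = i then 1 else 0)) = (\<Prod>j\<in>{0..m}. if j = i then p j else 1)"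
        by (rule prod.cong) auto
      also have "\<dots> = p i" using assms by (subst prod.delta) auto
      finally show ?thesis .
    qed
    then show ?thesis by (auto simp: coord_fun_def restrict_def)
  qed
  show ?thesis unfolding eq[symmetric] by (rule regular_funs_monomial)
qed

locale suspension =
  fixes P :: "'a::{alg_closed_field, field_char_0} poly" and m :: nat and k :: "nat \<Rightarrow> nat"
  assumes m_ge_2: "m \<ge> 2"
    and k_ge_2: "\<forall>j\<in>{2..m}. k j \<ge> 2"
    and P_monic: "lead_coeff P = 1"
    and d_ge_2: "degree P \<ge> 2"
    and P_coeff: "coeff P (degree P - 1) = 0"
begin

abbreviation Y :: "(nat \<Rightarrow> 'a) set" where "Y \<equiv> Y_var m k P"
abbreviation d :: nat where "d \<equiv> degree P"
definition idx :: "nat set" where "idx = insert 0 {2..m}"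
definition kvec :: "nat \<Rightarrow>\<^sub>0 int" where "kvec = (\<Sum>j\<in>{2..m}. mon j (int (k j)))"
definition y1 :: "'a laurent" where "y1 = mon (- kvec) 1 * poly (lift_poly P) (lvar 0)"
definition M :: "(nat \<Rightarrow> 'a) \<Rightarrow> 'a" where "M p = (\<Prod>j\<in>{2..m}. p j ^ k j)"

lemma finite_idx [simp]: "finite idx" by (simp add: idx_def)
lemma idx_simps [simp]: "0 \<in> idx" "j \<in> {2..m} \<Longrightarrow> j \<in> idx" "Suc 0 \<notin> idx" by (auto simp: idx_def)

lemma coef_kvec: "coef kvec j = (if j \<in> {2..m} then int (k j) else 0)"
  by (simp add: kvec_def lookup_sum lookup_single when_def)

lemma coef_kvec_0 [simp]: "coef kvec 0 = 0" by (simp add: coef_kvec)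

lemma Y_iff: "p \<in> Y \<longleftrightarrow> p \<in> extensional {0..m} \<and> p 1 * M p = poly P (p 0)"
  by (auto simp: Y_var_def affine_pts_def PiE_def y_monomial_def M_def)

lemma expts_kvec: "expts kvec \<subseteq> {2..m}"
  by (auto simp: in_keys_iff coef_kvec split: if_splits)

definition supported :: "(nat \<Rightarrow>\<^sub>0 int) set" where
  "supported = {s. expts s \<subseteq> idx \<and> coef s 0 \<ge> 0}"

lemma supported_closed: "0 \<in> supported" "s \<in> supported \<Longrightarrow> t \<in> supported \<Longrightarrow> s + t \<in> supported"
  using keys_add[of s t] by (auto simp: supported_def lookup_add)

lemma unit_exp_supported: "i \<in> idx \<Longrightarrow> unit_exp i \<in> supported"
  by (auto simp: supported_def coef_unit_exp)

lemma neg_kvec_supported: "- kvec \<in> supported"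
  using expts_kvec by (auto simp: supported_def idx_def)

lemma expts_poly_subset:
  assumes "\<And>i. expts (coeff Q i) \<subseteq> S" "expts x \<subseteq> S" "\<And>s t. s \<in> S \<Longrightarrow> t \<in> S \<Longrightarrow> s + t \<in> S"
  shows "expts (poly Q x) \<subseteq> S"
  using assms(1)
proof (induction Q)
  case 0
  then show ?case by simp
next
  case (pCons a Q)
  have "expts (coeff Q i) \<subseteq> S" for i using pCons.prems[of "Suc i"] by simp
  moreover have "expts a \<subseteq> S" using pCons.prems[of 0] by simp
  ultimately have "expts (a + x * poly Q x) \<subseteq> S"
    using pCons.IH by (intro expts_add_subset expts_mult_subset assms) auto
  then show ?case by simp
qed

lemma y1_supported: "expts y1 \<subseteq> supported"
  unfolding y1_def using supported_closed neg_kvec_supported unit_exp_supported[of 0]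
  by (intro expts_mult_subset expts_mono_subset expts_poly_subset) (auto simp: coeff_map_poly split: if_splits)

text \<open>\<open>rep f F\<close> relates a regular function to the Laurent polynomial obtained by substituting
  \<open>P(z) / M\<close> for \<open>y\<^sub>1\<close>. It is generated as a relation because a function alone does not determine how it
  is built from the coordinates; that it is a bijection is proved below.\<close>

inductive rep :: "((nat \<Rightarrow> 'a) \<Rightarrow> 'a) \<Rightarrow> 'a laurent \<Rightarrow> bool" where
  rep_const: "rep (\<lambda>p\<in>Y. c) (mon 0 c)"
| rep_coord: "i \<in> idx \<Longrightarrow> rep (coord_fun Y i) (lvar i)"
| rep_y1: "rep (coord_fun Y 1) y1"
| rep_add: "rep f F \<Longrightarrow> rep g G \<Longrightarrow> rep (\<lambda>p\<in>Y. f p + g p) (F + G)"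
| rep_mult: "rep f F \<Longrightarrow> rep g G \<Longrightarrow> rep (\<lambda>p\<in>Y. f p * g p) (F * G)"

lemma rep_extensional: "rep f F \<Longrightarrow> f \<in> extensional Y"
  unfolding coord_fun_def by (induction rule: rep.induct) (unfold coord_fun_def, (rule restrict_extensional)+)

lemma rep_cong:
  assumes "rep f F" "\<And>p. p \<in> Y \<Longrightarrow> f p = g p"
  shows "rep (restrict g Y) F"
proof -
  have "f = restrict g Y"
    using rep_extensional[OF assms(1)] assms(2) by (intro ext) (auto simp: extensional_def)
  then show ?thesis using assms(1) by simp
qed

lemma rep_supported: "rep f F \<Longrightarrow> expts F \<subseteq> supported"
proof (induction rule: rep.induct)
  case rep_y1
  show ?case by (rule y1_supported)
qed (intro expts_add_subset expts_mult_subset expts_mono_subset supported_closed unit_exp_supported; assumption)+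

lemma rep_sum: "finite J \<Longrightarrow> (\<And>j. j \<in> J \<Longrightarrow> rep (f j) (F j)) \<Longrightarrow> rep (\<lambda>p\<in>Y. \<Sum>j\<in>J. f j p) (\<Sum>j\<in>J. F j)"
proof (induction J rule: finite_induct)
  case empty
  show ?case using rep_const[of 0] by (simp only: sum.empty single_zero)
next
  case (insert x J)
  have "rep (\<lambda>p\<in>Y. \<Sum>j\<in>insert x J. f j p) (F x + sum F J)"
    by (rule rep_cong[OF rep_add[OF insert(4)[of x] insert(3)]]) (use insert in auto)
  then show ?case unfolding sum.insert[OF insert(1,2), of F] .
qed

lemma rep_power: "rep f F \<Longrightarrow> rep (\<lambda>p\<in>Y. f p ^ n) (F ^ n)"
proof (induction n)
  case 0
  show ?case using rep_const[of 1] by (simp only: power_0 single_one)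
next
  case (Suc n)
  have "rep (\<lambda>p\<in>Y. f p ^ Suc n) (F * F ^ n)"
    by (rule rep_cong[OF rep_mult[OF Suc(2) Suc(1)]]) (use Suc in auto)
  then show ?case unfolding power_Suc[of F] .
qed

lemma rep_prod: "finite J \<Longrightarrow> (\<And>j. j \<in> J \<Longrightarrow> rep (f j) (F j)) \<Longrightarrow> rep (\<lambda>p\<in>Y. \<Prod>j\<in>J. f j p) (\<Prod>j\<in>J. F j)"
proof (induction J rule: finite_induct)
  case empty
  show ?case using rep_const[of 1] by (simp only: prod.empty single_one)
next
  case (insert x J)
  have "rep (\<lambda>p\<in>Y. \<Prod>j\<in>insert x J. f j p) (F x * prod F J)"
    by (rule rep_cong[OF rep_mult[OF insert(4)[of x] insert(3)]]) (use insert in auto)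
  then show ?case unfolding prod.insert[OF insert(1,2), of F] .
qed

definition coord_laurent :: "nat \<Rightarrow> 'a laurent" where
  "coord_laurent i = (if i = 1 then y1 else lvar i)"

lemma rep_coord_laurent: "i \<le> m \<Longrightarrow> rep (coord_fun Y i) (coord_laurent i)"
  unfolding coord_laurent_def using rep_y1 rep_coord[of i]
  by (cases "i = 1"; cases "i = 0") (auto simp: idx_def)

lemma rep_regular_iff: "f \<in> regular_funs m Y \<longleftrightarrow> (\<exists>F. rep f F)"
proof
  assume "f \<in> regular_funs m Y"
  then obtain E c where E: "finite E" "f = (\<lambda>p\<in>Y. \<Sum>e\<in>E. c e * (\<Prod>i\<in>{0..m}. p i ^ e i))"
    unfolding regular_funs_def by blast
  have 1: "rep (\<lambda>p\<in>Y. \<Sum>e\<in>E. (\<lambda>p\<in>Y. (\<lambda>p\<in>Y. c e) p * (\<lambda>p\<in>Y. (\<Prod>i\<in>{0..m}. (\<lambda>p\<in>Y. coord_fun Y i p ^ e i) p)) p) p)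
     (\<Sum>e\<in>E. mon 0 (c e) * (\<Prod>i\<in>{0..m}. coord_laurent i ^ e i))"
    by (rule rep_sum[OF E(1)], rule rep_mult[OF rep_const rep_prod], simp, rule rep_power, rule rep_coord_laurent) simp
  have "rep f (\<Sum>e\<in>E. mon 0 (c e) * (\<Prod>i\<in>{0..m}. coord_laurent i ^ e i))"
    unfolding E(2) by (rule rep_cong[OF 1]) (simp add: coord_fun_def)
  then show "\<exists>F. rep f F" ..
next
  assume "\<exists>F. rep f F"
  then obtain F where "rep f F" ..
  then show "f \<in> regular_funs m Y"
  proof (induction rule: rep.induct)
    case (rep_coord i)
    then show ?case using m_ge_2 by (intro coord_fun_regular) (auto simp: idx_def)
  qed (use m_ge_2 in \<open>simp_all only: regular_funs_add regular_funs_mult regular_funs_const coord_fun_regular\<close>)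
qed

lemma supported_defined_at: "(\<And>j. j \<in> {2..m} \<Longrightarrow> p j \<noteq> 0) \<Longrightarrow> supported \<subseteq> defined_at p"
proof
  fix s assume p: "\<And>j. j \<in> {2..m} \<Longrightarrow> p j \<noteq> 0" and s: "s \<in> supported"
  show "s \<in> defined_at p" unfolding defined_at_def
  proof safe
    fix i assume "p i = 0"
    then have "i = 0 \<or> i \<notin> expts s" using p s by (auto simp: supported_def idx_def)
    then show "coef s i \<ge> 0" using s by (auto simp: supported_def in_keys_iff)
  qed
qed

lemma mono_at_unit_exp [simp]: "mono_at p (unit_exp i) = p i"
  by (simp add: mono_at_def coef_unit_exp)

lemma mono_at_kvec: "mono_at p kvec = M p"
proof -
  have "mono_at p kvec = (\<Prod>j\<in>{2..m}. p j powi coef kvec j)"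
    by (rule mono_at_superset) (use expts_kvec in auto)
  then show ?thesis by (simp add: M_def coef_kvec)
qed

lemma laurent_at_zpoly:
  fixes Q :: "'a poly"
  shows "laurent_at p (poly (lift_poly Q) (lvar 0)) = poly Q (p 0)"
proof (induction Q)
  case (pCons a Q)
  let ?S = "{s. \<forall>i. coef s i \<ge> 0} :: (nat \<Rightarrow>\<^sub>0 int) set"
  have sub: "?S \<subseteq> defined_at p" by (auto simp: defined_at_def)
  have "unit_exp 0 \<in> ?S" by (simp add: coef_unit_exp)
  then have "expts (poly (lift_poly Q) (lvar 0 :: 'a laurent)) \<subseteq> ?S"
    by (intro expts_poly_subset) (auto simp: coeff_map_poly lookup_add split: if_splits)
  moreover have "expts (lvar 0 :: 'a laurent) \<subseteq> ?S" by (simp add: coef_unit_exp)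
  ultimately have "laurent_at p (lvar 0 * poly (lift_poly Q) (lvar 0)) = p 0 * poly Q (p 0)"
    using sub pCons by (subst laurent_at_mult) auto
  then show ?case
    by (simp add: map_poly_pCons laurent_at_add)
qed simp

lemma laurent_at_rep:
  assumes "rep f F" "p \<in> Y" "\<And>j. j \<in> {2..m} \<Longrightarrow> p j \<noteq> 0"
  shows "f p = laurent_at p F"
  using assms(1)
proof (induction rule: rep.induct)
  case rep_y1
  have "expts (mon (- kvec) 1 :: 'a laurent) \<subseteq> supported"
    using neg_kvec_supported by (rule expts_mono_subset)
  moreover have "expts (poly (lift_poly P) (lvar 0 :: 'a laurent)) \<subseteq> supported"
    using supported_closed unit_exp_supported[of 0]
    by (intro expts_poly_subset expts_mono_subset) (auto simp: coeff_map_poly split: if_splits)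
  moreover note sub = supported_defined_at[of p]
  ultimately have "laurent_at p y1 = mono_at p (- kvec) * poly P (p 0)"
    using assms(3) unfolding y1_def by (subst laurent_at_mult) (auto simp: laurent_at_zpoly)
  moreover have "mono_at p (- kvec) * mono_at p kvec = 1"
  proof -
    have "kvec \<in> supported" using expts_kvec by (auto simp: supported_def idx_def)
    then have "mono_at p (- kvec + kvec) = mono_at p (- kvec) * mono_at p kvec"
      using sub assms(3) neg_kvec_supported by (intro mono_at_add) auto
    then show ?thesis by simp
  qed
  ultimately show ?case using assms(2) by (simp add: Y_iff coord_fun_def mono_at_kvec mult_ac)
     (metis mult.left_commute mult.right_neutral)
next
  case (rep_mult f F g G)
  have "expts F \<subseteq> defined_at p" "expts G \<subseteq> defined_at p"
    using rep_supported[OF rep_mult(1)] rep_supported[OF rep_mult(2)]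
      supported_defined_at[of p, OF assms(3)] by auto
  then show ?case using rep_mult assms(2) by (simp add: laurent_at_mult)
qed (use assms in \<open>auto simp: coord_fun_def laurent_at_add\<close>)

subsection \<open>Expansion in powers of \<open>y\<^sub>1\<close>\<close>

text \<open>The function and its Laurent polynomial are expanded with the same coefficients. The Laurent
  polynomial determines the coefficients, and these determine the function at all points of \<open>Y\<close>,
  including those where some \<open>y\<^sub>j\<close> vanishes.\<close>

definition low :: "(nat \<Rightarrow>\<^sub>0 int) set" where
  "low = {s. expts s \<subseteq> idx \<and> (\<forall>i. coef s i \<ge> 0) \<and> coef s 0 < int d}"

definition expansion :: "((nat \<Rightarrow> 'a) \<Rightarrow> 'a) \<Rightarrow> 'a laurent \<Rightarrow> nat \<Rightarrow> (nat \<Rightarrow> 'a laurent) \<Rightarrow> bool" where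
  "expansion f F N R \<longleftrightarrow> (\<forall>a. expts (R a) \<subseteq> low) \<and> (\<forall>a\<ge>N. R a = 0) \<and>
     F = (\<Sum>a<N. y1 ^ a * R a) \<and> (\<forall>p\<in>Y. f p = (\<Sum>a<N. p 1 ^ a * laurent_at p (R a)))"

definition expands :: "((nat \<Rightarrow> 'a) \<Rightarrow> 'a) \<Rightarrow> 'a laurent \<Rightarrow> bool" where
  "expands f F \<longleftrightarrow> (\<exists>N R. expansion f F N R)"

lemma expansion_mono:
  assumes "expansion f F N R" "N \<le> N'"
  shows "expansion f F N' R"
proof -
  have *: "(\<Sum>a<N. h a) = (\<Sum>a<N'. h a)" if "\<And>a. a \<ge> N \<Longrightarrow> h a = 0" for h :: "nat \<Rightarrow> 'b::comm_monoid_add"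
    using assms(2) that by (intro sum.mono_neutral_left) auto
  have "(\<Sum>a<N. y1 ^ a * R a) = (\<Sum>a<N'. y1 ^ a * R a)"
    using assms(1) by (intro *) (simp add: expansion_def)
  moreover have "(\<Sum>a<N. p 1 ^ a * laurent_at p (R a)) = (\<Sum>a<N'. p 1 ^ a * laurent_at p (R a))" for p
    using assms(1) by (intro *) (simp add: expansion_def)
  ultimately show ?thesis using assms unfolding expansion_def by auto
qed

lemma expands_add:
  assumes "expands f F" "expands g G"
  shows "expands (\<lambda>p. f p + g p) (F + G)"
proof -
  obtain N R where 1: "expansion f F N R" using assms(1) by (auto simp: expands_def)
  obtain N' R' where 2: "expansion g G N' R'" using assms(2) by (auto simp: expands_def)
  have 1: "expansion f F (max N N') R" and 2: "expansion g G (max N N') R'"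
    using 1 2 by (auto intro: expansion_mono)
  have "expansion (\<lambda>p. f p + g p) (F + G) (max N N') (\<lambda>a. R a + R' a)"
    using 1 2 unfolding expansion_def
    by (simp add: distrib_left sum.distrib laurent_at_add expts_add_subset)
  then show ?thesis unfolding expands_def by blast
qed

lemma expands_cong:
  assumes "expands f F" "\<And>p. p \<in> Y \<Longrightarrow> f p = g p"
  shows "expands g F"
proof -
  obtain N R where "expansion f F N R" using assms(1) by (auto simp: expands_def)
  then have "expansion g F N R" using assms(2) by (simp add: expansion_def)
  then show ?thesis unfolding expands_def by blast
qed

lemma expands_low: "expts R \<subseteq> low \<Longrightarrow> expands (\<lambda>p. laurent_at p R) R"
  unfolding expands_def expansion_def
  by (rule exI[of _ 1], rule exI[of _ "\<lambda>a. if a = 0 then R else 0"]) auto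

lemma expands_sum:
  "finite J \<Longrightarrow> (\<And>j. j \<in> J \<Longrightarrow> expands (f j) (F j)) \<Longrightarrow> expands (\<lambda>p. \<Sum>j\<in>J. f j p) (\<Sum>j\<in>J. F j)"
  by (induction J rule: finite_induct) (use expands_low[of 0] in \<open>auto intro: expands_add\<close>)

lemma expands_y1:
  assumes "expands f F"
  shows "expands (\<lambda>p. p 1 * f p) (y1 * F)"
proof -
  obtain N R where 1: "expansion f F N R" using assms(1) by (auto simp: expands_def)
  have "expansion (\<lambda>p. p 1 * f p) (y1 * F) (Suc N) (case_nat 0 R)"
    using 1 unfolding expansion_def
    by (auto simp: sum.lessThan_Suc_shift sum_distrib_left mult_ac split: nat.split
          simp del: sum.lessThan_Suc)
  then show ?thesis unfolding expands_def by blast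
qed

lemma expands_y1_power: "expands f F \<Longrightarrow> expands (\<lambda>p. p 1 ^ n * f p) (y1 ^ n * F)"
  by (induction n) (auto dest: expands_y1 simp: mult_ac)

definition nonneg :: "(nat \<Rightarrow>\<^sub>0 int) set" where
  "nonneg = {s. expts s \<subseteq> idx \<and> (\<forall>i. coef s i \<ge> 0)}"

lemma nonneg_closed: "0 \<in> nonneg" "s \<in> nonneg \<Longrightarrow> t \<in> nonneg \<Longrightarrow> s + t \<in> nonneg"
  using keys_add[of s t] by (auto simp: nonneg_def lookup_add)

lemma nonneg_defined_at: "nonneg \<subseteq> defined_at p"
  by (auto simp: nonneg_def defined_at_def)

lemma low_nonneg: "low \<subseteq> nonneg" by (auto simp: low_def nonneg_def)

lemma low_add: "s \<in> low \<Longrightarrow> t \<in> nonneg \<Longrightarrow> coef t 0 = 0 \<Longrightarrow> s + t \<in> low"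
  using keys_add[of s t] by (auto simp: nonneg_def low_def lookup_add)

lemma unit_exp_nonneg: "i \<in> idx \<Longrightarrow> unit_exp i \<in> nonneg"
  by (auto simp: nonneg_def coef_unit_exp)

lemma kvec_nonneg: "kvec \<in> nonneg"
  using expts_kvec by (auto simp: nonneg_def coef_kvec idx_def)

lemma expands_mult_mono:
  assumes "expands f F" "t \<in> nonneg" "coef t 0 = 0"
  shows "expands (\<lambda>p. f p * (c * mono_at p t)) (F * mon t c)"
proof -
  obtain N R where 1: "expansion f F N R" using assms(1) by (auto simp: expands_def)
  have 2: "expts (R a * mon t c) \<subseteq> low" for a
  proof
    fix x assume "x \<in> expts (R a * mon t c)"
    then obtain u v where "x = u + v" "u \<in> expts (R a)" "v \<in> expts (mon t c)"
      using keys_mult[of "R a" "mon t c"] by blast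
    then show "x \<in> low" using 1 assms
      by (auto simp: expansion_def intro!: low_add split: if_splits)
  qed
  have 3: "laurent_at p (R a * mon t c) = laurent_at p (R a) * (c * mono_at p t)" for p a
    by (subst laurent_at_mult)
       (use 1 assms low_nonneg nonneg_defined_at[of p] in \<open>auto simp: expansion_def split: if_splits\<close>)
  have "expansion (\<lambda>p. f p * (c * mono_at p t)) (F * mon t c) N (\<lambda>a. R a * mon t c)"
    using 1 2 unfolding expansion_def by (simp add: sum_distrib_right mult.assoc 3)
  then show ?thesis unfolding expands_def by blast
qed

lemma zpoly_eq_sum:
  fixes Q :: "'a poly"
  shows "poly (lift_poly Q) (lvar 0) = (\<Sum>i\<le>degree Q. mon (z_exp i) (coeff Q i))"
proof -
  have "(\<Sum>j<i. unit_exp 0) = z_exp i" for i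
    by (induction i) (simp_all add: lessThan_Suc z_exp_add del: sum_constant flip: z_exp_1)
  moreover have "degree (lift_poly Q) = degree Q"
  proof -
    have "mon 0 c = (0::'a laurent) \<longleftrightarrow> c = 0" for c
      by (metis inj_single injD single_zero)
    then show ?thesis by (intro degree_map_poly) metis+
  qed
  ultimately show ?thesis
    by (auto simp: poly_altdef coeff_map_poly mono_power mult_single intro!: sum.cong)
qed

lemma mono_at_z: "mono_at p (z_exp i) = p 0 ^ i"
  by (cases "i = 0") (simp_all add: mono_at_def z_exp_def del: single_of_nat)

lemma mon_z_low: "i < d \<Longrightarrow> z_exp i \<in> low"
  using expts_z_exp[of i] by (auto simp: low_def coef_z_exp)

text \<open>Only the degree \<open>d\<close> in \<open>z\<close> leaves the range of the coefficients, and there \<open>z\<^sup>d\<close> is \<open>y\<^sub>1 M\<close> minus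
  the lower terms of \<open>P\<close>.\<close>

lemma expands_z_mon:
  assumes "s \<in> low"
  shows "expands (\<lambda>p. p 0 * (c * mono_at p s)) (lvar 0 * mon s c)"
proof (cases "coef s 0 + 1 < int d")
  case True
  then have "unit_exp 0 + s \<in> low"
    using assms keys_add[of "unit_exp 0" s] by (auto simp: low_def lookup_add coef_unit_exp)
  then have "expts (mon (unit_exp 0 + s) c) \<subseteq> low" by (rule expts_mono_subset)
  then have *: "expands (\<lambda>p. laurent_at p (mon (unit_exp 0 + s) c)) (mon (unit_exp 0 + s) c)"
    by (rule expands_low)
  have "laurent_at p (mon (unit_exp 0 + s) c) = p 0 * (c * mono_at p s)" for p
    using assms low_nonneg nonneg_defined_at[of p] unit_exp_nonneg[of 0]
    by (simp add: mono_at_add subset_iff)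
  moreover have "lvar 0 * mon s c = mon (unit_exp 0 + s) c" by (simp add: mult_single)
  ultimately show ?thesis using * by (simp del: laurent_at_mono)
next
  case False
  define t where "t = s - z_exp (d - 1)"
  have s: "s = z_exp (d - 1) + t" by (simp add: t_def)
  have s0: "coef s 0 = int (d - 1)"
    using False assms d_ge_2 by (auto simp: low_def)
  have ct: "coef t i = (if i = 0 then 0 else coef s i)" for i
    by (auto simp: t_def lookup_minus coef_z_exp s0)
  have t: "t \<in> nonneg" "coef t 0 = 0"
    using assms by (auto simp: nonneg_def ct low_def in_keys_iff split: if_splits)
  let ?L = "\<Sum>i<d. mon (z_exp i) (- coeff P i)"
  have L: "expts ?L \<subseteq> low"
    by (intro expts_sum_subset expts_mono_subset mon_z_low) auto
  have P: "poly (lift_poly P) (lvar 0) = mon (z_exp d) 1 - ?L"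
    unfolding zpoly_eq_sum lessThan_Suc_atMost[symmetric]
    using P_monic by (simp add: single_uminus sum_negf)
  have eq: "lvar 0 * mon s c = y1 * (mon 0 1 * mon (kvec + t) c) + ?L * mon t c"
  proof -
    have "y1 * (mon 0 1 * mon (kvec + t) c) = poly (lift_poly P) (lvar 0) * mon t c"
      by (simp add: y1_def mult_single mult_ac flip: mult.assoc)
    also have "\<dots> = mon (z_exp d) 1 * mon t c - ?L * mon t c"
      by (simp add: P left_diff_distrib)
    also have "mon (z_exp d) 1 * mon t c = lvar 0 * mon s c"
    proof -
      have "z_exp d + t = unit_exp 0 + s"
        using d_ge_2 by (simp add: s add.assoc[symmetric] z_exp_add flip: z_exp_1)
      then show ?thesis by (simp add: mult_single)
    qed
    finally show ?thesis by simp
  qed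
  have e1: "expands (\<lambda>p. p 1 * (laurent_at p (mon 0 1) * (c * mono_at p (kvec + t)))) (y1 * (mon 0 1 * mon (kvec + t) c))"
    using t kvec_nonneg mon_z_low[of 0] d_ge_2
    by (intro expands_y1 expands_mult_mono expands_low expts_mono_subset nonneg_closed) (auto simp: lookup_add)
  have e2: "expands (\<lambda>p. laurent_at p ?L * (c * mono_at p t)) (?L * mon t c)"
    using t L by (intro expands_mult_mono expands_low)
  have "p 1 * (c * mono_at p (kvec + t)) + laurent_at p ?L * (c * mono_at p t) = p 0 * (c * mono_at p s)"
    if p: "p \<in> Y" for p
  proof -
    have def: "kvec \<in> defined_at p" "t \<in> defined_at p" "z_exp (d - 1) \<in> defined_at p"
      using t kvec_nonneg nonneg_defined_at[of p] mon_z_low[of "d - 1"] low_nonneg d_ge_2 by auto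
    have Lp: "laurent_at p ?L = p 0 ^ d - poly P (p 0)"
    proof -
      have "poly P (p 0) = (\<Sum>i<Suc d. coeff P i * p 0 ^ i)"
        by (simp add: poly_altdef lessThan_Suc_atMost)
      then show ?thesis using P_monic by (simp add: laurent_at_sum mono_at_z sum_negf)
    qed
    have "p 0 * mono_at p s = p 0 ^ d * mono_at p t"
      unfolding s using def d_ge_2 by (simp add: mono_at_add mono_at_z flip: power_Suc mult.assoc)
    moreover have "p 1 * (c * mono_at p (kvec + t)) = poly P (p 0) * (c * mono_at p t)"
      using p def by (simp add: mono_at_add mono_at_kvec Y_iff mult_ac)
    ultimately show ?thesis by (simp add: Lp algebra_simps)
  qed
  then show ?thesis unfolding eq
    by (intro expands_cong[OF expands_add[OF e1 e2], of "\<lambda>p. p 0 * (c * mono_at p s)"]) simp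
qed

lemma expands_z:
  assumes "expands f F"
  shows "expands (\<lambda>p. p 0 * f p) (lvar 0 * F)"
proof -
  have low: "expands (\<lambda>p. p 0 * laurent_at p R) (lvar 0 * R)" if "expts R \<subseteq> low" for R
    using that
  proof (induction R rule: laurent_induct)
    case zero
    then show ?case using expands_low[of 0] by simp
  next
    case (mon s c)
    then show ?case using expands_z_mon by simp
  next
    case (add R R')
    then show ?case using expands_add[OF add(3,4)] by (simp add: laurent_at_add distrib_left)
  qed
  obtain N R where 1: "expansion f F N R" using assms(1) by (auto simp: expands_def)
  have "expands (\<lambda>p. \<Sum>a<N. p 1 ^ a * (p 0 * laurent_at p (R a))) (\<Sum>a<N. y1 ^ a * (lvar 0 * R a))"
    using 1 by (intro expands_sum expands_y1_power low) (auto simp: expansion_def)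
  moreover have "(\<Sum>a<N. y1 ^ a * (lvar 0 * R a)) = lvar 0 * F"
  proof -
    have "F = (\<Sum>a<N. y1 ^ a * R a)" using 1 by (simp add: expansion_def)
    then show ?thesis by (simp only: sum_distrib_left mult.left_commute)
  qed
  moreover have "(\<Sum>a<N. p 1 ^ a * (p 0 * laurent_at p (R a))) = p 0 * f p" if "p \<in> Y" for p
  proof -
    have "f p = (\<Sum>a<N. p 1 ^ a * laurent_at p (R a))" using 1 that by (simp add: expansion_def)
    then show ?thesis by (simp only: sum_distrib_left mult.left_commute)
  qed
  ultimately show ?thesis by (metis (no_types, lifting) expands_cong)
qed

text \<open>Being closed under multiplication by the generators, expansions are closed under multiplication
  by every regular function; apply this to the constant \<open>1\<close>.\<close>

lemma rep_expands:
  assumes "rep f F"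
  shows "expands f F"
proof -
  have "expands (\<lambda>p. g p * f p) (G * F)" if "expands g G" for g G
    using assms that
  proof (induction arbitrary: g G rule: rep.induct)
    case (rep_const c)
    have "expands (\<lambda>p. g p * (c * mono_at p 0)) (G * mon 0 c)"
      by (rule expands_mult_mono[OF rep_const nonneg_closed(1)]) simp
    then show ?case by (rule expands_cong) simp
  next
    case (rep_coord i)
    show ?case
    proof (cases "i = 0")
      case True
      have eq: "G * lvar i = lvar 0 * G" by (simp add: True mult.commute)
      show ?thesis unfolding eq using expands_z[OF rep_coord(2)]
        by (rule expands_cong[of "\<lambda>p. p 0 * g p"]) (simp add: True mult.commute coord_fun_def)
    next
      case False
      then have "expands (\<lambda>p. g p * (1 * mono_at p (unit_exp i))) (G * lvar i)"
        using expands_mult_mono[OF rep_coord(2) unit_exp_nonneg[OF rep_coord(1)], of 1]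
        by (simp add: coef_unit_exp)
      then show ?thesis by (rule expands_cong) (simp add: coord_fun_def)
    qed
  next
    case rep_y1
    have eq: "G * y1 = y1 * G" by (simp add: mult.commute)
    show ?case unfolding eq using expands_y1[OF rep_y1]
        by (rule expands_cong[of "\<lambda>p. p 1 * g p"]) (simp add: mult.commute coord_fun_def)
  next
    case (rep_add f F h H)
    show ?case unfolding distrib_left[of G]
      using expands_add[OF rep_add(3)[OF rep_add(5)] rep_add(4)[OF rep_add(5)]]
      by (rule expands_cong) (simp add: distrib_left)
  next
    case (rep_mult f F h H)
    show ?case unfolding mult.assoc[of G, symmetric]
      using rep_mult(4)[OF rep_mult(3)[OF rep_mult(5)]]
      by (rule expands_cong) (simp add: mult.assoc)
  qed
  note mult = this
  have "expts (mon 0 1 :: 'a laurent) \<subseteq> low"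
    using mon_z_low[of 0] d_ge_2 by (intro expts_mono_subset) simp
  from mult[OF expands_low[OF this]] show ?thesis by simp
qed

lemma y1_top: "has_top y1 (z_exp d - kvec) 1"
proof -
  have "has_top (mon (z_exp d) 1 + (\<Sum>i<d. mon (z_exp i) (coeff P i))) (z_exp d) 1"
  proof (rule has_top_add_lower[OF has_top_mono])
    fix t assume "t \<in> expts (\<Sum>i<d. mon (z_exp i) (coeff P i))"
    moreover have "expts (\<Sum>i<d. mon (z_exp i) (coeff P i)) \<subseteq> {t. coef t 0 < int d}"
      by (intro expts_sum_subset expts_mono_subset) (auto simp: coef_z_exp)
    ultimately show "t < z_exp d" by (intro lex_less) (auto simp: coef_z_exp)
  qed
  moreover have "poly (lift_poly P) (lvar 0) = mon (z_exp d) 1 + (\<Sum>i<d. mon (z_exp i) (coeff P i))"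
    unfolding zpoly_eq_sum lessThan_Suc_atMost[symmetric] using P_monic by simp
  ultimately have "has_top (poly (lift_poly P) (lvar 0)) (z_exp d) (1::'a)" by simp
  from has_top_mult[OF has_top_mono this, of "-kvec" 1] show ?thesis
    by (simp add: y1_def)
qed

lemma coef_sum_const: "coef (\<Sum>i<n. s) j = int n * coef s j"
  by (induction n) (auto simp: lookup_add algebra_simps)

text \<open>The exponents of \<open>y\<^sub>1\<^sup>a R\<^sub>a\<close> have degree in \<open>z\<close> less than \<open>(a + 1) d\<close>, and its leading exponent has degree at
  least \<open>a d\<close>, so the leading terms for different \<open>a\<close> do not interfere.\<close>

lemma expansion_top:
  assumes "expansion f F N R" and nz: "R b \<noteq> 0"
  obtains a s c where "has_top F ((\<Sum>i<a. z_exp d - kvec) + s) c" "c \<noteq> 0" "s \<in> low"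
    "b \<le> a"
proof -
  define a where "a = Max {a. R a \<noteq> 0}"
  have lt_N: "i < N" if "R i \<noteq> 0" for i
    using assms(1) that unfolding expansion_def by (meson not_le_imp_less)
  have fin: "finite {a. R a \<noteq> 0}"
    by (rule finite_subset[of _ "{..<N}"]) (use lt_N in auto)
  have a: "R a \<noteq> 0" "b \<le> a" "\<And>i. i > a \<Longrightarrow> R i = 0"
    using nz Max_in[OF fin] Max_ge[OF fin] unfolding a_def by (blast, blast, meson leD mem_Collect_eq)
  have aN: "a < N" using lt_N a(1) .
  have F: "F = y1 ^ a * R a + (\<Sum>i<a. y1 ^ i * R i)"
  proof -
    have "F = (\<Sum>i<N. y1 ^ i * R i)" using assms by (simp add: expansion_def)
    also have "\<dots> = (\<Sum>i<Suc a. y1 ^ i * R i)"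
      using aN a(3) by (intro sum.mono_neutral_right) auto
    finally show ?thesis by simp
  qed
  obtain s c where s: "has_top (R a) s c" "c \<noteq> 0" "s \<in> expts (R a)"
    using has_top_exists[OF a(1)] .
  have slow: "s \<in> low" using s(3) assms(1) by (auto simp: expansion_def)
  have "has_top (y1 ^ a * R a) ((\<Sum>i<a. z_exp d - kvec) + s) c"
    using has_top_mult[OF has_top_power[OF y1_top, of a] s(1)] by simp
  then have "has_top F ((\<Sum>i<a. z_exp d - kvec) + s) c"
    unfolding F
  proof (rule has_top_add_lower)
    fix t assume "t \<in> expts (\<Sum>i<a. y1 ^ i * R i)"
    then obtain i where i: "i < a" "t \<in> expts (y1 ^ i * R i)"
      using expts_sum_subset[of "{..<a}" "\<lambda>i. y1 ^ i * R i" "\<Union>i<a. expts (y1 ^ i * R i)"] by auto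
    then obtain u v where uv: "t = u + v" "u \<in> expts (y1 ^ i)" "v \<in> expts (R i)"
      using keys_mult[of "y1 ^ i" "R i"] by blast
    have "u \<le> (\<Sum>j<i. z_exp d - kvec)"
      using has_top_power[OF y1_top, of i] uv by (auto simp: has_top_def)
    from lex_le[OF this] have "coef u 0 \<le> int i * int d"
      by (simp add: coef_sum_const lookup_minus coef_z_exp del: sum_constant)
    moreover have "coef v 0 < int d" using uv assms(1) by (auto simp: expansion_def low_def)
    ultimately have "coef t 0 < int (Suc i) * int d"
      unfolding uv by (simp add: lookup_add algebra_simps)
    also have "\<dots> \<le> int a * int d" using i by (intro mult_right_mono) auto
    also have "\<dots> \<le> coef ((\<Sum>i<a. z_exp d - kvec) + s) 0"
      using slow by (simp add: lookup_add coef_sum_const lookup_minus coef_z_exp low_def del: sum_constant)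
    finally show "t < (\<Sum>i<a. z_exp d - kvec) + s" by (rule lex_less)
  qed
  then show ?thesis using that s(2) slow a(2) by blast
qed

definition A :: "'a laurent set" where "A = {F. \<exists>f. rep f F}"

lemma rep_eq_0: "rep f 0 \<Longrightarrow> p \<in> Y \<Longrightarrow> f p = 0"
proof -
  assume "rep f 0" "p \<in> Y"
  then obtain N R where 1: "expansion f 0 N R" using rep_expands unfolding expands_def by blast
  have "R b = 0" for b
  proof (rule ccontr)
    assume "R b \<noteq> 0"
    from expansion_top[OF 1 this] show False by (auto simp: has_top_def)
  qed
  then show "f p = 0" using 1 \<open>p \<in> Y\<close> by (simp add: expansion_def)
qed

text \<open>By the expansion, a leading exponent is \<open>a\<close> times that of \<open>y\<^sub>1\<close> plus an exponent in \<open>low\<close>, and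
  \<open>a\<close> is recovered as the quotient of the degree in \<open>z\<close> by \<open>d\<close>.\<close>

lemma A_top:
  assumes "F \<in> A" "has_top F s c" "c \<noteq> 0"
  shows "coef s 0 \<ge> 0" "j \<in> {2..m} \<Longrightarrow> coef s j + int (k j) * (coef s 0 div int d) \<ge> 0"
proof -
  obtain f N R where 1: "expansion f F N R" using assms(1) rep_expands unfolding expands_def A_def by blast
  have "F \<noteq> 0" using assms by (auto simp: has_top_def)
  moreover have "F = (\<Sum>a<N. y1 ^ a * R a)" using 1 unfolding expansion_def by blast
  ultimately have "\<exists>b. R b \<noteq> 0" by (auto intro: ccontr)
  then obtain b where "R b \<noteq> 0" ..
  then obtain a :: nat and t c' where
    t: "has_top F ((\<Sum>i<a. z_exp d - kvec) + t) c'" "c' \<noteq> 0" "t \<in> low"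
    using expansion_top[OF 1] by blast
  have s: "s = (\<Sum>i<a. z_exp d - kvec) + t"
    using has_top_unique[OF assms(2) t(1)] assms(3) t(2) by simp
  have s0: "coef s 0 = int a * int d + coef t 0"
    by (simp add: s lookup_add coef_sum_const lookup_minus coef_z_exp del: sum_constant)
  have t0: "0 \<le> coef t 0" "coef t 0 < int d" using t by (auto simp: low_def)
  then show "coef s 0 \<ge> 0" by (simp add: s0)
  have "coef s 0 div int d = int a"
    unfolding s0 using t0 d_ge_2 by (simp add: div_add1_eq)
  moreover have "coef s j = coef t j - int a * int (k j)" if "j \<in> {2..m}"
    using that by (simp add: s lookup_add coef_sum_const lookup_minus coef_z_exp coef_kvec coef_z_exp del: sum_constant)
  ultimately show "j \<in> {2..m} \<Longrightarrow> coef s j + int (k j) * (coef s 0 div int d) \<ge> 0"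
    using t(3) by (simp add: low_def)
qed

text \<open>A power of \<open>y\<^sub>1\<close> in the expansion would contribute a leading term of degree at least \<open>d\<close> in \<open>z\<close>.
  The second part matters at points where Laurent monomials are not defined.\<close>

lemma rep_low:
  assumes "rep f F" "\<And>s. s \<in> expts F \<Longrightarrow> coef s 0 < int d"
  shows "expts F \<subseteq> low" "p \<in> Y \<Longrightarrow> f p = laurent_at p F"
proof -
  obtain N R where 1: "expansion f F N R" using rep_expands[OF assms(1)] unfolding expands_def by blast
  have 2: "R b = 0" if "b > 0" for b
  proof (rule ccontr)
    assume "R b \<noteq> 0"
    then obtain a :: nat and s c where *:
      "has_top F ((\<Sum>i<a. z_exp d - kvec) + s) c" "c \<noteq> 0" "s \<in> low" "b \<le> a"
      using expansion_top[OF 1] by blast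
    then have "(\<Sum>i<a. z_exp d - kvec) + s \<in> expts F" by (auto simp: has_top_def in_keys_iff)
    from assms(2)[OF this] have "int a * int d + coef s 0 < int d"
      by (simp add: lookup_add coef_sum_const lookup_minus coef_z_exp del: sum_constant)
    moreover have "int d \<le> int a * int d" using that * by (simp add: mult_le_cancel_right1)
    moreover have "coef s 0 \<ge> 0" using *(3) by (simp add: low_def)
    ultimately show False by linarith
  qed
  have 1: "expansion f F (Suc N) R" using 1 by (rule expansion_mono) simp
  have *: "(\<Sum>a<Suc N. h a) = h 0" if "\<And>a. a > 0 \<Longrightarrow> h a = 0" for h :: "nat \<Rightarrow> 'b::comm_monoid_add"
    using that by (subst sum.lessThan_Suc_shift) simp
  have "F = (\<Sum>a<Suc N. y1 ^ a * R a)" using 1 unfolding expansion_def by blast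
  also have "\<dots> = R 0" using *[of "\<lambda>a. y1 ^ a * R a"] 2 by simp
  finally have F: "F = R 0" .
  then show "expts F \<subseteq> low" using 1 unfolding expansion_def by blast
  show "f p = laurent_at p F" if "p \<in> Y"
  proof -
    have "f p = (\<Sum>a<Suc N. p 1 ^ a * laurent_at p (R a))"
      using 1 that unfolding expansion_def by blast
    also have "\<dots> = laurent_at p (R 0)" using *[of "\<lambda>a. p 1 ^ a * laurent_at p (R a)"] 2 by simp
    finally show ?thesis by (simp add: F)
  qed
qed

lemma rep_unique_fun:
  assumes "rep f F" "rep g F"
  shows "f = g"
proof
  fix p
  have "rep (\<lambda>p\<in>Y. (\<lambda>p\<in>Y. -1) p * g p) (mon 0 (-1) * F)"
    using assms by (intro rep_mult rep_const)
  from rep_add[OF assms(1) this]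
  have "rep (\<lambda>p\<in>Y. f p + (\<lambda>p\<in>Y. (\<lambda>p\<in>Y. -1) p * g p) p) (F + mon 0 (-1) * F)" .
  moreover have "F + mon 0 (-1) * F = 0" by (simp add: single_uminus)
  ultimately have "rep (\<lambda>p\<in>Y. f p + (\<lambda>p\<in>Y. (\<lambda>p\<in>Y. -1) p * g p) p) 0" by argo
  from rep_eq_0[OF this, of p] have "p \<in> Y \<Longrightarrow> f p = g p" by simp
  then show "f p = g p"
    using rep_extensional[OF assms(1)] rep_extensional[OF assms(2)]
    by (cases "p \<in> Y") (auto simp: extensional_def)
qed

lemma point_exists:
  assumes "\<And>j. j \<in> {2..m} \<Longrightarrow> p j \<noteq> 0"
  obtains q where "q \<in> Y" "\<And>i. i \<in> idx \<Longrightarrow> q i = p i"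
proof
  define q where "q = (\<lambda>i\<in>{0..m}. if i = 1 then poly P (p 0) / M p else p i)"
  have "M p \<noteq> 0" using assms by (simp add: M_def)
  moreover have "M q = M p" unfolding M_def q_def by (intro prod.cong) auto
  ultimately show "q \<in> Y" unfolding Y_iff using m_ge_2 by (auto simp: q_def)
  show "q i = p i" if "i \<in> idx" for i using that m_ge_2 by (auto simp: q_def idx_def)
qed

lemma laurent_eqI:
  assumes "expts F \<subseteq> supported" "expts G \<subseteq> supported"
    and "\<And>p. p \<in> Y \<Longrightarrow> (\<And>j. j \<in> {2..m} \<Longrightarrow> p j \<noteq> 0) \<Longrightarrow> laurent_at p F = laurent_at p G"
  shows "F = G"
proof -
  have "F + mon 0 (-1) * G = 0"
  proof (rule laurent_at_eq_0_imp)
    fix p :: "nat \<Rightarrow> 'a" assume p: "\<And>i. p i \<noteq> 0"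
    obtain q where q: "q \<in> Y" "\<And>i. i \<in> idx \<Longrightarrow> q i = p i" using point_exists[of p] p by metis
    have *: "laurent_at p H = laurent_at q H" if "expts H \<subseteq> supported" for H
      using that q(2) by (intro laurent_at_cong) (auto simp: supported_def subset_iff)
    have "laurent_at q F = laurent_at q G" using assms(3)[OF q(1)] q(2) p by simp
    then have "laurent_at p F = laurent_at p G" using * assms by metis
    moreover have "laurent_at p (mon 0 (-1) * G) = - laurent_at p G"
      using p by (subst laurent_at_mult) (auto simp: defined_at_def)
    ultimately show "laurent_at p (F + mon 0 (-1) * G) = 0"
      by (simp add: laurent_at_add)
  qed
  then show ?thesis by (simp add: single_uminus)
qed

lemma rep_unique:
  assumes "rep f F" "rep f G"
  shows "F = G"
proof (rule laurent_eqI)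
  fix p assume p: "p \<in> Y" "\<And>j. j \<in> {2..m} \<Longrightarrow> p j \<noteq> 0"
  show "laurent_at p F = laurent_at p G"
    using laurent_at_rep[OF assms(1) p] laurent_at_rep[OF assms(2) p] by simp
qed (rule rep_supported[OF assms(1)], rule rep_supported[OF assms(2)])

end

section \<open>Locally nilpotent derivations\<close>

text \<open>The combinatorial core. Here \<open>e\<close> is the exponent by which a homogeneous locally nilpotent derivation
  shifts monomials, and the numbers \<open>n i\<close> are the values of its linear form on the variables. The
  assumptions say that this form is nonnegative on the variables and on the leading exponent of \<open>y\<^sub>1\<close>,
  that it takes the value \<open>-1\<close> on \<open>e\<close>, and that \<open>e\<close> shifts each variable of nonzero value into the semigroup of
  leading exponents. If some \<open>n j\<close> with \<open>j \<ge> 2\<close> were positive, the bounds on the components of \<open>e\<close> would give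
  \<open>e\<close> a nonnegative value.\<close>

lemma root_arith:
  fixes n e :: "nat \<Rightarrow> int" and k :: "nat \<Rightarrow> nat" and d :: int
  assumes d: "d \<ge> 2" and k: "\<And>j. j \<in> {2..m} \<Longrightarrow> k j \<ge> 2"
    and n: "\<And>i. i \<in> insert 0 {2..m} \<Longrightarrow> n i \<ge> 0"
    and n0: "(\<Sum>j\<in>{2..m}. int (k j) * n j) \<le> d * n 0"
    and e: "(\<Sum>i\<in>insert 0 {2..m}. e i * n i) = -1"
    and z: "\<And>j. n 0 > 0 \<Longrightarrow> j \<in> {2..m} \<Longrightarrow> e j + int (k j) * ((e 0 + 1) div d) \<ge> 0"
    and y: "\<And>i. i \<in> {2..m} \<Longrightarrow> n i > 0 \<Longrightarrow> e 0 \<ge> 0"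
      "\<And>i j. i \<in> {2..m} \<Longrightarrow> n i > 0 \<Longrightarrow> j \<in> {2..m} \<Longrightarrow>
         e j + (if i = j then 1 else 0) + int (k j) * (e 0 div d) \<ge> 0"
  shows "(\<forall>j\<in>{2..m}. n j = 0) \<and> n 0 = 1 \<and> e 0 = -1"
proof -
  define q where "q = e 0 div d"
  define r where "r = e 0 mod d"
  have e0: "e 0 = q * d + r" by (simp add: q_def r_def)
  have r: "0 \<le> r" "r < d" using d by (auto simp: r_def)
  have tot: "e 0 * n 0 + (\<Sum>i\<in>{2..m}. e i * n i) = -1" using e by simp
  have n_zero: "n j = 0" if j: "j \<in> {2..m}" for j
  proof (rule ccontr)
    assume "n j \<noteq> 0"
    then have nj: "n j > 0" using n[of j] j by simp
    have "int (k j) * n j \<le> (\<Sum>j\<in>{2..m}. int (k j) * n j)"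
      using j n by (intro member_le_sum) auto
    moreover have "2 * n j \<le> int (k j) * n j" using k[OF j] nj by (intro mult_right_mono) auto
    ultimately have dn: "2 * n j \<le> d * n 0" using n0 by linarith
    have n0pos: "n 0 > 0"
    proof (rule ccontr)
      assume "\<not> n 0 > 0"
      then have "n 0 = 0" using n[of 0] by simp
      then show False using dn nj by simp
    qed
    have q: "q \<ge> 0" using y(1)[OF j nj] d by (simp add: q_def pos_imp_zdiv_nonneg_iff)
    have qs: "q * (\<Sum>j\<in>{2..m}. int (k j) * n j) \<le> q * (d * n 0)"
      using q n0 by (intro mult_left_mono) auto
    \<comment> \<open>If \<open>d\<close> does not divide \<open>e 0 + 1\<close>, the shift of \<open>z\<close> bounds \<open>e\<close> from below. Otherwise the shift
      of \<open>y\<^sub>j\<close> gives a bound that is worse by \<open>n j\<close>, which \<open>k\<^sub>j \<ge> 2\<close> compensates.\<close>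
    show False
    proof (cases "r = d - 1")
      case True
      have "(\<Sum>i\<in>{2..m}. e i * n i) \<ge> (\<Sum>i\<in>{2..m}. - q * (int (k i) * n i) - (if j = i then n i else 0))"
      proof (rule sum_mono)
        fix i assume i: "i \<in> {2..m}"
        have "(- (int (k i) * q) - (if j = i then 1 else 0)) * n i \<le> e i * n i"
          using y(2)[OF j nj i] n[of i] i by (intro mult_right_mono) (auto simp: q_def)
        then show "- q * (int (k i) * n i) - (if j = i then n i else 0) \<le> e i * n i"
          by (simp add: algebra_simps split: if_splits)
      qed
      also have "(\<Sum>i\<in>{2..m}. - q * (int (k i) * n i) - (if j = i then n i else 0))
          = - (q * (\<Sum>i\<in>{2..m}. int (k i) * n i)) - n j"
        using j by (simp add: sum_subtractf sum_negf sum_distrib_left sum.delta)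
      finally have "-1 \<ge> e 0 * n 0 - q * (d * n 0) - n j" using tot qs by linarith
      then have "-1 \<ge> (d - 1) * n 0 - n j" using True by (simp add: e0 algebra_simps)
      moreover have "2 * ((d - 1) * n 0) \<ge> d * n 0"
        using d n0pos by (simp add: algebra_simps)
      ultimately show False using dn by linarith
    next
      case False
      have "e 0 + 1 = (r + 1) + q * d" using e0 by simp
      moreover have "(r + 1 + q * d) div d = q"
        using r False d by (simp add: div_pos_pos_trivial)
      ultimately have "(e 0 + 1) div d = q" by (simp only:)
      then have "(\<Sum>i\<in>{2..m}. e i * n i) \<ge> (\<Sum>i\<in>{2..m}. - q * (int (k i) * n i))"
      proof (intro sum_mono)
        fix i assume i: "i \<in> {2..m}" and *: "(e 0 + 1) div d = q"
        have "- (int (k i) * q) * n i \<le> e i * n i"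
          using z[OF n0pos i] n[of i] i by (intro mult_right_mono) (auto simp: *)
        then show "- q * (int (k i) * n i) \<le> e i * n i" by (simp add: algebra_simps)
      qed
      also have "(\<Sum>i\<in>{2..m}. - q * (int (k i) * n i)) = - (q * (\<Sum>i\<in>{2..m}. int (k i) * n i))"
        by (simp add: sum_negf sum_distrib_left)
      finally have "-1 \<ge> e 0 * n 0 - q * (d * n 0)" using tot qs by linarith
      then have "-1 \<ge> r * n 0" by (simp add: e0 algebra_simps)
      moreover have "r * n 0 \<ge> 0" using r n0pos by simp
      ultimately show False by linarith
    qed
  qed
  then have "e 0 * n 0 = -1" using tot by simp
  then have "(- e 0) * n 0 = 1" by simp
  moreover have "n 0 \<ge> 0" using n[of 0] by simp
  ultimately have "n 0 = 1" using zmult_eq_1_iff[of "- e 0" "n 0"] by auto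
  then show ?thesis using n_zero \<open>e 0 * n 0 = -1\<close> by simp
qed

context suspension
begin

lemma A_induct [consumes 1, case_names const lvar y1 add mult]:
  assumes "F \<in> A" "\<And>c. Q (mon 0 c)" "\<And>i. i \<in> idx \<Longrightarrow> Q (lvar i)" "Q y1"
    "\<And>F G. F \<in> A \<Longrightarrow> G \<in> A \<Longrightarrow> Q F \<Longrightarrow> Q G \<Longrightarrow> Q (F + G)"
    "\<And>F G. F \<in> A \<Longrightarrow> G \<in> A \<Longrightarrow> Q F \<Longrightarrow> Q G \<Longrightarrow> Q (F * G)"
  shows "Q F"
proof -
  obtain f where "rep f F" using assms(1) by (auto simp: A_def)
  then show ?thesis
  proof (induction rule: rep.induct)
    case (rep_add f F g G)
    then show ?case using assms(5)[of F G] by (auto simp: A_def)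
  next
    case (rep_mult f F g G)
    then show ?case using assms(6)[of F G] by (auto simp: A_def)
  qed (use assms in auto)
qed

lemma A_const: "mon 0 c \<in> A" and A_lvar: "i \<in> idx \<Longrightarrow> lvar i \<in> A" and A_y1: "y1 \<in> A"
  unfolding A_def using rep_const rep_coord rep_y1 by blast+

lemma A_add: "F \<in> A \<Longrightarrow> G \<in> A \<Longrightarrow> F + G \<in> A"
  and A_mult: "F \<in> A \<Longrightarrow> G \<in> A \<Longrightarrow> F * G \<in> A"
  unfolding A_def using rep_add rep_mult by blast+

lemma A_supported: "F \<in> A \<Longrightarrow> expts F \<subseteq> supported"
  unfolding A_def using rep_supported by blast

lemma mon_eq_prod:
  assumes "s \<in> nonneg"
  shows "mon s 1 = (\<Prod>i\<in>idx. lvar i ^ nat (coef s i))"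
proof -
  have "s = (\<Sum>i\<in>idx. \<Sum>_<nat (coef s i). unit_exp i)"
  proof (rule poly_mapping_eqI)
    fix j
    have "coef (\<Sum>i\<in>idx. \<Sum>_<nat (coef s i). unit_exp i) j = (\<Sum>i\<in>idx. int (nat (coef s i)) * coef (unit_exp i) j)"
      unfolding lookup_sum[of _ idx] coef_sum_const ..
    also have "\<dots> = (\<Sum>i\<in>idx. if i = j then coef s i else 0)"
      by (rule sum.cong) (use assms in \<open>auto simp: coef_unit_exp nonneg_def\<close>)
    also have "\<dots> = coef s j"
      using assms by (auto simp: nonneg_def in_keys_iff)
    finally show "coef s j = coef (\<Sum>i\<in>idx. \<Sum>_<nat (coef s i). unit_exp i) j" by simp
  qed
  then show ?thesis by (simp add: mono_power mono_prod del: sum_constant)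
qed

text \<open>An induction principle: polynomials are generated by constants and variables.\<close>

lemma nonneg_subalgebra:
  assumes "expts F \<subseteq> nonneg" "\<And>c. mon 0 c \<in> S" "\<And>i. i \<in> idx \<Longrightarrow> lvar i \<in> S"
    "\<And>F G. F \<in> S \<Longrightarrow> G \<in> S \<Longrightarrow> F + G \<in> S" "\<And>F G. F \<in> S \<Longrightarrow> G \<in> S \<Longrightarrow> F * G \<in> S"
  shows "F \<in> S"
  using assms(1)
proof (induction F rule: laurent_induct)
  case zero
  then show ?case using assms(2)[of 0] by simp
next
  case (mon s c)
  have one: "1 \<in> S" using assms(2)[of 1] by simp
  have pow: "F ^ n \<in> S" if "F \<in> S" for F n
    using that one by (induction n) (simp_all add: assms(5))
  have "(\<Prod>i\<in>J. lvar i ^ nat (coef s i)) \<in> S" if "finite J" "J \<subseteq> idx" for J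
    using that by (induction J rule: finite_induct) (simp_all add: one assms(3,5) pow)
  from this[OF finite_idx order_refl] have "mon s 1 \<in> S" unfolding mon_eq_prod[OF mon(1)] .
  then have "mon 0 c * mon s 1 \<in> S" using assms(2,5) by blast
  then show ?case by (simp add: mult_single)
next
  case (add F G)
  then show ?case using assms(4) by blast
qed

lemma nonneg_A: "expts F \<subseteq> nonneg \<Longrightarrow> F \<in> A"
  by (rule nonneg_subalgebra) (simp_all add: A_const A_lvar A_add A_mult)

lemma zpoly_nonneg: "expts (poly (lift_poly Q) (lvar 0)) \<subseteq> nonneg" for Q :: "'a poly"
  using nonneg_closed unit_exp_nonneg[of 0]
  by (intro expts_poly_subset expts_mono_subset) (auto simp: coeff_map_poly split: if_splits)

lemma kvec_plus_neg [simp]: "mon kvec 1 * mon (- kvec) 1 = (1 :: 'a laurent)"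
  by (simp add: mult_single)

lemma y1_mult_kvec: "y1 * mon kvec 1 = poly (lift_poly P) (lvar 0)"
proof -
  have "y1 * mon kvec 1 = (mon kvec 1 * mon (- kvec) 1) * poly (lift_poly P) (lvar 0)"
    unfolding y1_def by (simp only: mult_ac)
  then show ?thesis by simp
qed

lemma mon_neq_0: "c \<noteq> 0 \<Longrightarrow> mon s c \<noteq> 0" for c :: 'a
  by (metis keys_single keys_zero insert_not_empty)

definition derivA :: "('a laurent \<Rightarrow> 'a laurent) \<Rightarrow> bool" where
  "derivA \<delta> \<longleftrightarrow> (\<forall>F\<in>A. \<delta> F \<in> A) \<and> (\<forall>c. \<delta> (mon 0 c) = 0) \<and>
     (\<forall>F\<in>A. \<forall>G\<in>A. \<delta> (F + G) = \<delta> F + \<delta> G) \<and> (\<forall>F\<in>A. \<forall>G\<in>A. \<delta> (F * G) = F * \<delta> G + G * \<delta> F)"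

text \<open>Both sides are derivations and agree on \<open>z, y\<^sub>2, \<dots>, y\<^sub>m\<close>. They agree on \<open>y\<^sub>1\<close> as well, because \<open>y\<^sub>1 M\<close> and
  \<open>M\<close> are polynomials in these variables and \<open>M\<close> can be cancelled. So a derivation shifts exponents by those
  of finitely many Laurent polynomials.\<close>

lemma derivA_euler:
  assumes "derivA \<delta>" "F \<in> A"
  shows "\<delta> F = (\<Sum>i\<in>idx. \<delta> (lvar i) * mon (- unit_exp i) 1 * euler i F)" (is "_ = ?\<Delta> F")
proof -
  have \<Delta>_add: "?\<Delta> (F + G) = ?\<Delta> F + ?\<Delta> G" for F G
    by (simp add: euler_add distrib_left sum.distrib)
  have \<Delta>_mult: "?\<Delta> (F * G) = F * ?\<Delta> G + G * ?\<Delta> F" for F G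
  proof -
    have "?\<Delta> (F * G) = (\<Sum>i\<in>idx. F * (\<delta> (lvar i) * mon (- unit_exp i) 1 * euler i G) + G * (\<delta> (lvar i) * mon (- unit_exp i) 1 * euler i F))"
      by (rule sum.cong[OF refl]) (simp only: euler_mult distrib_left mult_ac add.commute)
    then show ?thesis by (simp only: sum.distrib sum_distrib_left)
  qed
  have \<Delta>_const: "?\<Delta> (mon 0 c) = 0" for c
    by (simp add: euler_mono)
  have \<Delta>_lvar: "?\<Delta> (lvar j) = \<delta> (lvar j)" if "j \<in> idx" for j
  proof -
    have "?\<Delta> (lvar j) = (\<Sum>i\<in>idx. if i = j then \<delta> (lvar j) else 0)"
    proof (rule sum.cong[OF refl])
      fix i
      have "mon (- unit_exp j) 1 * lvar j = (1 :: 'a laurent)" by (simp add: mult_single)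
      then show "\<delta> (lvar i) * mon (- unit_exp i) 1 * euler i (lvar j) = (if i = j then \<delta> (lvar j) else 0)"
        by (auto simp: euler_mono coef_unit_exp mult.assoc)
    qed
    then show ?thesis using that by simp
  qed
  define S where "S = {F \<in> A. \<delta> F = ?\<Delta> F}"
  have SA: "F \<in> S \<Longrightarrow> F \<in> A" and SD: "F \<in> S \<Longrightarrow> \<delta> F = ?\<Delta> F" for F by (auto simp: S_def)
  have S: "mon 0 c \<in> S" for c using assms(1) A_const \<Delta>_const by (simp add: S_def derivA_def)
  have S': "lvar i \<in> S" if "i \<in> idx" for i using that A_lvar \<Delta>_lvar by (simp add: S_def)
  have S_add: "F + G \<in> S" if "F \<in> S" "G \<in> S" for F G
  proof -
    have "\<delta> (F + G) = \<delta> F + \<delta> G" using that SA assms(1) unfolding derivA_def by blast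
    then have "\<delta> (F + G) = ?\<Delta> (F + G)" unfolding \<Delta>_add using that SD by simp
    then show ?thesis using that SA A_add unfolding S_def by blast
  qed
  have \<delta>_mult: "\<delta> (F * G) = F * \<delta> G + G * \<delta> F" if "F \<in> A" "G \<in> A" for F G
    using that assms(1) unfolding derivA_def by blast
  have S_mult: "F * G \<in> S" if "F \<in> S" "G \<in> S" for F G
  proof -
    have "\<delta> (F * G) = F * \<delta> G + G * \<delta> F" using that SA \<delta>_mult by blast
    then have "\<delta> (F * G) = ?\<Delta> (F * G)" unfolding \<Delta>_mult using that SD by simp
    then show ?thesis using that SA A_mult unfolding S_def by blast
  qed
  have nn: "F \<in> S" if "expts F \<subseteq> nonneg" for F
    using that S S' S_add S_mult by (rule nonneg_subalgebra)
  have M: "mon kvec 1 \<in> S" using kvec_nonneg by (intro nn expts_mono_subset)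
  have yM: "y1 * mon kvec 1 \<in> S" unfolding y1_mult_kvec by (intro nn zpoly_nonneg)
  have "y1 \<in> S"
  proof -
    have "\<delta> (y1 * mon kvec 1) = y1 * \<delta> (mon kvec 1) + mon kvec 1 * \<delta> y1"
      using SA[OF M] A_y1 by (intro \<delta>_mult)
    then have "mon kvec 1 * \<delta> y1 = \<delta> (y1 * mon kvec 1) - y1 * \<delta> (mon kvec 1)" by simp
    also have "\<dots> = ?\<Delta> (y1 * mon kvec 1) - y1 * ?\<Delta> (mon kvec 1)"
      unfolding SD[OF yM] SD[OF M] ..
    also have "\<dots> = mon kvec 1 * ?\<Delta> y1" unfolding \<Delta>_mult by (rule add_diff_cancel_left')
    finally have eq: "mon kvec 1 * \<delta> y1 = mon kvec 1 * ?\<Delta> y1" .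
    have nz: "mon kvec (1::'a) \<noteq> 0" by (rule mon_neq_0) simp
    have "\<delta> y1 = ?\<Delta> y1" by (rule mult_left_cancel[OF nz, THEN iffD1, OF eq])
    then show ?thesis using A_y1 unfolding S_def by blast
  qed
  have "F \<in> S" using assms(2)
    by (induction rule: A_induct) (use S S' S_add S_mult \<open>y1 \<in> S\<close> in blast)+
  then show ?thesis using SD by blast
qed

text \<open>Let \<open>e\<close> be the largest exponent in the coefficients of the Euler derivations. It shifts leading
  terms, with a factor \<open>lam\<close> that depends additively on the exponent. If iterating \<open>\<delta>\<close> ends in \<open>0\<close>, some
  factor \<open>lam s + i lam e\<close> vanishes. As \<open>lam\<close> is nonzero on some variable, \<open>lam e \<noteq> 0\<close>, and on leading
  exponents \<open>lam\<close> is a nonpositive integral multiple of \<open>lam e\<close>. The multiples for the variables satisfy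
  the assumptions of \<open>root_arith\<close>.\<close>

lemma lnd_top:
  assumes der: "derivA \<delta>" and nil: "\<And>F. F \<in> A \<Longrightarrow> \<exists>n. (\<delta> ^^ n) F = 0"
    and nonzero: "\<exists>F\<in>A. \<delta> F \<noteq> 0"
  obtains e \<mu> where "\<mu> \<noteq> 0" "coef e 0 = -1"
    "\<forall>F\<in>A. \<forall>s c. has_top F s c \<longrightarrow> has_top (\<delta> F) (e + s) (of_int (coef s 0) * \<mu> * c)"
proof -
  define D where "D i = \<delta> (lvar i) * mon (- unit_exp i) 1" for i
  have \<delta>: "\<delta> F = (\<Sum>i\<in>idx. D i * euler i F)" if "F \<in> A" for F
    using derivA_euler[OF der that] by (simp add: D_def)
  have \<delta>A: "\<delta> F \<in> A" if "F \<in> A" for F using der that by (simp add: derivA_def)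
  define E where "E = (\<Union>i\<in>idx. expts (D i))"
  have fE: "finite E" by (simp add: E_def)
  have "E \<noteq> {}"
  proof
    assume "E = {}"
    then have "D i = 0" if "i \<in> idx" for i using that by (auto simp: E_def)
    then show False using nonzero \<delta> by auto
  qed
  define e where "e = Max E"
  have eE: "e \<in> E" and Ee: "\<And>t. t \<in> E \<Longrightarrow> t \<le> e" using fE \<open>E \<noteq> {}\<close> by (auto simp: e_def)
  define l where "l i = coef (D i) e" for i
  define lam where "lam s = (\<Sum>i\<in>idx. of_int (coef s i) * l i)" for s
  have lam_add: "lam (s + t) = lam s + lam t" for s t
    by (simp add: lam_def lookup_add distrib_right sum.distrib)
  have lam_unit: "lam (unit_exp i) = l i" if "i \<in> idx" for i
  proof -
    have "lam (unit_exp i) = (\<Sum>j\<in>idx. if i = j then l j else 0)"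
      unfolding lam_def by (rule sum.cong) (auto simp: coef_unit_exp)
    then show ?thesis using that by simp
  qed
  have topD: "has_top (D i) e (l i)" if "i \<in> idx" for i
    using Ee that by (auto simp: has_top_def l_def E_def)
  have top: "has_top (\<delta> F) (e + s) (lam s * c)" if "F \<in> A" "has_top F s c" for F s c
  proof -
    have eu: "has_top (euler i F) s (of_int (coef s i) * c)" for i
      using that(2) by (auto simp: has_top_def coef_euler in_keys_iff)
    have "has_top (\<Sum>i\<in>idx. D i * euler i F) (e + s) (\<Sum>i\<in>idx. l i * (of_int (coef s i) * c))"
      by (intro has_top_sum has_top_mult topD eu) auto
    moreover have "(\<Sum>i\<in>idx. l i * (of_int (coef s i) * c)) = lam s * c"
      by (simp add: lam_def sum_distrib_left mult_ac)
    ultimately show ?thesis using \<delta>[OF that(1)] by simp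
  qed
  have iter: "(\<delta> ^^ n) F \<in> A \<and> has_top ((\<delta> ^^ n) F) ((\<Sum>i<n. e) + s) (c * (\<Prod>i<n. lam s + of_nat i * lam e))"
    if F: "F \<in> A" "has_top F s c" for F s c n
  proof (induction n)
    case 0
    then show ?case using that by simp
  next
    case (Suc n)
    have 1: "lam ((\<Sum>i<n. e) + s) = lam s + of_nat n * lam e"
    proof -
      have "lam (\<Sum>i<n. e) = of_nat n * lam e"
        by (induction n) (simp_all add: lam_add algebra_simps del: sum_constant, simp add: lam_def)
      then show ?thesis by (simp add: lam_add del: sum_constant)
    qed
    have "has_top (\<delta> ((\<delta> ^^ n) F)) (e + ((\<Sum>i<n. e) + s)) (lam ((\<Sum>i<n. e) + s) * (c * (\<Prod>i<n. lam s + of_nat i * lam e)))"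
      using Suc by (intro top) auto
    moreover have "e + ((\<Sum>i<n. e) + s) = (\<Sum>i<Suc n. e) + s" by (simp add: algebra_simps del: sum_constant)
    moreover have "lam ((\<Sum>i<n. e) + s) * (c * (\<Prod>i<n. lam s + of_nat i * lam e)) = c * (\<Prod>i<Suc n. lam s + of_nat i * lam e)"
      by (simp only: 1 prod.lessThan_Suc mult_ac)
    ultimately have "has_top ((\<delta> ^^ Suc n) F) ((\<Sum>i<Suc n. e) + s) (c * (\<Prod>i<Suc n. lam s + of_nat i * lam e))"
      by (simp only: funpow.simps o_apply)
    moreover have "(\<delta> ^^ Suc n) F \<in> A" using Suc \<delta>A by simp
    ultimately show ?case by blast
  qed
  have root: "\<exists>i::nat. lam s + of_nat i * lam e = 0" if F: "F \<in> A" "has_top F s c" "c \<noteq> 0" for F s c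
  proof -
    obtain n where n: "(\<delta> ^^ n) F = 0" using nil[OF F(1)] by blast
    have "c * (\<Prod>i<n. lam s + of_nat i * lam e) = 0"
      using iter[OF F(1,2), of n] unfolding n has_top_def by (metis lookup_zero)
    then show ?thesis using F(3) by auto
  qed
  have lame: "lam e \<noteq> 0"
  proof
    assume 0: "lam e = 0"
    obtain i where i: "i \<in> idx" "e \<in> expts (D i)" using eE by (auto simp: E_def)
    then have "l i \<noteq> 0" by (simp add: l_def in_keys_iff)
    moreover have "lam (unit_exp i) = 0"
      using root[OF A_lvar[OF i(1)] has_top_mono] 0 by auto
    ultimately show False using lam_unit i by simp
  qed
  have "\<exists>n::int. n \<ge> 0 \<and> l i = - of_int n * lam e" if i: "i \<in> idx" for i
  proof -
    obtain n :: nat where "lam (unit_exp i) + of_nat n * lam e = 0"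
      using root[OF A_lvar[OF i] has_top_mono] by auto
    then show ?thesis using lam_unit[OF i]
      by (intro exI[of _ "int n"]) (simp add: eq_neg_iff_add_eq_0)
  qed
  then obtain n where n: "\<And>i. i \<in> idx \<Longrightarrow> n i \<ge> 0" "\<And>i. i \<in> idx \<Longrightarrow> l i = - of_int (n i) * lam e"
    by metis
  have lam: "lam s = - of_int (\<Sum>i\<in>idx. coef s i * n i) * lam e" for s
  proof -
    have "lam s = (\<Sum>i\<in>idx. - (of_int (coef s i * n i) * lam e))"
      unfolding lam_def[of s] by (rule sum.cong) (simp_all add: n(2) mult.assoc)
    then show ?thesis by (simp add: sum_negf sum_distrib_right)
  qed
  have sum_idx: "(\<Sum>i\<in>idx. h i) = h 0 + (\<Sum>i\<in>{2..m}. h i)" for h :: "nat \<Rightarrow> int"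
    unfolding idx_def by simp
  have closed: "coef (e + unit_exp i) 0 \<ge> 0 \<and>
     (\<forall>j\<in>{2..m}. coef (e + unit_exp i) j + int (k j) * (coef (e + unit_exp i) 0 div int d) \<ge> 0)"
    if i: "i \<in> idx" "n i > 0" for i
  proof -
    have "l i \<noteq> 0" using n(2)[OF i(1)] i lame by simp
    moreover have "has_top (\<delta> (lvar i)) (e + unit_exp i) (l i * 1)"
      using top[OF A_lvar[OF i(1)] has_top_mono] lam_unit[OF i(1)] by simp
    ultimately show ?thesis using A_top[of "\<delta> (lvar i)"] \<delta>A[OF A_lvar[OF i(1)]] by simp
  qed
  have main: "(\<forall>j\<in>{2..m}. n j = 0) \<and> n 0 = 1 \<and> coef e 0 = -1"
  proof (rule root_arith[where k = k and d = "int d"])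
    show "int d \<ge> 2" using d_ge_2 by simp
    show "k j \<ge> 2" if "j \<in> {2..m}" for j using that k_ge_2 by blast
    show "n i \<ge> 0" if "i \<in> insert 0 {2..m}" for i using n(1)[of i] that by (simp add: idx_def)
    show "(\<Sum>j\<in>{2..m}. int (k j) * n j) \<le> int d * n 0"
    proof -
      obtain N :: nat where "lam (z_exp d - kvec) + of_nat N * lam e = 0"
        using root[OF A_y1 y1_top] by auto
      then have "(of_nat N - of_int (\<Sum>i\<in>idx. coef (z_exp d - kvec) i * n i)) * lam e = 0"
        by (simp add: lam[of "z_exp d - kvec"] left_diff_distrib)
      then have "of_int (\<Sum>i\<in>idx. coef (z_exp d - kvec) i * n i) = (of_int (int N) :: 'a)"
        using lame by simp
      then have "(\<Sum>i\<in>idx. coef (z_exp d - kvec) i * n i) = int N" using of_int_eq_iff by blast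
      moreover have "(\<Sum>i\<in>idx. coef (z_exp d - kvec) i * n i) = int d * n 0 - (\<Sum>j\<in>{2..m}. int (k j) * n j)"
        unfolding sum_idx by (simp add: lookup_minus coef_z_exp coef_kvec sum_negf)
      ultimately show ?thesis by simp
    qed
    show "(\<Sum>i\<in>insert 0 {2..m}. coef e i * n i) = -1"
    proof -
      define S where "S = (of_int (\<Sum>i\<in>idx. coef e i * n i) :: 'a)"
      have "S * lam e + lam e = S * lam e + (- S * lam e)"
        using lam[of e] unfolding S_def by (rule arg_cong)
      then have "(S + 1) * lam e = 0" by (simp add: distrib_right)
      then have "of_int ((\<Sum>i\<in>idx. coef e i * n i) + 1) = (of_int 0 :: 'a)" using lame unfolding S_def by simp
      then have "(\<Sum>i\<in>idx. coef e i * n i) + 1 = 0" using of_int_eq_iff by blast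
      then show ?thesis by (simp add: idx_def)
    qed
    show "coef e j + int (k j) * ((coef e 0 + 1) div int d) \<ge> 0" if "n 0 > 0" "j \<in> {2..m}" for j
      using closed[of 0] that by (auto simp: lookup_add coef_unit_exp)
    show "coef e 0 \<ge> 0" if "i \<in> {2..m}" "n i > 0" for i
      using closed[of i] that by (auto simp: lookup_add coef_unit_exp)
    show "coef e j + (if i = j then 1 else 0) + int (k j) * (coef e 0 div int d) \<ge> 0"
      if "i \<in> {2..m}" "n i > 0" "j \<in> {2..m}" for i j
      using closed[of i] that by (auto simp: lookup_add coef_unit_exp)
  qed
  have lam_z: "lam s = of_int (coef s 0) * (- lam e)" for s
    using main by (subst lam) (simp add: sum_idx)
  show ?thesis
  proof (rule that)
    show "- lam e \<noteq> 0" using lame by simp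
    show "coef e 0 = -1" using main by blast
    have "has_top (\<delta> F) (e + s) (of_int (coef s 0) * (- lam e) * c)" if "F \<in> A" "has_top F s c" for F s c
      using top[OF that] unfolding lam_z[of s] .
    then show "\<forall>F\<in>A. \<forall>s c. has_top F s c \<longrightarrow> has_top (\<delta> F) (e + s) (of_int (coef s 0) * (- lam e) * c)"
      by blast
  qed
qed

text \<open>An element annihilated by \<open>\<delta>\<close> or \<open>\<delta>\<^sup>2\<close> has a leading exponent for which the corresponding product of
  factors vanishes. All other exponents have at most the same degree in \<open>z\<close>.\<close>

lemma lnd_kernel:
  assumes "derivA \<delta>" "\<And>F. F \<in> A \<Longrightarrow> \<exists>n. (\<delta> ^^ n) F = 0" "\<exists>F\<in>A. \<delta> F \<noteq> 0"
    and F: "F \<in> A" "s \<in> expts F"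
  shows "\<delta> F = 0 \<Longrightarrow> coef s 0 = 0" "\<delta> (\<delta> F) = 0 \<Longrightarrow> coef s 0 \<le> 1"
proof -
  obtain e \<mu> where e: "\<mu> \<noteq> 0" "coef e 0 = -1"
    and top0: "\<forall>F\<in>A. \<forall>s c. has_top F s c \<longrightarrow> has_top (\<delta> F) (e + s) (of_int (coef s 0) * \<mu> * c)"
    by (rule lnd_top[OF assms(1-3)])
  have top: "F \<in> A \<Longrightarrow> has_top F s c \<Longrightarrow> has_top (\<delta> F) (e + s) (of_int (coef s 0) * \<mu> * c)" for F s c
    using top0 by blast
  have "F \<noteq> 0" using F by auto
  then obtain t c where t: "has_top F t c" "c \<noteq> 0" using has_top_exists by blast
  have st: "coef s 0 \<le> coef t 0" using t F by (intro lex_le) (auto simp: has_top_def)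
  have s0: "coef s 0 \<ge> 0" using A_supported[OF F(1)] F(2) by (auto simp: supported_def)
  have top1: "has_top (\<delta> F) (e + t) (of_int (coef t 0) * \<mu> * c)" using top[OF F(1) t(1)] .
  have "\<delta> F \<in> A" using assms(1) F by (simp add: derivA_def)
  then have top2: "has_top (\<delta> (\<delta> F)) (e + (e + t)) (of_int (coef t 0 - 1) * \<mu> * (of_int (coef t 0) * \<mu> * c))"
  proof -
    assume "\<delta> F \<in> A"
    moreover have "coef (e + t) 0 = coef t 0 - 1" using e(2) by (simp add: lookup_add)
    ultimately show ?thesis using top[OF _ top1] by metis
  qed
  have z: "c' = 0" if "has_top (0 :: 'a laurent) s' c'" for s' c' using that by (simp add: has_top_def)
  show "coef s 0 = 0" if "\<delta> F = 0"
  proof -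
    have "of_int (coef t 0) * \<mu> * c = 0" using z[OF top1[unfolded that]] .
    then have "coef t 0 = 0" using e(1) t(2) by (simp only: mult_eq_0_iff of_int_eq_0_iff simp_thms)
    then show ?thesis using st s0 by simp
  qed
  show "coef s 0 \<le> 1" if "\<delta> (\<delta> F) = 0"
  proof -
    have "of_int (coef t 0 - 1) * (of_int (coef t 0) :: 'a) = 0"
      using z[OF top2[unfolded that]] e(1) t(2) by (simp only: mult_eq_0_iff simp_thms)
    then have "coef t 0 - 1 = 0 \<or> coef t 0 = 0"
      by (simp only: mult_eq_0_iff of_int_eq_0_iff)
    then show ?thesis using st by auto
  qed
qed

end

section \<open>Automorphisms of the coordinate ring\<close>

context suspension
begin

definition homA :: "('a laurent \<Rightarrow> 'a laurent) \<Rightarrow> bool" where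
  "homA \<alpha> \<longleftrightarrow> (\<forall>F\<in>A. \<alpha> F \<in> A) \<and> (\<forall>c. \<alpha> (mon 0 c) = mon 0 c) \<and>
     (\<forall>F\<in>A. \<forall>G\<in>A. \<alpha> (F + G) = \<alpha> F + \<alpha> G) \<and> (\<forall>F\<in>A. \<forall>G\<in>A. \<alpha> (F * G) = \<alpha> F * \<alpha> G)"

definition autA :: "('a laurent \<Rightarrow> 'a laurent) \<Rightarrow> ('a laurent \<Rightarrow> 'a laurent) \<Rightarrow> bool" where
  "autA \<alpha> \<beta> \<longleftrightarrow> homA \<alpha> \<and> homA \<beta> \<and> (\<forall>F\<in>A. \<alpha> (\<beta> F) = F \<and> \<beta> (\<alpha> F) = F)"

lemma autA_sym: "autA \<alpha> \<beta> \<Longrightarrow> autA \<beta> \<alpha>"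
  unfolding autA_def by blast

lemma homA_A: "homA \<alpha> \<Longrightarrow> F \<in> A \<Longrightarrow> \<alpha> F \<in> A"
  and homA_const: "homA \<alpha> \<Longrightarrow> \<alpha> (mon 0 c) = mon 0 c"
  and homA_add: "homA \<alpha> \<Longrightarrow> F \<in> A \<Longrightarrow> G \<in> A \<Longrightarrow> \<alpha> (F + G) = \<alpha> F + \<alpha> G"
  and homA_mult: "homA \<alpha> \<Longrightarrow> F \<in> A \<Longrightarrow> G \<in> A \<Longrightarrow> \<alpha> (F * G) = \<alpha> F * \<alpha> G"
  unfolding homA_def by blast+

lemma autA_hom: "autA \<alpha> \<beta> \<Longrightarrow> homA \<alpha>" "autA \<alpha> \<beta> \<Longrightarrow> homA \<beta>"
  and autA_inverse: "autA \<alpha> \<beta> \<Longrightarrow> F \<in> A \<Longrightarrow> \<alpha> (\<beta> F) = F"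
  unfolding autA_def by blast+

lemma homA_0: "homA \<alpha> \<Longrightarrow> \<alpha> 0 = 0" and homA_1: "homA \<alpha> \<Longrightarrow> \<alpha> 1 = 1"
  using homA_const[of \<alpha> 0] homA_const[of \<alpha> 1] by simp_all

lemma A_1: "1 \<in> A" using A_const[of 1] by simp

lemma A_power: "F \<in> A \<Longrightarrow> F ^ n \<in> A"
  by (induction n) (simp_all add: A_1 A_mult)

lemma A_prod: "(\<And>i. i \<in> J \<Longrightarrow> F i \<in> A) \<Longrightarrow> (\<Prod>i\<in>J. F i) \<in> A"
  by (induction J rule: infinite_finite_induct) (simp_all add: A_1 A_mult)

lemma homA_power: "homA \<alpha> \<Longrightarrow> F \<in> A \<Longrightarrow> \<alpha> (F ^ n) = \<alpha> F ^ n"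
  by (induction n) (simp_all add: homA_1 homA_mult A_power)

lemma homA_prod: "finite J \<Longrightarrow> homA \<alpha> \<Longrightarrow> (\<And>i. i \<in> J \<Longrightarrow> F i \<in> A) \<Longrightarrow> \<alpha> (\<Prod>i\<in>J. F i) = (\<Prod>i\<in>J. \<alpha> (F i))"
  by (induction J rule: finite_induct) (simp_all add: homA_1 homA_mult A_prod)

lemma zpoly_A: "poly (lift_poly Q) (lvar 0) \<in> A" for Q :: "'a poly"
  by (rule nonneg_A[OF zpoly_nonneg])

lemma kvec_A: "mon kvec c \<in> A"
  by (intro nonneg_A expts_mono_subset kvec_nonneg)

lemma homA_zpoly:
  fixes Q :: "'a poly"
  assumes "homA \<alpha>"
  shows "\<alpha> (poly (lift_poly Q) (lvar 0)) = poly (lift_poly Q) (\<alpha> (lvar 0))"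
proof (induction Q)
  case 0
  then show ?case using homA_0[OF assms] by simp
next
  case (pCons a Q)
  have "\<alpha> (mon 0 a + lvar 0 * poly (lift_poly Q) (lvar 0)) = mon 0 a + \<alpha> (lvar 0) * \<alpha> (poly (lift_poly Q) (lvar 0))"
    by (simp add: homA_add[OF assms] homA_mult[OF assms] homA_const[OF assms] A_const A_mult A_lvar zpoly_A)
  then show ?case using pCons by (simp add: map_poly_pCons)
qed

lemma lift_poly_add: "lift_poly (p + q) = lift_poly p + lift_poly q" for p q :: "'a poly"
  by (rule poly_eqI) (simp add: coeff_map_poly single_add)

lemma lift_poly_pCons: "lift_poly (pCons c q) = pCons (mon 0 c) (lift_poly q)" for q :: "'a poly"
  by (rule map_poly_pCons) simp

lemma derivA_zpoly:
  fixes Q :: "'a poly"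
  assumes "derivA \<delta>"
  shows "\<delta> (poly (lift_poly Q) (lvar 0)) = poly (lift_poly (pderiv Q)) (lvar 0) * \<delta> (lvar 0)"
proof (induction Q)
  case 0
  have "\<delta> (mon 0 0) = 0" using assms unfolding derivA_def by blast
  then show ?case by simp
next
  case (pCons a Q)
  let ?z = "\<lambda>Q. poly (lift_poly Q) (lvar 0 :: 'a laurent)"
  have "\<delta> (mon 0 a + lvar 0 * ?z Q) = \<delta> (mon 0 a) + \<delta> (lvar 0 * ?z Q)"
    using assms A_const A_mult A_lvar zpoly_A unfolding derivA_def by simp
  also have "\<dots> = lvar 0 * \<delta> (?z Q) + ?z Q * \<delta> (lvar 0)"
    using assms A_lvar[of 0] zpoly_A unfolding derivA_def by simp
  also have "\<dots> = ?z (pderiv (pCons a Q)) * \<delta> (lvar 0)"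
    by (simp add: pCons pderiv_pCons lift_poly_add lift_poly_pCons algebra_simps)
  finally show ?case by (simp add: lift_poly_pCons)
qed

subsection \<open>The canonical derivation\<close>

text \<open>The canonical derivation is \<open>M \<partial>/\<partial>z\<close> on Laurent polynomials.\<close>

definition dz :: "'a laurent \<Rightarrow> 'a laurent" where
  "dz F = mon (kvec - unit_exp 0) 1 * euler 0 F"

lemma coef_dz: "coef (dz F) t = of_int (coef t 0 + 1) * coef F (t - (kvec - unit_exp 0))"
  by (simp add: dz_def coef_mono_mult coef_euler lookup_minus coef_unit_exp)

lemma dz_const: "dz (mon 0 c) = 0"
  by (simp add: dz_def euler_mono)

lemma dz_lvar_0: "dz (lvar 0) = mon kvec 1"
  by (simp add: dz_def euler_mono coef_unit_exp mult_single)

lemma dz_lvar: "j \<noteq> 0 \<Longrightarrow> dz (lvar j) = 0"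
  by (simp add: dz_def euler_mono coef_unit_exp)

lemma euler_zpoly: "euler 0 (poly (lift_poly Q) (lvar 0)) = lvar 0 * poly (lift_poly (pderiv Q)) (lvar 0)"
  for Q :: "'a poly"
proof (induction Q)
  case (pCons a Q)
  have "euler 0 (mon 0 a + lvar 0 * poly (lift_poly Q) (lvar 0)) =
    lvar 0 * poly (lift_poly Q) (lvar 0) + lvar 0 * euler 0 (poly (lift_poly Q) (lvar 0))"
    by (simp add: euler_add euler_mult euler_mono coef_unit_exp)
  then show ?case
    by (simp add: pCons pderiv_pCons lift_poly_add lift_poly_pCons algebra_simps)
qed simp

lemma dz_y1: "dz y1 = poly (lift_poly (pderiv P)) (lvar 0)"
proof -
  have "dz y1 = (mon (kvec - unit_exp 0) 1 * mon (- kvec) 1 * lvar 0) * poly (lift_poly (pderiv P)) (lvar 0)"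
    unfolding dz_def y1_def by (simp add: euler_mult euler_mono euler_zpoly mult.assoc)
  also have "mon (kvec - unit_exp 0) 1 * mon (- kvec) 1 * lvar 0 = (1 :: 'a laurent)"
    by (simp add: mult_single)
  finally show ?thesis by simp
qed

lemma dz_add: "dz (F + G) = dz F + dz G"
  by (simp add: dz_def euler_add distrib_left)

lemma dz_mult: "dz (F * G) = F * dz G + G * dz F"
  by (simp add: dz_def euler_mult distrib_left mult_ac)

lemma dz_A: "F \<in> A \<Longrightarrow> dz F \<in> A"
proof (induction rule: A_induct)
  case (const c)
  show ?case using A_const[of 0] by (simp add: dz_const)
next
  case (lvar i)
  show ?case using A_const[of 0] by (cases "i = 0") (simp_all add: dz_lvar_0 dz_lvar kvec_A)
next
  case y1
  show ?case by (simp add: dz_y1 zpoly_A)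
qed (simp_all add: dz_add dz_mult A_add A_mult)

lemma derivA_dz: "derivA dz"
  unfolding derivA_def using dz_A dz_const dz_add dz_mult by blast

lemma dz_nilpotent:
  assumes "F \<in> A"
  shows "\<exists>n. (dz ^^ n) F = 0"
proof -
  have *: "(dz ^^ Suc n) F = 0" if "\<And>s. s \<in> expts F \<Longrightarrow> 0 \<le> coef s 0 \<and> coef s 0 \<le> int n" for n F
    using that
  proof (induction n arbitrary: F)
    case 0
    have "coef s 0 = 0 \<or> coef F s = 0" for s
    proof (cases "s \<in> expts F")
      case True
      from 0[OF this] show ?thesis by simp
    qed (simp add: in_keys_iff)
    then have "euler 0 F = 0" by (intro poly_mapping_eqI) (auto simp: coef_euler)
    then show ?case by (simp add: dz_def)
  next
    case (Suc n)
    have "(dz ^^ Suc n) (dz F) = 0"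
    proof (rule Suc.IH)
      fix t assume "t \<in> expts (dz F)"
      then have "of_int (coef t 0 + 1) \<noteq> (0 :: 'a)" and in_F: "t - (kvec - unit_exp 0) \<in> expts F"
        unfolding in_keys_iff coef_dz by auto
      then have "coef t 0 + 1 \<noteq> 0" by (metis of_int_0)
      with Suc.prems[OF in_F] show "0 \<le> coef t 0 \<and> coef t 0 \<le> int n"
        by (auto simp: lookup_minus coef_unit_exp)
    qed
    then show ?case by (simp only: funpow_Suc_right o_apply)
  qed
  define n where "n = nat (Max (insert 0 ((\<lambda>s. coef s 0) ` expts F)))"
  have "0 \<le> coef s 0 \<and> coef s 0 \<le> int n" if "s \<in> expts F" for s
  proof -
    have "coef s 0 \<le> Max (insert 0 ((\<lambda>s. coef s 0) ` expts F))"
      using that by (intro Max_ge) auto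
    moreover have "0 \<le> coef s 0" using A_supported[OF assms] that by (auto simp: supported_def)
    ultimately show ?thesis by (simp add: n_def)
  qed
  from *[OF this] show ?thesis by blast
qed

definition B :: "'a laurent set" where
  "B = {F. expts F \<subseteq> {s \<in> nonneg. coef s 0 = 0}}"

lemma A_low: "F \<in> A \<Longrightarrow> (\<And>s. s \<in> expts F \<Longrightarrow> coef s 0 < int d) \<Longrightarrow> expts F \<subseteq> low"
  unfolding A_def using rep_low(1) by blast

lemma B_A: "F \<in> B \<Longrightarrow> F \<in> A"
  unfolding B_def by (auto intro: nonneg_A)

lemma B_iff: "F \<in> A \<Longrightarrow> F \<in> B \<longleftrightarrow> (\<forall>s\<in>expts F. coef s 0 = 0)"
proof
  assume F: "F \<in> A" "\<forall>s\<in>expts F. coef s 0 = 0"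
  then have "expts F \<subseteq> low" using d_ge_2 by (intro A_low) auto
  then show "F \<in> B" using F low_nonneg by (auto simp: B_def)
qed (auto simp: B_def)

lemma dz_eq_0_iff:
  assumes "F \<in> A"
  shows "dz F = 0 \<longleftrightarrow> F \<in> B"
proof
  assume 0: "dz F = 0"
  have "coef s 0 = 0" if "s \<in> expts F" for s
  proof -
    have "coef (dz F) (s + (kvec - unit_exp 0)) = of_int (coef s 0) * coef F s"
      by (simp add: coef_dz lookup_add lookup_minus coef_unit_exp)
    then show ?thesis using that 0 by (simp add: in_keys_iff)
  qed
  then show "F \<in> B" using B_iff[OF assms] by blast
next
  assume F: "F \<in> B"
  have "coef (dz F) t = 0" for t
  proof (cases "t - (kvec - unit_exp 0) \<in> expts F")
    case True
    then have "coef (t - (kvec - unit_exp 0)) 0 = 0" using F by (auto simp: B_def)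
    then show ?thesis by (simp add: coef_dz lookup_minus coef_unit_exp)
  next
    case False
    then show ?thesis by (simp add: coef_dz in_keys_iff)
  qed
  then show "dz F = 0" by (intro poly_mapping_eqI) simp
qed

lemma B_const: "mon 0 c \<in> B"
  unfolding B_def using nonneg_closed(1) by (intro CollectI expts_mono_subset) simp

lemma B_mon: "s \<in> nonneg \<Longrightarrow> coef s 0 = 0 \<Longrightarrow> mon s c \<in> B"
  unfolding B_def by (intro CollectI expts_mono_subset) simp

lemma B_lvar: "j \<in> {2..m} \<Longrightarrow> lvar j \<in> B"
  by (rule B_mon) (auto intro!: unit_exp_nonneg simp: coef_unit_exp)

lemma B_kvec: "mon kvec c \<in> B"
  by (rule B_mon) (auto simp: kvec_nonneg)

lemma B_add: "F \<in> B \<Longrightarrow> G \<in> B \<Longrightarrow> F + G \<in> B"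
  unfolding B_def using expts_add_subset by blast

lemma B_mult: "F \<in> B \<Longrightarrow> G \<in> B \<Longrightarrow> F * G \<in> B"
  unfolding B_def mem_Collect_eq
  by (rule expts_mult_subset) (auto simp: lookup_add intro: nonneg_closed)

lemma conjugate_lnd:
  assumes "autA \<alpha> \<beta>"
  defines "\<delta> \<equiv> \<lambda>F. \<alpha> (dz (\<beta> F))"
  shows "derivA \<delta>" "F \<in> A \<Longrightarrow> \<exists>n. (\<delta> ^^ n) F = 0" "\<exists>F\<in>A. \<delta> F \<noteq> 0"
proof -
  note hom = autA_hom[OF assms(1)] and inv = autA_inverse[OF assms(1)] autA_inverse[OF autA_sym[OF assms(1)]]
  show "derivA \<delta>" unfolding derivA_def
  proof (intro conjI ballI allI)
    show "\<delta> F \<in> A" if "F \<in> A" for F unfolding \<delta>_def using that hom homA_A dz_A by blast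
    show "\<delta> (mon 0 c) = 0" for c
      unfolding \<delta>_def by (simp add: homA_const[OF hom(2)] dz_const homA_0[OF hom(1)])
    show "\<delta> (F + G) = \<delta> F + \<delta> G" if "F \<in> A" "G \<in> A" for F G
      unfolding \<delta>_def using that
      by (simp add: homA_add[OF hom(2)] dz_add homA_add[OF hom(1)] dz_A homA_A[OF hom(2)])
    show "\<delta> (F * G) = F * \<delta> G + G * \<delta> F" if "F \<in> A" "G \<in> A" for F G
      unfolding \<delta>_def using that
      by (simp add: homA_mult[OF hom(2)] dz_mult homA_add[OF hom(1)] homA_mult[OF hom(1)] A_mult dz_A homA_A[OF hom(2)] inv(1))
  qed
  have iter: "(\<delta> ^^ n) F = \<alpha> ((dz ^^ n) (\<beta> F)) \<and> (dz ^^ n) (\<beta> F) \<in> A" if "F \<in> A" for F n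
    using that by (induction n) (simp_all add: inv homA_A[OF hom(2)] dz_A, simp add: \<delta>_def inv)
  show "\<exists>n. (\<delta> ^^ n) F = 0" if "F \<in> A"
  proof -
    obtain n where "(dz ^^ n) (\<beta> F) = 0" using dz_nilpotent[OF homA_A[OF hom(2) \<open>F \<in> A\<close>]] by blast
    then have "(\<delta> ^^ n) F = 0" using iter[OF \<open>F \<in> A\<close>, of n] homA_0[OF hom(1)] by simp
    then show ?thesis by blast
  qed
  show "\<exists>F\<in>A. \<delta> F \<noteq> 0"
  proof (intro bexI)
    show "\<alpha> (lvar 0) \<in> A" using homA_A[OF hom(1)] A_lvar by simp
    show "\<delta> (\<alpha> (lvar 0)) \<noteq> 0"
    proof
      assume "\<delta> (\<alpha> (lvar 0)) = 0"
      then have "\<alpha> (mon kvec 1) = 0" unfolding \<delta>_def using inv(2) A_lvar[of 0] by (simp add: dz_lvar_0)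
      then have "mon kvec (1::'a) = \<beta> 0" using inv(2)[OF kvec_A[of 1]] by simp
      then show False using homA_0[OF hom(2)] mon_neq_0[of 1 kvec] by simp
    qed
  qed
qed

text \<open>The image of the kernel of the canonical derivation is annihilated by the conjugate derivation.\<close>

lemma aut_B:
  assumes "autA \<alpha> \<beta>" "F \<in> B"
  shows "\<alpha> F \<in> B"
proof -
  note hom = autA_hom[OF assms(1)] and inv = autA_inverse[OF autA_sym[OF assms(1)]]
  have F: "F \<in> A" using assms(2) by (rule B_A)
  have "\<alpha> (dz (\<beta> (\<alpha> F))) = 0"
    using inv[OF F] dz_eq_0_iff[OF F] assms(2) homA_0[OF hom(1)] by simp
  then have "\<forall>s\<in>expts (\<alpha> F). coef s 0 = 0"
    using lnd_kernel(1)[OF conjugate_lnd[OF assms(1)] homA_A[OF hom(1) F]] by blast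
  then show ?thesis using B_iff[OF homA_A[OF hom(1) F]] by blast
qed

subsection \<open>Polynomials in \<open>z\<close>\<close>

definition z_free :: "'a laurent set" where
  "z_free = {F. expts F \<subseteq> {s. expts s \<subseteq> idx \<and> coef s 0 = 0}}"

lemma B_z_free: "F \<in> B \<Longrightarrow> F \<in> z_free"
  unfolding B_def z_free_def nonneg_def by blast

lemma z_free_closed:
  shows "F \<in> z_free \<Longrightarrow> G \<in> z_free \<Longrightarrow> F + G \<in> z_free"
    "F \<in> z_free \<Longrightarrow> G \<in> z_free \<Longrightarrow> F - G \<in> z_free"
    "F \<in> z_free \<Longrightarrow> G \<in> z_free \<Longrightarrow> F * G \<in> z_free"
proof -
  show "F \<in> z_free \<Longrightarrow> G \<in> z_free \<Longrightarrow> F + G \<in> z_free"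
    unfolding z_free_def using expts_add_subset by blast
  show "F \<in> z_free \<Longrightarrow> G \<in> z_free \<Longrightarrow> F - G \<in> z_free"
    unfolding z_free_def mem_Collect_eq by (rule expts_diff_subset)
  show "F \<in> z_free \<Longrightarrow> G \<in> z_free \<Longrightarrow> F * G \<in> z_free"
    unfolding z_free_def mem_Collect_eq
  proof (rule expts_mult_subset)
    fix s t :: "nat \<Rightarrow>\<^sub>0 int"
    assume "s \<in> {s. expts s \<subseteq> idx \<and> coef s 0 = 0}" "t \<in> {s. expts s \<subseteq> idx \<and> coef s 0 = 0}"
    then show "s + t \<in> {s. expts s \<subseteq> idx \<and> coef s 0 = 0}"
      using keys_add[of s t] by (auto simp: lookup_add)
  qed
qed

lemma z_free_coef: "F \<in> z_free \<Longrightarrow> coef s 0 \<noteq> 0 \<Longrightarrow> coef F s = 0"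
  by (auto simp: z_free_def subset_iff in_keys_iff)

text \<open>The coefficients are free of \<open>z\<close>, so terms of different degree in \<open>z\<close> do not mix.\<close>

lemma coef_poly_z:
  assumes "\<And>i. coeff p i \<in> z_free" "coef s 0 = 0"
  shows "coef (poly p (lvar 0)) (s + z_exp n) = coef (coeff p n) s"
  using assms(1)
proof (induction p arbitrary: n)
  case 0
  then show ?case by simp
next
  case (pCons a q)
  have q: "coeff q i \<in> z_free" for i using pCons.prems[of "Suc i"] by simp
  have a: "a \<in> z_free" using pCons.prems[of 0] by simp
  have eq: "coef (poly (pCons a q) (lvar 0)) (s + z_exp n) = coef a (s + z_exp n) + coef (poly q (lvar 0)) (s + z_exp n - unit_exp 0)"
    by (simp add: lookup_add coef_mono_mult)
  show ?case
  proof (cases n)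
    case 0
    let ?S = "{s. coef s 0 \<ge> 0} :: (nat \<Rightarrow>\<^sub>0 int) set"
    have "expts (poly q (lvar 0)) \<subseteq> ?S"
    proof (rule expts_poly_subset)
      show "expts (coeff q i) \<subseteq> ?S" for i using q[of i] unfolding z_free_def by fastforce
      show "expts (lvar 0 :: 'a laurent) \<subseteq> ?S" by (rule expts_mono_subset) (simp add: coef_unit_exp)
    qed (simp add: lookup_add)
    moreover have "s - unit_exp 0 \<notin> ?S" using assms(2) by (simp add: lookup_minus coef_unit_exp)
    ultimately have "coef (poly q (lvar 0)) (s - unit_exp 0) = 0"
      by (auto simp: subset_iff in_keys_iff simp del: lookup_minus)
    then show ?thesis using eq 0 by simp
  next
    case (Suc n')
    have "coef (s + z_exp n) 0 \<noteq> 0" using assms(2) Suc by (simp add: lookup_add coef_z_exp)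
    then have e1: "coef a (s + z_exp n) = 0" by (rule z_free_coef[OF a])
    have e2: "s + z_exp n - unit_exp 0 = s + z_exp n'"
      using z_exp_add[of n' "Suc 0"] by (simp add: Suc z_exp_1 algebra_simps)
    show ?thesis unfolding eq e1 e2 by (simp add: pCons.IH[OF q] Suc)
  qed
qed

lemma lvar0_power: "lvar 0 ^ n = (mon (z_exp n) 1 :: 'a laurent)"
  by (induction n) (simp_all add: mult_single z_exp_add flip: z_exp_1)

text \<open>The criterion for divisibility by \<open>M\<close>: a Laurent polynomial of small degree in \<open>z\<close> belongs to the
  coordinate ring only if all its coefficients are polynomials in \<open>y\<^sub>2, \<dots>, y\<^sub>m\<close>.\<close>

lemma poly_z_in_A:
  assumes "\<And>i. coeff p i \<in> z_free" "degree p < d" "poly p (lvar 0) \<in> A"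
  shows "coeff p n \<in> B"
proof -
  have "expts (poly p (lvar 0)) \<subseteq> {s. coef s 0 < int d}"
    unfolding poly_altdef
  proof (rule expts_sum_subset)
    fix i assume "i \<in> {..degree p}"
    then have i: "i < d" using assms(2) by simp
    show "expts (coeff p i * lvar 0 ^ i) \<subseteq> {s. coef s 0 < int d}"
    proof
      fix x assume "x \<in> expts (coeff p i * lvar 0 ^ i)"
      then obtain u v where uv: "x = u + v" "u \<in> expts (coeff p i)" "v \<in> expts (mon (z_exp i) 1 :: 'a laurent)"
        unfolding lvar0_power using keys_mult by blast
      have "v = z_exp i" using uv(3) by (simp split: if_splits)
      moreover have "coef u 0 = 0" using uv(2) assms(1)[of i] unfolding z_free_def by blast
      ultimately show "x \<in> {s. coef s 0 < int d}" using i uv(1) by (simp add: lookup_add coef_z_exp)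
    qed
  qed
  then have low: "expts (poly p (lvar 0)) \<subseteq> low"
    using assms(3) by (intro A_low) blast+
  show ?thesis unfolding B_def
  proof (rule CollectI, rule subsetI)
    fix s assume s: "s \<in> expts (coeff p n)"
    then have s0: "expts s \<subseteq> idx" "coef s 0 = 0" using assms(1)[of n] unfolding z_free_def by blast+
    have "s + z_exp n \<in> expts (poly p (lvar 0))"
      using s coef_poly_z[OF assms(1) s0(2)] by (simp add: in_keys_iff)
    then have nn: "s + z_exp n \<in> nonneg" using low low_nonneg by blast
    have "coef s i \<ge> 0" for i
    proof (cases "i = 0")
      case False
      have "coef (s + z_exp n) i \<ge> 0" using nn by (simp add: nonneg_def)
      then show ?thesis using False by (simp add: lookup_add coef_z_exp)
    qed (simp add: s0)
    then show "s \<in> {s \<in> nonneg. coef s 0 = 0}" using s0 by (simp add: nonneg_def)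
  qed
qed

lemma linear_in_z:
  assumes "expts F \<subseteq> {s \<in> nonneg. coef s 0 \<le> 1}"
  shows "\<exists>G\<in>B. \<exists>H\<in>B. F = lvar 0 * G + H"
  using assms
proof (induction F rule: laurent_induct)
  case zero
  then show ?case using B_const[of 0] by (intro bexI[of _ 0]) auto
next
  case (mon s c)
  show ?case
  proof (cases "coef s 0 = 0")
    case True
    then have "mon s c \<in> B" using mon by (intro B_mon) auto
    moreover have "0 \<in> B" using B_const[of 0] by simp
    ultimately show ?thesis by (intro bexI[of _ 0] bexI[of _ "mon s c"]) auto
  next
    case False
    then have s0: "coef s 0 = 1" using mon by (auto simp: nonneg_def dest: spec[of _ 0])
    have ct: "coef (s - unit_exp 0) i = (if i = 0 then 0 else coef s i)" for i
      by (simp add: lookup_minus coef_unit_exp s0)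
    have "s - unit_exp 0 \<in> nonneg"
      using mon by (auto simp: nonneg_def ct in_keys_iff split: if_splits)
    then have "mon (s - unit_exp 0) c \<in> B" by (rule B_mon) (simp add: ct)
    moreover have "0 \<in> B" using B_const[of 0] by simp
    moreover have "mon s c = lvar 0 * mon (s - unit_exp 0) c + 0" by (simp add: mult_single)
    ultimately show ?thesis by blast
  qed
next
  case (add F F')
  then obtain G H G' H' where GH: "G \<in> B" "H \<in> B" "F = lvar 0 * G + H" "G' \<in> B" "H' \<in> B" "F' = lvar 0 * G' + H'"
    by blast
  have "F + F' = lvar 0 * (G + G') + (H + H')" unfolding GH(3,6) by (simp add: algebra_simps)
  moreover have "G + G' \<in> B" "H + H' \<in> B" using GH B_add by blast+
  ultimately show ?case by blast
qed

lemma linear_in_z_unique: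
  assumes "G \<in> B" "H \<in> B" "G' \<in> B" "H' \<in> B" "lvar 0 * G + H = lvar 0 * G' + H'"
  shows "G = G'"
proof (rule poly_mapping_eqI)
  fix s
  have *: "coef X s = coef (lvar 0 * X + Z) (s + z_exp 1)" if "X \<in> B" "Z \<in> B" "coef s 0 = 0" for X Z
  proof -
    have zf: "coeff [:Z, X:] i \<in> z_free" for i
    proof -
      have "0 \<in> B" using B_const[of 0] by simp
      then show ?thesis using that B_z_free by (auto simp: coeff_pCons split: nat.split)
    qed
    have "poly [:Z, X:] (lvar 0) = lvar 0 * X + Z" by (simp add: algebra_simps)
    moreover have "coeff [:Z, X:] 1 = X" by simp
    ultimately show ?thesis using coef_poly_z[of "[:Z, X:]" s 1, OF zf that(3)] by metis
  qed
  show "coef G s = coef G' s"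
  proof (cases "coef s 0 = 0")
    case True
    then show ?thesis using *[of G H] *[of G' H'] assms by simp
  next
    case False
    then have "s \<notin> expts G" "s \<notin> expts G'" using assms unfolding B_def by auto
    then show ?thesis by (simp add: in_keys_iff)
  qed
qed

text \<open>A factor of \<open>1\<close> is a monomial, and the exponents of two inverse monomials cannot both be nonnegative
  unless they vanish.\<close>

lemma B_unit:
  assumes "F \<in> B" "G \<in> B" "F * G = 1"
  obtains c where "c \<noteq> 0" "F = mon 0 c"
proof -
  have FG: "F * G = mon 0 1" "G * F = mon 0 1" using assms(3) by (simp_all add: mult.commute)
  obtain s c where s: "F = mon s c" "c \<noteq> 0" using mono_factor_is_mono[OF FG(1)] by auto
  obtain t b where t: "G = mon t b" "b \<noteq> 0" using mono_factor_is_mono[OF FG(2)] by auto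
  have "s \<in> nonneg" "t \<in> nonneg" using assms(1,2) s t unfolding B_def by auto
  moreover have "s + t = 0"
  proof -
    have "expts (mon (s + t) (c * b)) = {0::nat \<Rightarrow>\<^sub>0 int}" using assms(3) unfolding s t mult_single by (simp del: keys_single)
    then show ?thesis using s t by simp
  qed
  ultimately have "s = 0"
    by (intro poly_mapping_eqI) (auto simp: nonneg_def add_eq_0_iff lookup_add dest!: arg_cong[where f = coef] intro: antisym)
  then show ?thesis using that s by blast
qed

lemma B_cancel_const:
  assumes "mon 0 c * F \<in> B" "c \<noteq> 0"
  shows "F \<in> B"
proof -
  have "mon 0 (inverse c) * (mon 0 c * F) \<in> B" by (rule B_mult[OF B_const assms(1)])
  also have "mon 0 (inverse c) * (mon 0 c * F) = F"
    using assms(2) by (simp add: mult.assoc[symmetric] mult_single)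
  finally show ?thesis .
qed

lemma mon_eq_mon:
  fixes s t :: "nat \<Rightarrow>\<^sub>0 int" and b c :: 'a
  assumes "mon s c = mon t b" "c \<noteq> 0" "b \<noteq> 0"
  shows "s = t"
proof -
  have "expts (mon s c) = expts (mon t b)" by (simp only: assms(1))
  then show ?thesis using assms(2,3) by simp
qed

lemma aut_inject:
  assumes "autA \<alpha> \<beta>" "F \<in> A" "G \<in> A" "\<alpha> F = \<alpha> G"
  shows "F = G"
  using autA_inverse[OF autA_sym[OF assms(1)] assms(2)] autA_inverse[OF autA_sym[OF assms(1)] assms(3)]
  unfolding assms(4) by (rule trans[OF sym])

text \<open>The canonical derivation annihilates \<open>z\<close> in two steps, so the conjugate derivation does the same with
  the image of \<open>z\<close>.\<close>

lemma aut_z_linear: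
  assumes "autA \<alpha> \<beta>"
  shows "\<exists>G\<in>B. \<exists>H\<in>B. \<alpha> (lvar 0) = lvar 0 * G + H"
proof (rule linear_in_z)
  note hom = autA_hom[OF assms(1)] and inv = autA_inverse[OF autA_sym[OF assms(1)]]
  have Z: "lvar 0 \<in> A" by (simp add: A_lvar)
  have aZ: "\<alpha> (lvar 0) \<in> A" using homA_A[OF hom(1) Z] .
  have "dz (mon kvec 1) = 0" using dz_eq_0_iff[OF kvec_A] B_kvec by blast
  then have "\<alpha> (dz (\<beta> (\<alpha> (dz (\<beta> (\<alpha> (lvar 0))))))) = 0"
    using inv[OF Z] inv[OF kvec_A[of 1]] homA_0[OF hom(1)] by (simp add: dz_lvar_0)
  then have le: "coef s 0 \<le> 1" if "s \<in> expts (\<alpha> (lvar 0))" for s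
    using lnd_kernel(2)[OF conjugate_lnd[OF assms] aZ that] by blast
  then have "expts (\<alpha> (lvar 0)) \<subseteq> low" using d_ge_2 by (intro A_low[OF aZ]) force
  then show "expts (\<alpha> (lvar 0)) \<subseteq> {s \<in> nonneg. coef s 0 \<le> 1}" using le low_nonneg by blast
qed

text \<open>Substituting the inverse, \<open>z = \<alpha>(\<beta>(z))\<close>, shows that the coefficient of \<open>z\<close> is invertible in \<open>B\<close>.\<close>

lemma aut_z:
  assumes "autA \<alpha> \<beta>"
  obtains a H where "a \<noteq> 0" "H \<in> B" "\<alpha> (lvar 0) = lvar 0 * mon 0 a + H"
proof -
  note hom = autA_hom[OF assms(1)] and inv = autA_inverse[OF assms(1)]
  have Z: "lvar 0 \<in> A" by (simp add: A_lvar)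
  obtain G H where GH: "G \<in> B" "H \<in> B" "\<alpha> (lvar 0) = lvar 0 * G + H"
    using aut_z_linear[OF assms] by blast
  obtain G' H' where GH': "G' \<in> B" "H' \<in> B" "\<beta> (lvar 0) = lvar 0 * G' + H'"
    using aut_z_linear[OF autA_sym[OF assms]] by blast
  have "lvar 0 = \<alpha> (lvar 0 * G' + H')" using inv[OF Z] GH'(3) by simp
  also have "\<dots> = (lvar 0 * G + H) * \<alpha> G' + \<alpha> H'"
    using Z GH' by (simp add: homA_add[OF hom(1)] homA_mult[OF hom(1)] A_mult B_A GH(3))
  finally have eq: "lvar 0 * (G * \<alpha> G') + (H * \<alpha> G' + \<alpha> H') = lvar 0 * mon 0 1 + 0"
    by (simp add: algebra_simps)
  note img = aut_B[OF assms GH'(1)] aut_B[OF assms GH'(2)]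
  have "0 \<in> B" using B_const[of 0] by simp
  from linear_in_z_unique[OF B_mult[OF GH(1) img(1)] B_add[OF B_mult[OF GH(2) img(1)] img(2)] B_const this eq]
  have "G * \<alpha> G' = 1" by simp
  then obtain a where "a \<noteq> 0" "G = mon 0 a"
    by (rule B_unit[OF GH(1) img(1)])
  then show ?thesis using GH(2,3) by (intro that[of a H]) simp_all
qed

lemma kvec_inverse_z_free: "F \<in> z_free \<Longrightarrow> mon (- kvec) 1 * F \<in> z_free"
proof (rule z_free_closed(3))
  show "mon (- kvec) 1 \<in> z_free"
    unfolding z_free_def using expts_kvec by (intro CollectI expts_mono_subset) (auto simp: idx_def)
qed

lemma kvec_cancel: "mon kvec 1 * (mon (- kvec) 1 * F) = (F :: 'a laurent)"
  by (simp add: mult.assoc[symmetric])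

lemma coeff_lift_z_free: "coeff (lift_poly Q) i \<in> z_free" for Q :: "'a poly"
  using B_const B_z_free by (auto simp: coeff_map_poly)

lemma degree_lift: "degree (lift_poly Q) = degree Q" for Q :: "'a poly"
proof (rule degree_map_poly)
  fix x :: 'a assume "x \<noteq> 0"
  then show "mon 0 x \<noteq> (0 :: 'a laurent)" by (rule mon_neq_0)
qed

text \<open>The conjugate derivation \<open>\<delta>\<close> annihilates \<open>M\<close> and maps \<open>a z\<close> to \<open>\<alpha>(M)\<close>. Applied to \<open>y\<^sub>1 M = P(z)\<close> it gives
  \<open>a M \<delta>(y\<^sub>1) = P'(z) \<alpha>(M)\<close>. As \<open>\<delta>(y\<^sub>1)\<close> is in the coordinate ring and \<open>P'\<close> has degree \<open>d - 1\<close>, the criterion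
  for divisibility applies to the leading coefficient.\<close>

lemma aut_kvec_divisible:
  assumes "autA \<alpha> \<beta>"
  obtains U where "U \<in> B" "\<alpha> (mon kvec 1) = mon kvec 1 * U"
proof -
  note hom = autA_hom[OF assms(1)] and inv = autA_inverse[OF autA_sym[OF assms(1)]]
  define \<delta> where "\<delta> = (\<lambda>F. \<alpha> (dz (\<beta> F)))"
  have der: "derivA \<delta>" unfolding \<delta>_def by (rule conjugate_lnd(1)[OF assms])
  have \<delta>A: "F \<in> A \<Longrightarrow> \<delta> F \<in> A" for F using der unfolding derivA_def by blast
  have \<delta>_add: "\<delta> (F + G) = \<delta> F + \<delta> G" if "F \<in> A" "G \<in> A" for F G
    using der that unfolding derivA_def by blast
  have \<delta>_mult: "\<delta> (F * G) = F * \<delta> G + G * \<delta> F" if "F \<in> A" "G \<in> A" for F G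
    using der that unfolding derivA_def by blast
  have \<delta>_const: "\<delta> (mon 0 c) = 0" for c using der unfolding derivA_def by blast
  have \<delta>B: "\<delta> F = 0" if "F \<in> B" for F
  proof -
    have "\<beta> F \<in> B" using aut_B[OF autA_sym[OF assms] that] .
    then have "dz (\<beta> F) = 0" using dz_eq_0_iff B_A by blast
    then show ?thesis by (simp add: \<delta>_def homA_0[OF hom(1)])
  qed
  have Z: "lvar 0 \<in> A" by (simp add: A_lvar)
  obtain a H where aH: "a \<noteq> 0" "H \<in> B" "\<alpha> (lvar 0) = lvar 0 * mon 0 a + H"
    using aut_z[OF assms] .
  have "\<alpha> (mon kvec 1) = \<delta> (\<alpha> (lvar 0))"
    using inv[OF Z] by (simp add: \<delta>_def dz_lvar_0)
  also have "\<dots> = mon 0 a * \<delta> (lvar 0)"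
    unfolding aH(3) using aH(2) Z
    by (simp add: \<delta>_add \<delta>_mult \<delta>_const \<delta>B A_mult A_const B_A)
  finally have \<alpha>M: "\<alpha> (mon kvec 1) = mon 0 a * \<delta> (lvar 0)" .
  define P' where "P' = (poly (lift_poly (pderiv P)) (lvar 0) :: 'a laurent)"
  have "mon kvec 1 * \<delta> y1 = \<delta> (y1 * mon kvec 1)"
    using A_y1 kvec_A[of 1] B_kvec[of 1] by (simp add: \<delta>_mult \<delta>B)
  also have "\<dots> = P' * \<delta> (lvar 0)"
    unfolding y1_mult_kvec P'_def by (rule derivA_zpoly[OF der])
  finally have M\<delta>: "mon kvec 1 * \<delta> y1 = P' * \<delta> (lvar 0)" .
  define Q where "Q = mon (- kvec) 1 * \<alpha> (mon kvec 1)"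
  have Q: "Q \<in> z_free" unfolding Q_def
    by (rule kvec_inverse_z_free[OF B_z_free[OF aut_B[OF assms B_kvec]]])
  have "mon 0 a * \<delta> y1 = P' * Q"
  proof -
    have "mon kvec 1 * (mon 0 a * \<delta> y1) = mon 0 a * (mon kvec 1 * \<delta> y1)" by (simp only: mult_ac)
    also have "\<dots> = P' * (mon 0 a * \<delta> (lvar 0))" unfolding M\<delta> by (simp only: mult_ac)
    also have "\<dots> = P' * \<alpha> (mon kvec 1)" unfolding \<alpha>M ..
    also have "\<dots> = P' * (mon kvec 1 * Q)" unfolding Q_def kvec_cancel ..
    also have "\<dots> = mon kvec 1 * (P' * Q)" by (simp only: mult_ac)
    finally have eq: "mon kvec 1 * (mon 0 a * \<delta> y1) = mon kvec 1 * (P' * Q)" .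
    have "mon kvec (1::'a) \<noteq> 0" by (rule mon_neq_0) simp
    from mult_left_cancel[OF this, THEN iffD1, OF eq] show ?thesis .
  qed
  moreover have "mon 0 a * \<delta> y1 \<in> A" by (rule A_mult[OF A_const \<delta>A[OF A_y1]])
  moreover define p where "p = smult Q (lift_poly (pderiv P))"
  ultimately have pA: "poly p (lvar 0) \<in> A" by (simp add: P'_def mult.commute)
  have "coeff p i \<in> z_free" for i
    unfolding p_def coeff_smult using Q coeff_lift_z_free by (rule z_free_closed(3))
  moreover have "degree p < d"
  proof -
    have "degree p \<le> degree (lift_poly (pderiv P))" unfolding p_def by (rule degree_smult_le)
    also have "\<dots> = degree (pderiv P)" by (rule degree_lift)
    also have "\<dots> < d" using d_ge_2 by (simp add: degree_pderiv)
    finally show ?thesis .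
  qed
  ultimately have "coeff p (d - 1) \<in> B" using pA by (intro poly_z_in_A)
  moreover have "coeff p (d - 1) = Q * mon 0 (of_nat d)"
    using P_monic d_ge_2 by (simp add: p_def coeff_map_poly coeff_pderiv del: single_of_nat)
  ultimately have "mon 0 (of_nat d) * Q \<in> B" by (simp only: mult.commute)
  then have "Q \<in> B" by (rule B_cancel_const) (use d_ge_2 in simp)
  moreover have "\<alpha> (mon kvec 1) = mon kvec 1 * Q" unfolding Q_def kvec_cancel ..
  ultimately show ?thesis by (rule that)
qed

text \<open>The quotient of \<open>\<alpha>(M)\<close> by \<open>M\<close> is invertible, since \<open>M\<close> also divides its image under the inverse.\<close>

lemma aut_kvec:
  assumes "autA \<alpha> \<beta>"
  obtains c where "c \<noteq> 0" "\<alpha> (mon kvec 1) = mon kvec c"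
proof -
  note hom = autA_hom[OF assms(1)] and inv = autA_inverse[OF assms(1)]
  obtain U where U: "U \<in> B" "\<alpha> (mon kvec 1) = mon kvec 1 * U" using aut_kvec_divisible[OF assms] .
  obtain U' where U': "U' \<in> B" "\<beta> (mon kvec 1) = mon kvec 1 * U'" using aut_kvec_divisible[OF autA_sym[OF assms]] .
  have "mon kvec 1 = \<alpha> (mon kvec 1 * U')" using inv[OF kvec_A[of 1]] U'(2) by simp
  also have "\<dots> = mon kvec 1 * (U * \<alpha> U')"
    using homA_mult[OF hom(1) kvec_A B_A[OF U'(1)]] U(2) by (simp add: mult.assoc)
  finally have eq: "mon kvec 1 * (U * \<alpha> U') = mon kvec 1 * 1" by simp
  have "mon kvec (1::'a) \<noteq> 0" by (rule mon_neq_0) simp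
  from mult_left_cancel[OF this, THEN iffD1, OF eq] have "U * \<alpha> U' = 1" .
  then obtain c where "c \<noteq> 0" "U = mon 0 c" by (rule B_unit[OF U(1) aut_B[OF assms U'(1)]])
  then show ?thesis using that[of c] U(2) by (simp add: mult_single)
qed

text \<open>The image of \<open>y\<^sub>j\<close> is a factor of the monomial \<open>\<alpha>(M)\<close>.\<close>

lemma aut_lvar_mon:
  assumes "autA \<alpha> \<beta>" and j: "j \<in> {2..m}"
  shows "\<exists>v c. c \<noteq> 0 \<and> v \<in> nonneg \<and> coef v 0 = 0 \<and> v \<noteq> 0 \<and> \<alpha> (lvar j) = mon v c"
proof -
  note hom = autA_hom[OF assms(1)] and inv = autA_inverse[OF autA_sym[OF assms(1)]]
  obtain c where c: "c \<noteq> 0" "\<alpha> (mon kvec 1) = mon kvec c" using aut_kvec[OF assms(1)] .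
  have jA: "lvar j \<in> A" using j by (simp add: A_lvar)
  have "coef (kvec - unit_exp j) i \<ge> 0" for i
  proof (cases "i = j")
    case True
    then have "k i \<ge> 2" using k_ge_2 j by blast
    then show ?thesis using True j by (simp add: lookup_minus coef_kvec coef_unit_exp)
  qed (simp add: lookup_minus coef_kvec coef_unit_exp)
  moreover have "expts (kvec - unit_exp j) \<subseteq> idx"
    using expts_kvec j by (intro expts_diff_subset) (auto simp: idx_def)
  ultimately have "mon (kvec - unit_exp j) 1 \<in> A"
    by (intro nonneg_A expts_mono_subset) (simp add: nonneg_def)
  then have "\<alpha> (lvar j) * \<alpha> (mon (kvec - unit_exp j) 1) = \<alpha> (lvar j * mon (kvec - unit_exp j) 1)"
    using homA_mult[OF hom(1) jA] by simp
  also have "\<dots> = mon kvec c" using c(2) by (simp add: mult_single)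
  finally obtain v b where v: "\<alpha> (lvar j) = mon v b" "b \<noteq> 0" by (rule mono_factor_is_mono[OF _ c(1)])
  have "mon v b \<in> B" using aut_B[OF assms(1) B_lvar[OF j]] v by simp
  then have "v \<in> nonneg" "coef v 0 = 0" using v(2) unfolding B_def by auto
  moreover have "v \<noteq> 0"
  proof
    assume "v = 0"
    then have "lvar j = mon 0 b"
      using inv[OF jA] v(1) homA_const[OF hom(2)] by simp
    then have "expts (lvar j :: 'a laurent) = expts (mon (0::nat \<Rightarrow>\<^sub>0 int) b)" by simp
    then have "unit_exp j = 0" using v(2) by simp
    then have "expts (unit_exp j) = {}" by simp
    then show False by simp
  qed
  ultimately show ?thesis using v by blast
qed

text \<open>The images of \<open>y\<^sub>2, \<dots>, y\<^sub>m\<close> under an automorphism and its inverse are monomials; counting total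
  degrees in the composition, each of them is a multiple of one variable.\<close>

lemma aut_lvar:
  assumes "autA \<alpha> \<beta>" and j: "j \<in> {2..m}"
  shows "\<exists>i c. i \<in> {2..m} \<and> c \<noteq> 0 \<and> \<beta> (lvar j) = mon (unit_exp i) c"
proof -
  note hom = autA_hom[OF assms(1)] and inv = autA_inverse[OF assms(1)]
  have "\<exists>v c. \<forall>i\<in>{2..m}. c i \<noteq> 0 \<and> v i \<in> nonneg \<and> coef (v i) 0 = 0 \<and> v i \<noteq> 0 \<and> \<alpha> (lvar i) = mon (v i) (c i)"
    using aut_lvar_mon[OF assms(1)] by metis
  then obtain v c where v: "\<And>i. i \<in> {2..m} \<Longrightarrow> c i \<noteq> 0" "\<And>i. i \<in> {2..m} \<Longrightarrow> v i \<in> nonneg"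
      "\<And>i. i \<in> {2..m} \<Longrightarrow> v i \<noteq> 0" "\<And>i. i \<in> {2..m} \<Longrightarrow> coef (v i) 0 = 0"
      "\<And>i. i \<in> {2..m} \<Longrightarrow> \<alpha> (lvar i) = mon (v i) (c i)" by blast
  obtain w b where w: "b \<noteq> 0" "w \<in> nonneg" "coef w 0 = 0" "w \<noteq> 0" "\<beta> (lvar j) = mon w b"
    using aut_lvar_mon[OF autA_sym[OF assms(1)] j] by blast
  define tdeg where "tdeg s = (\<Sum>i\<in>{2..m}. coef s i)" for s :: "nat \<Rightarrow>\<^sub>0 int"
  have tdeg_sum: "tdeg (\<Sum>i\<in>J. f i) = (\<Sum>i\<in>J. tdeg (f i))" for f and J :: "nat set"
    unfolding tdeg_def lookup_sum by (rule sum.swap)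
  have tdeg_pos: "tdeg s \<ge> 1" if s: "s \<in> nonneg" "s \<noteq> 0" "coef s 0 = 0" for s
  proof -
    obtain i where i: "coef s i \<noteq> 0" using s(2) by (metis poly_mapping_eqI lookup_zero)
    then have "i \<in> expts s" by (simp add: in_keys_iff)
    then have "i \<in> {2..m}" using s i unfolding nonneg_def idx_def by auto
    moreover have "coef s i \<ge> 1" using i s(1) unfolding nonneg_def by (simp add: less_le zero_less_iff_neq_zero int_one_le_iff_zero_less)
    ultimately show ?thesis unfolding tdeg_def using s(1)
      by (intro order.trans[OF _ member_le_sum[of i "{2..m}"]]) (auto simp: nonneg_def)
  qed
  have powA: "lvar i ^ nat (coef w i) \<in> A" if "i \<in> {2..m}" for i using that by (simp add: A_lvar A_power)
  have monw: "mon w 1 = (\<Prod>i\<in>{2..m}. lvar i ^ nat (coef w i))"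
    unfolding mon_eq_prod[OF w(2)] idx_def using w(3) by simp
  have "\<alpha> (mon w 1) = (\<Prod>i\<in>{2..m}. \<alpha> (lvar i) ^ nat (coef w i))"
    unfolding monw by (subst homA_prod[OF _ hom(1) powA]) (simp_all add: homA_power[OF hom(1)] A_lvar)
  also have "\<dots> = (\<Prod>i\<in>{2..m}. mon (\<Sum>_<nat (coef w i). v i) (c i ^ nat (coef w i)))"
    using v(5) by (intro prod.cong) (simp_all add: mono_power del: sum_constant)
  also have "\<dots> = mon (\<Sum>i\<in>{2..m}. \<Sum>_<nat (coef w i). v i) (\<Prod>i\<in>{2..m}. c i ^ nat (coef w i))"
    by (rule mono_prod) simp
  finally have \<alpha>w: "\<alpha> (mon w 1) = mon (\<Sum>i\<in>{2..m}. \<Sum>_<nat (coef w i). v i) (\<Prod>i\<in>{2..m}. c i ^ nat (coef w i))" .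
  have "lvar j = \<alpha> (mon 0 b * mon w 1)"
    using inv[OF A_lvar[of j]] j w(5) by (simp add: mult_single)
  also have "\<dots> = mon 0 b * \<alpha> (mon w 1)"
    using homA_mult[OF hom(1) A_const B_A[OF B_mon[OF w(2,3)]]] homA_const[OF hom(1)] by simp
  finally have "lvar j = mon (\<Sum>i\<in>{2..m}. \<Sum>_<nat (coef w i). v i) (b * (\<Prod>i\<in>{2..m}. c i ^ nat (coef w i)))"
    unfolding \<alpha>w by (simp add: mult_single del: sum_constant)
  then have "unit_exp j = (\<Sum>i\<in>{2..m}. \<Sum>_<nat (coef w i). v i)"
    by (rule mon_eq_mon) (use w(1) v(1) in simp_all)
  then have "tdeg (unit_exp j) = tdeg (\<Sum>i\<in>{2..m}. \<Sum>_<nat (coef w i). v i)" by (simp only:)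
  also have "\<dots> = (\<Sum>i\<in>{2..m}. int (nat (coef w i)) * tdeg (v i))"
    unfolding tdeg_sum by simp
  also have "\<dots> \<ge> (\<Sum>i\<in>{2..m}. coef w i)"
  proof (rule sum_mono)
    fix i assume i: "i \<in> {2..m}"
    have "coef w i \<ge> 0" using w(2) by (simp add: nonneg_def)
    moreover have "tdeg (v i) \<ge> 1" using tdeg_pos v i by blast
    ultimately show "coef w i \<le> int (nat (coef w i)) * tdeg (v i)"
      by (simp add: mult_le_cancel_left1)
  qed
  finally have "tdeg w \<le> tdeg (unit_exp j)" unfolding tdeg_def .
  also have "tdeg (unit_exp j) = 1" using j by (simp add: tdeg_def coef_unit_exp)
  finally have tw: "tdeg w = 1" using tdeg_pos[OF w(2,4,3)] by simp
  obtain i where i: "coef w i \<noteq> 0" using w(4) by (metis poly_mapping_eqI lookup_zero)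
  then have "i \<in> expts w" by (simp add: in_keys_iff)
  then have im: "i \<in> {2..m}" using w i unfolding nonneg_def idx_def by auto
  have wnn: "coef w i' \<ge> 0" for i' using w(2) by (simp add: nonneg_def)
  have "coef w i' = coef (unit_exp i) i'" for i'
  proof -
    have split: "coef w i + (\<Sum>i\<in>{2..m} - {i}. coef w i) = 1"
      using tw im unfolding tdeg_def by (simp add: sum.remove[symmetric])
    have nn: "(\<Sum>i\<in>{2..m} - {i}. coef w i) \<ge> 0" using wnn by (intro sum_nonneg) auto
    have wi: "coef w i = 1" using split nn wnn[of i] i by linarith
    then have "(\<Sum>i\<in>{2..m} - {i}. coef w i) = 0" using split by simp
    then have "\<forall>x\<in>{2..m} - {i}. coef w x = 0" using wnn by (subst (asm) sum_nonneg_eq_0_iff) auto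
    moreover have "coef w x = 0" if "x \<notin> {2..m}" for x
    proof (rule ccontr)
      assume "coef w x \<noteq> 0"
      then have "x \<in> expts w" by (simp add: in_keys_iff)
      then show False using w(2,3) that \<open>coef w x \<noteq> 0\<close> unfolding nonneg_def idx_def by auto
    qed
    ultimately show ?thesis using wi by (cases "i' = i"; cases "i' \<in> {2..m}") (simp_all add: coef_unit_exp)
  qed
  then have "w = unit_exp i" by (rule poly_mapping_eqI)
  then show ?thesis using im w by blast
qed

lemma coeff_pcompose_linear:
  fixes p :: "'b::comm_ring_1 poly"
  shows "coeff (pcompose p [:h, a:]) n = (\<Sum>i\<le>degree p. coeff p i * (if n \<le> i then of_nat (i choose n) * a ^ n * h ^ (i - n) else 0))"
proof -
  have c: "coeff ([:h, a:] ^ i) n = (if n \<le> i then of_nat (i choose n) * a ^ n * h ^ (i - n) else 0)" for i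
  proof (cases "n \<le> i")
    case False
    have "degree ([:h, a:] ^ i) \<le> degree [:h, a:] * i" by (rule degree_power_le)
    also have "\<dots> \<le> i" by simp
    finally show ?thesis using False by (simp add: coeff_eq_0)
  qed (simp add: coeff_linear_poly_power)
  have "pcompose p [:h, a:] = (\<Sum>i\<le>degree p. smult (coeff p i) ([:h, a:] ^ i))"
  proof -
    have "pcompose p [:h, a:] = poly (map_poly (\<lambda>x. [:x:]) p) [:h, a:]" by (rule pcompose_altdef)
    also have "\<dots> = (\<Sum>i\<le>degree p. coeff (map_poly (\<lambda>x. [:x:]) p) i * [:h, a:] ^ i)"
    proof (cases "p = 0")
      case False
      then have "degree (map_poly (\<lambda>x. [:x:]) p) = degree p" by (intro degree_map_poly) auto
      then show ?thesis by (simp add: poly_altdef)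
    qed simp
    finally show ?thesis by (simp add: coeff_map_poly)
  qed
  then show ?thesis by (simp add: coeff_sum c)
qed

text \<open>The difference \<open>q\<close> of \<open>P(a z + H)\<close> and \<open>a\<^sup>d P(z)\<close> has degree less than \<open>d\<close> in \<open>z\<close> and becomes an element of
  the coordinate ring when divided by \<open>M\<close>, so all its coefficients are divisible by \<open>M\<close>. The coefficient
  of degree \<open>d - 1\<close> is \<open>d a\<^sup>d\<^sup>-\<^sup>1 H\<close>, because that of \<open>P\<close> vanishes; so \<open>H\<close> is divisible by \<open>M\<close>. Then \<open>q\<close> and
  \<open>H\<close> vanish where \<open>y\<^sub>2 = \<dots> = y\<^sub>m = 0\<close>, which gives the functional equation of \<open>P\<close>.\<close>

lemma aut_z_shift:
  assumes "autA \<alpha> \<beta>"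
  obtains a f where "a \<noteq> 0" "f \<in> B" "\<alpha> (lvar 0) = lvar 0 * mon 0 a + mon kvec 1 * f"
    "\<And>z. poly P (a * z) = a ^ d * poly P z"
proof -
  note hom = autA_hom[OF assms(1)] and inv = autA_inverse[OF assms(1)]
  obtain a H where aH: "a \<noteq> 0" "H \<in> B" "\<alpha> (lvar 0) = lvar 0 * mon 0 a + H"
    using aut_z[OF assms] .
  obtain c where c: "c \<noteq> 0" "\<alpha> (mon kvec 1) = mon kvec c" using aut_kvec[OF assms(1)] .
  define q where "q = pcompose (lift_poly P) [:H, mon 0 a:] - smult (mon 0 (a ^ d)) (lift_poly P)"
  have cq: "coeff q n = (\<Sum>i\<le>d. mon 0 (coeff P i) * (if n \<le> i then of_nat (i choose n) * mon 0 a ^ n * H ^ (i - n) else 0))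
      - mon 0 (a ^ d * coeff P n)" for n
    unfolding q_def coeff_diff coeff_pcompose_linear degree_lift by (simp add: coeff_map_poly mult_single)
  have B_pow: "F ^ n \<in> B" if "F \<in> B" for F n
    using that by (induction n) (use B_const[of 1] in \<open>simp_all add: B_mult\<close>)
  have B_sum: "(\<Sum>i\<in>I. F i) \<in> B" if "\<And>i. i \<in> I \<Longrightarrow> F i \<in> B" for F and I :: "nat set"
    using that by (induction I rule: infinite_finite_induct) (use B_const[of 0] in \<open>simp_all add: B_add\<close>)
  have Hn: "coeff q n \<in> z_free" for n
  proof -
    have "mon 0 (coeff P i) * (if n \<le> i then of_nat (i choose n) * mon 0 a ^ n * H ^ (i - n) else 0) \<in> B" for i
    proof -
      have "mon 0 (of_nat (i choose n)) * mon 0 a ^ n * H ^ (i - n) \<in> B"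
        by (rule B_mult[OF B_mult[OF B_const B_pow[OF B_const]] B_pow[OF aH(2)]])
      then show ?thesis using B_const[of 0] B_mult[OF B_const[of "coeff P i"]] by simp
    qed
    then show ?thesis unfolding cq by (intro z_free_closed(2) B_z_free B_sum B_const)
  qed
  have qn: "coeff q n = 0" if "n \<ge> d" for n
  proof (cases "n = d")
    case True
    have "coeff q d = (\<Sum>i\<le>d. if i = d then mon 0 (a ^ d) else 0) - mon 0 (a ^ d * coeff P d)"
      unfolding cq using P_monic
      by (intro arg_cong2[of _ _ _ _ "(-)"] sum.cong refl) (auto simp: mono_power)
    then show ?thesis using P_monic True by simp
  next
    case False
    then have "n > d" using that by simp
    then show ?thesis unfolding cq by (simp add: coeff_eq_0)
  qed
  have qd: "coeff q (d - 1) = mon 0 (of_nat d * a ^ (d - 1)) * H"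
  proof -
    have "coeff q (d - 1) = (\<Sum>i\<le>d. if i = d then mon 0 (of_nat d * a ^ (d - 1)) * H else 0)"
      unfolding cq using P_coeff P_monic d_ge_2
    proof (simp only: P_coeff mult_zero_right single_zero diff_zero, intro sum.cong refl)
      fix i assume "i \<in> {..d}"
      then consider "i = d" | "i = d - 1" | "i < d - 1" by fastforce
      then show "mon 0 (coeff P i) * (if d - 1 \<le> i then of_nat (i choose (d - 1)) * mon 0 a ^ (d - 1) * H ^ (i - (d - 1)) else 0)
        = (if i = d then mon 0 (of_nat d * a ^ (d - 1)) * H else 0)"
      proof cases
        case 1
        have "d choose (d - 1) = d" using d_ge_2 by (subst binomial_symmetric) auto
        moreover have "d - (d - 1) = 1" using d_ge_2 by simp
        moreover have "mon 0 (of_nat d * a ^ (d - 1)) = of_nat d * (mon 0 a ^ (d - 1) :: 'a laurent)"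
          by (simp add: mono_power flip: mult_single[of 0 _ 0, simplified])
        ultimately show ?thesis using 1 P_monic by simp
      qed (use P_coeff d_ge_2 in auto)
    qed
    then show ?thesis by simp
  qed
  define p where "p = smult (mon (- kvec) 1) q"
  have "coeff p n \<in> z_free" for n unfolding p_def coeff_smult by (rule kvec_inverse_z_free[OF Hn])
  moreover have "degree p < d"
  proof -
    have "degree q \<le> d - 1" by (rule degree_le) (use qn in auto)
    then show ?thesis using degree_smult_le[of "mon (- kvec) 1" q] d_ge_2 unfolding p_def by linarith
  qed
  moreover have pq: "mon kvec 1 * poly p (lvar 0) = poly q (lvar 0)"
    unfolding p_def poly_smult by (rule kvec_cancel)
  have q_eval: "poly q (lvar 0) = poly (lift_poly P) (\<alpha> (lvar 0)) - mon 0 (a ^ d) * poly (lift_poly P) (lvar 0)"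
    unfolding q_def aH(3) by (simp add: poly_pcompose algebra_simps)
  have pA: "poly p (lvar 0) = mon 0 c * \<alpha> y1 + mon 0 (- (a ^ d)) * y1"
  proof -
    have "poly (lift_poly P) (\<alpha> (lvar 0)) = \<alpha> (y1 * mon kvec 1)"
      unfolding y1_mult_kvec homA_zpoly[OF hom(1)] ..
    also have "\<dots> = mon kvec 1 * (mon 0 c * \<alpha> y1)"
      using homA_mult[OF hom(1) A_y1 kvec_A] c(2) by (simp add: mult_single mult.assoc[symmetric] mult.commute)
    finally have "poly q (lvar 0) = mon kvec 1 * (mon 0 c * \<alpha> y1) - mon 0 (a ^ d) * (y1 * mon kvec 1)"
      unfolding q_eval y1_mult_kvec by simp
    also have "\<dots> = mon kvec 1 * (mon 0 c * \<alpha> y1 + mon 0 (- (a ^ d)) * y1)"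
      by (simp add: single_uminus algebra_simps)
    finally have eq: "mon kvec 1 * poly p (lvar 0) = mon kvec 1 * (mon 0 c * \<alpha> y1 + mon 0 (- (a ^ d)) * y1)"
      unfolding pq .
    have "mon kvec (1::'a) \<noteq> 0" by (rule mon_neq_0) simp
    from mult_left_cancel[OF this, THEN iffD1, OF eq] show ?thesis .
  qed
  have pinA: "poly p (lvar 0) \<in> A"
    unfolding pA by (rule A_add[OF A_mult[OF A_const homA_A[OF hom(1) A_y1]] A_mult[OF A_const A_y1]])
  ultimately have pB: "coeff p n \<in> B" for n using pinA by (intro poly_z_in_A)
  define f where "f = mon (- kvec) 1 * H"
  have "f \<in> B"
  proof -
    have e: "of_nat d * a ^ (d - 1) \<noteq> 0" using aH(1) d_ge_2 by simp
    have "coeff p (d - 1) = mon 0 (of_nat d * a ^ (d - 1)) * f"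
      unfolding p_def coeff_smult qd f_def by (simp only: mult_ac)
    then have "mon 0 (of_nat d * a ^ (d - 1)) * f \<in> B" using pB[of "d - 1"] by simp
    then show ?thesis using e by (rule B_cancel_const)
  qed
  moreover have H: "H = mon kvec 1 * f" unfolding f_def kvec_cancel ..
  moreover have "poly P (a * z) = a ^ d * poly P z" for z
  proof -
    define x where "x = (\<lambda>i::nat. if i = 0 then z else 0)"
    have def: "expts F \<subseteq> nonneg \<Longrightarrow> expts F \<subseteq> defined_at x" for F :: "'a laurent"
      using nonneg_defined_at by blast
    have BD: "F \<in> B \<Longrightarrow> expts F \<subseteq> defined_at x" for F by (rule def) (auto simp: B_def)
    have Mx: "laurent_at x (mon kvec 1) = 0"
    proof -
      have "\<exists>j\<in>{2..m}. x j ^ k j = 0"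
        using m_ge_2 bspec[OF k_ge_2, of 2] by (intro bexI[of _ 2]) (auto simp: x_def)
      then show ?thesis by (simp add: mono_at_kvec M_def)
    qed
    have "lvar 0 \<in> {F. expts F \<subseteq> defined_at x}" by (auto simp: defined_at_def coef_unit_exp)
    then have lvar_def: "expts (lvar 0 :: 'a laurent) \<subseteq> defined_at x" by simp
    have pdef: "expts (poly p (lvar 0)) \<subseteq> defined_at x"
      using BD[OF pB] lvar_def defined_at_closed(2) by (rule expts_poly_subset)
    have poly_at: "laurent_at x (poly (lift_poly Q) F) = poly Q (laurent_at x F) \<and> expts (poly (lift_poly Q) F) \<subseteq> defined_at x"
      if F: "expts F \<subseteq> defined_at x" for Q F
    proof (induction Q)
      case (pCons b Q)
      have e1: "expts (mon 0 b :: 'a laurent) \<subseteq> defined_at x" by (rule BD[OF B_const])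
      have e2: "expts (F * poly (lift_poly Q) F) \<subseteq> defined_at x"
        using F pCons defined_at_closed(2) by (intro expts_mult_subset) auto
      show ?case using e1 e2 pCons F expts_add_subset[OF e1 e2]
        by (simp add: lift_poly_pCons laurent_at_add laurent_at_mult)
    qed simp
    have aZdef: "expts (lvar 0 * mon 0 a) \<subseteq> defined_at x"
      by (rule expts_mult_subset[OF lvar_def BD[OF B_const] defined_at_closed(2)])
    have "laurent_at x H = 0" unfolding H
      using Mx by (subst laurent_at_mult[OF BD[OF B_kvec] BD[OF \<open>f \<in> B\<close>]]) simp
    then have aZ: "laurent_at x (\<alpha> (lvar 0)) = a * z" unfolding aH(3)
      using lvar_def BD[OF B_const]
      by (simp add: laurent_at_add laurent_at_mult x_def del: keys_single)
    have aZd: "expts (\<alpha> (lvar 0)) \<subseteq> defined_at x" unfolding aH(3) by (rule expts_add_subset[OF aZdef BD[OF aH(2)]])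
    have "0 = laurent_at x (poly q (lvar 0))"
      unfolding pq[symmetric] using Mx by (subst laurent_at_mult[OF BD[OF B_kvec] pdef]) simp
    then have "laurent_at x (poly (lift_poly P) (\<alpha> (lvar 0))) = laurent_at x (mon 0 (a ^ d) * poly (lift_poly P) (lvar 0))"
      unfolding q_eval by (metis diff_add_cancel laurent_at_add add_0)
    also have "\<dots> = a ^ d * poly P z"
      using poly_at[OF lvar_def] BD[OF B_const] by (simp add: laurent_at_mult x_def del: keys_single)
    finally show ?thesis using poly_at[OF aZd] aZ by simp
  qed
  ultimately show ?thesis using aH(1,3) by (intro that[of a f]) simp_all
qed

theorem aut_structure:
  assumes "autA \<alpha> \<beta>"
  shows "\<exists>a f \<sigma> c. a \<noteq> 0 \<and> f \<in> B \<and> \<alpha> (lvar 0) = lvar 0 * mon 0 a + mon kvec 1 * f \<and>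
    (\<forall>z. poly P (a * z) = a ^ d * poly P z) \<and> inj_on \<sigma> {2..m} \<and>
    (\<forall>j\<in>{2..m}. \<sigma> j \<in> {2..m} \<and> k (\<sigma> j) = k j \<and> c j \<noteq> 0 \<and> \<alpha> (lvar j) = mon (unit_exp (\<sigma> j)) (c j))"
proof -
  note hom = autA_hom[OF assms(1)]
  have "\<exists>\<sigma> c. \<forall>j\<in>{2..m}. \<sigma> j \<in> {2..m} \<and> c j \<noteq> 0 \<and> \<alpha> (lvar j) = mon (unit_exp (\<sigma> j)) (c j)"
    using aut_lvar[OF autA_sym[OF assms]] by metis
  then obtain \<sigma> c where \<sigma>: "\<And>j. j \<in> {2..m} \<Longrightarrow> \<sigma> j \<in> {2..m}" "\<And>j. j \<in> {2..m} \<Longrightarrow> c j \<noteq> 0"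
    "\<And>j. j \<in> {2..m} \<Longrightarrow> \<alpha> (lvar j) = mon (unit_exp (\<sigma> j)) (c j)" by blast
  have inj: "inj_on \<sigma> {2..m}"
  proof (rule inj_onI)
    fix i j assume ij: "i \<in> {2..m}" "j \<in> {2..m}" "\<sigma> i = \<sigma> j"
    have A: "lvar i * mon 0 (c j) \<in> A" "lvar j * mon 0 (c i) \<in> A"
      using ij A_lvar A_const A_mult by simp_all
    have "\<alpha> (lvar i * mon 0 (c j)) = \<alpha> (lvar j * mon 0 (c i))"
      unfolding homA_mult[OF hom(1) A_lvar[OF idx_simps(2)[OF ij(1)]] A_const]
        homA_mult[OF hom(1) A_lvar[OF idx_simps(2)[OF ij(2)]] A_const] homA_const[OF hom(1)]
      unfolding \<sigma>(3)[OF ij(1)] \<sigma>(3)[OF ij(2)] mult_single ij(3)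
      by (simp add: mult.commute)
    from aut_inject[OF assms A this] have "mon (unit_exp i) (c j) = mon (unit_exp j) (c i)"
      by (simp add: mult_single)
    then have "unit_exp i = unit_exp j"
      by (rule mon_eq_mon) (use \<sigma>(2) ij in simp_all)
    then have "expts (unit_exp i) = expts (unit_exp j)" by simp
    then show "i = j" by simp
  qed
  have k\<sigma>: "k (\<sigma> j) = k j" if j: "j \<in> {2..m}" for j
  proof -
    obtain b where b: "b \<noteq> 0" "\<alpha> (mon kvec 1) = mon kvec b" using aut_kvec[OF assms(1)] .
    have powA: "lvar i ^ k i \<in> A" if "i \<in> {2..m}" for i using that by (simp add: A_lvar A_power)
    have "mon kvec (1::'a) = (\<Prod>i\<in>{2..m}. lvar i ^ k i)"
      unfolding mon_eq_prod[OF kvec_nonneg] idx_def by (simp add: coef_kvec)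
    then have "mon kvec b = \<alpha> (\<Prod>i\<in>{2..m}. lvar i ^ k i)" using b(2) by simp
    also have "\<dots> = (\<Prod>i\<in>{2..m}. \<alpha> (lvar i) ^ k i)"
      by (subst homA_prod[OF _ hom(1) powA]) (simp_all add: homA_power[OF hom(1)] A_lvar)
    also have "\<dots> = (\<Prod>i\<in>{2..m}. mon (\<Sum>_<k i. unit_exp (\<sigma> i)) (c i ^ k i))"
      by (intro prod.cong) (simp_all add: \<sigma>(3) mono_power del: sum_constant)
    also have "\<dots> = mon (\<Sum>i\<in>{2..m}. \<Sum>_<k i. unit_exp (\<sigma> i)) (\<Prod>i\<in>{2..m}. c i ^ k i)"
      by (rule mono_prod) simp
    finally have "mon kvec b = mon (\<Sum>i\<in>{2..m}. \<Sum>_<k i. unit_exp (\<sigma> i)) (\<Prod>i\<in>{2..m}. c i ^ k i)" .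
    then have "kvec = (\<Sum>i\<in>{2..m}. \<Sum>_<k i. unit_exp (\<sigma> i))"
      by (rule mon_eq_mon) (use b(1) \<sigma>(2) in simp_all)
    then have "coef kvec (\<sigma> j) = coef (\<Sum>i\<in>{2..m}. \<Sum>_<k i. unit_exp (\<sigma> i)) (\<sigma> j)" by (simp only:)
    also have "\<dots> = (\<Sum>i\<in>{2..m}. int (k i) * coef (unit_exp (\<sigma> i)) (\<sigma> j))"
      unfolding lookup_sum[of _ "{2..m}"] coef_sum_const ..
    also have "\<dots> = (\<Sum>i\<in>{2..m}. if i = j then int (k i) else 0)"
      using inj j by (intro sum.cong) (auto simp: coef_unit_exp inj_on_def)
    also have "\<dots> = int (k j)" using j by simp
    finally show ?thesis using \<sigma>(1)[OF j] by (simp add: coef_kvec)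
  qed
  obtain a f where af: "a \<noteq> 0" "f \<in> B" "\<alpha> (lvar 0) = lvar 0 * mon 0 a + mon kvec 1 * f"
    "\<And>z. poly P (a * z) = a ^ d * poly P z" using aut_z_shift[OF assms] by blast
  show ?thesis using af inj \<sigma> k\<sigma> by blast
qed

end

section \<open>Automorphisms of the variety\<close>

context suspension
begin

definition formal :: "((nat \<Rightarrow> 'a) \<Rightarrow> 'a) \<Rightarrow> 'a laurent" where
  "formal f = (THE F. rep f F)"

definition fun_of :: "'a laurent \<Rightarrow> ((nat \<Rightarrow> 'a) \<Rightarrow> 'a)" where
  "fun_of F = (THE f. rep f F)"

lemma formal_eq: "rep f F \<Longrightarrow> formal f = F"
  unfolding formal_def using rep_unique by blast

lemma fun_of_eq: "rep f F \<Longrightarrow> fun_of F = f"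
  unfolding fun_of_def using rep_unique_fun by blast

lemma rep_formal: "f \<in> regular_funs m Y \<Longrightarrow> rep f (formal f)"
  using rep_regular_iff formal_eq by auto

lemma rep_fun_of: "F \<in> A \<Longrightarrow> rep (fun_of F) F"
  unfolding A_def using fun_of_eq by auto

lemma rep_A: "rep f F \<Longrightarrow> F \<in> A"
  unfolding A_def by blast

lemma rep_regular: "rep f F \<Longrightarrow> f \<in> regular_funs m Y"
  using rep_regular_iff by blast

text \<open>The Laurent polynomial of a regular function is determined by its values at the points with
  \<open>y\<^sub>2, \<dots>, y\<^sub>m \<noteq> 0\<close>, so these points are dense in \<open>Y\<close>.\<close>

lemma regular_dense:
  assumes "f \<in> regular_funs m Y" "g \<in> regular_funs m Y"
    and "\<And>p. p \<in> Y \<Longrightarrow> (\<And>j. j \<in> {2..m} \<Longrightarrow> p j \<noteq> 0) \<Longrightarrow> f p = g p"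
  shows "f = g"
proof -
  note r = rep_formal[OF assms(1)] rep_formal[OF assms(2)]
  have eq: "formal f = formal g"
  proof (rule laurent_eqI[OF rep_supported[OF r(1)] rep_supported[OF r(2)]])
    fix p assume p: "p \<in> Y" "\<And>j. j \<in> {2..m} \<Longrightarrow> p j \<noteq> 0"
    show "laurent_at p (formal f) = laurent_at p (formal g)"
      using laurent_at_rep[OF r(1) p] laurent_at_rep[OF r(2) p] assms(3)[OF p] by simp
  qed
  show ?thesis by (rule rep_unique_fun[OF r(1)]) (simp add: eq r(2))
qed

lemma regular_map_in_Y: "regular_map m Y \<phi> \<Longrightarrow> p \<in> Y \<Longrightarrow> \<phi> p \<in> Y"
  unfolding regular_map_def by blast

lemma regular_map_extensional: "regular_map m Y \<phi> \<Longrightarrow> \<phi> \<in> extensional Y"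
  unfolding regular_map_def by (simp add: PiE_def)

lemma regular_map_coord: "regular_map m Y \<phi> \<Longrightarrow> i \<le> m \<Longrightarrow> (\<lambda>p\<in>Y. \<phi> p i) \<in> regular_funs m Y"
  unfolding regular_map_def by simp

lemma regular_comp:
  assumes "f \<in> regular_funs m Y" "regular_map m Y \<phi>"
  shows "(\<lambda>p\<in>Y. f (\<phi> p)) \<in> regular_funs m Y"
proof -
  obtain F where "rep f F" using assms(1) rep_regular_iff by blast
  then show ?thesis
  proof (induction rule: rep.induct)
    case (rep_const c)
    have "(\<lambda>p\<in>Y. (\<lambda>p\<in>Y. c) (\<phi> p)) = (\<lambda>p\<in>Y. c)"
      by (rule restrict_ext) (simp add: regular_map_in_Y[OF assms(2)])
    then show ?case using regular_funs_const[of c Y m] by argo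
  next
    case (rep_coord i)
    have "(\<lambda>p\<in>Y. coord_fun Y i (\<phi> p)) = (\<lambda>p\<in>Y. \<phi> p i)"
      by (rule restrict_ext) (simp add: regular_map_in_Y[OF assms(2)] coord_fun_def)
    moreover have "i \<le> m" using rep_coord m_ge_2 by (auto simp: idx_def)
    ultimately show ?case using regular_map_coord[OF assms(2), of i] by argo
  next
    case rep_y1
    have "(\<lambda>p\<in>Y. coord_fun Y 1 (\<phi> p)) = (\<lambda>p\<in>Y. \<phi> p 1)"
      by (rule restrict_ext) (simp add: regular_map_in_Y[OF assms(2)] coord_fun_def)
    moreover have "1 \<le> m" using m_ge_2 by simp
    ultimately show ?case using regular_map_coord[OF assms(2), of 1] by argo
  next
    case (rep_add f F g G)
    have "(\<lambda>p\<in>Y. (\<lambda>p\<in>Y. f p + g p) (\<phi> p)) = (\<lambda>p\<in>Y. (\<lambda>p\<in>Y. f (\<phi> p)) p + (\<lambda>p\<in>Y. g (\<phi> p)) p)"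
      by (rule restrict_ext) (simp add: regular_map_in_Y[OF assms(2)])
    then show ?case using regular_funs_add[OF rep_add(3,4)] by argo
  next
    case (rep_mult f F g G)
    have "(\<lambda>p\<in>Y. (\<lambda>p\<in>Y. f p * g p) (\<phi> p)) = (\<lambda>p\<in>Y. (\<lambda>p\<in>Y. f (\<phi> p)) p * (\<lambda>p\<in>Y. g (\<phi> p)) p)"
      by (rule restrict_ext) (simp add: regular_map_in_Y[OF assms(2)])
    then show ?case using regular_funs_mult[OF rep_mult(3,4)] by argo
  qed
qed

lemma regular_map_comp:
  assumes "regular_map m Y \<phi>" "regular_map m Y \<psi>"
  shows "regular_map m Y (compose Y \<phi> \<psi>)"
  unfolding regular_map_def
proof (intro conjI ballI)
  show "compose Y \<phi> \<psi> \<in> Y \<rightarrow>\<^sub>E Y"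
    using regular_map_in_Y[OF assms(1)] regular_map_in_Y[OF assms(2)] by (auto simp: compose_def PiE_def)
  fix i assume i: "i \<in> {0..m}"
  have "(\<lambda>p\<in>Y. compose Y \<phi> \<psi> p i) = (\<lambda>p\<in>Y. (\<lambda>p\<in>Y. \<phi> p i) (\<psi> p))"
    by (rule restrict_ext) (simp add: compose_def regular_map_in_Y[OF assms(2)])
  then show "(\<lambda>p\<in>Y. compose Y \<phi> \<psi> p i) \<in> regular_funs m Y"
    using regular_comp[OF regular_map_coord[OF assms(1)] assms(2), of i] i by simp
qed

lemma point_eqI:
  assumes "p \<in> Y" "q \<in> Y" "\<And>i. i \<le> m \<Longrightarrow> p i = q i"
  shows "p = q"
proof
  fix i
  show "p i = q i" using assms by (cases "i \<le> m") (auto simp: Y_iff extensional_def)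
qed

text \<open>The equation of \<open>Y\<close> determines \<open>y\<^sub>1\<close> from the other coordinates where \<open>M \<noteq> 0\<close>. The last assumption
  makes this happen on a dense set.\<close>

lemma regular_map_eqI:
  assumes "regular_map m Y \<phi>" "regular_map m Y \<psi>"
    and "\<And>p i. p \<in> Y \<Longrightarrow> i \<in> idx \<Longrightarrow> \<phi> p i = \<psi> p i"
    and "\<And>p j. p \<in> Y \<Longrightarrow> (\<And>j. j \<in> {2..m} \<Longrightarrow> p j \<noteq> 0) \<Longrightarrow> j \<in> {2..m} \<Longrightarrow> \<phi> p j \<noteq> 0"
  shows "\<phi> = \<psi>"
proof -
  have "1 \<le> m" using m_ge_2 by simp
  note reg = regular_map_coord[OF assms(1) this] regular_map_coord[OF assms(2) this]
  have y1: "(\<lambda>p\<in>Y. \<phi> p 1) = (\<lambda>p\<in>Y. \<psi> p 1)"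
  proof (rule regular_dense[OF reg])
    fix p assume p: "p \<in> Y" "\<And>j. j \<in> {2..m} \<Longrightarrow> p j \<noteq> 0"
    have "M (\<phi> p) = M (\<psi> p)" unfolding M_def using assms(3)[OF p(1)] by (intro prod.cong) auto
    moreover have "M (\<phi> p) \<noteq> 0" unfolding M_def using assms(4)[OF p(1) p(2)] by simp
    moreover have "\<phi> p 1 * M (\<phi> p) = poly P (\<phi> p 0)" "\<psi> p 1 * M (\<psi> p) = poly P (\<psi> p 0)"
      using regular_map_in_Y[OF assms(1) p(1)] regular_map_in_Y[OF assms(2) p(1)] Y_iff by blast+
    moreover have "\<phi> p 0 = \<psi> p 0" using assms(3)[OF p(1)] by simp
    ultimately have "\<phi> p 1 = \<psi> p 1" by (metis mult_right_cancel)
    then show "(\<lambda>p\<in>Y. \<phi> p 1) p = (\<lambda>p\<in>Y. \<psi> p 1) p" using p(1) by simp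
  qed
  show ?thesis
  proof (rule extensionalityI[OF regular_map_extensional[OF assms(1)] regular_map_extensional[OF assms(2)]])
    fix p assume p: "p \<in> Y"
    show "\<phi> p = \<psi> p"
    proof (rule point_eqI[OF regular_map_in_Y[OF assms(1) p] regular_map_in_Y[OF assms(2) p]])
      fix i assume i: "i \<le> m"
      show "\<phi> p i = \<psi> p i"
      proof (cases "i = 1")
        case True
        then show ?thesis using fun_cong[OF y1, of p] p by simp
      next
        case False
        then have "i \<in> idx" using i by (cases "i = 0") (auto simp: idx_def)
        then show ?thesis using assms(3)[OF p] by blast
      qed
    qed
  qed
qed

abbreviation G where "G \<equiv> Aut_Y m k P"

lemma G_carrier_iff: "\<phi> \<in> carrier G \<longleftrightarrow>
    \<phi> \<in> Bij Y \<and> regular_map m Y \<phi> \<and> regular_map m Y (restrict (inv_into Y \<phi>) Y)"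
  by (simp add: variety_aut_def)

lemma G_carrierI:
  assumes "regular_map m Y \<phi>" "regular_map m Y \<psi>"
    "\<And>p. p \<in> Y \<Longrightarrow> \<psi> (\<phi> p) = p" "\<And>p. p \<in> Y \<Longrightarrow> \<phi> (\<psi> p) = p"
  shows "\<phi> \<in> carrier G"
proof -
  have bij: "bij_betw \<phi> Y Y"
    by (rule bij_betwI[where g = \<psi>]) (use assms regular_map_in_Y in auto)
  have "restrict (inv_into Y \<phi>) Y = \<psi>"
  proof (rule extensionalityI[OF restrict_extensional regular_map_extensional[OF assms(2)]])
    fix p assume p: "p \<in> Y"
    have "inv_into Y \<phi> (\<phi> (\<psi> p)) = \<psi> p"
      using bij by (intro inv_into_f_f regular_map_in_Y[OF assms(2)] p) (simp add: bij_betw_def)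
    then show "restrict (inv_into Y \<phi>) Y p = \<psi> p" using assms(4)[OF p] p by simp
  qed
  then show ?thesis unfolding G_carrier_iff Bij_def
    using bij assms regular_map_extensional by simp
qed

lemma G_regular: "\<phi> \<in> carrier G \<Longrightarrow> regular_map m Y \<phi>"
  unfolding G_carrier_iff by blast

lemma G_in_Y: "\<phi> \<in> carrier G \<Longrightarrow> p \<in> Y \<Longrightarrow> \<phi> p \<in> Y"
  using G_regular regular_map_in_Y by blast

lemma G_ext: "\<phi> \<in> carrier G \<Longrightarrow> \<psi> \<in> carrier G \<Longrightarrow> (\<And>p. p \<in> Y \<Longrightarrow> \<phi> p = \<psi> p) \<Longrightarrow> \<phi> = \<psi>"
  using extensionalityI[OF regular_map_extensional[OF G_regular] regular_map_extensional[OF G_regular]] by blast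

lemma G_one: "\<one>\<^bsub>G\<^esub> = (\<lambda>p\<in>Y. p)"
  by (simp add: variety_aut_def BijGroup_def)

lemma G_mult: "\<phi> \<in> carrier G \<Longrightarrow> \<psi> \<in> carrier G \<Longrightarrow> \<phi> \<otimes>\<^bsub>G\<^esub> \<psi> = compose Y \<phi> \<psi>"
  unfolding G_carrier_iff by (simp add: variety_aut_def BijGroup_def)

lemma G_mult_apply: "\<phi> \<in> carrier G \<Longrightarrow> \<psi> \<in> carrier G \<Longrightarrow> p \<in> Y \<Longrightarrow> (\<phi> \<otimes>\<^bsub>G\<^esub> \<psi>) p = \<phi> (\<psi> p)"
  using G_mult by (simp add: compose_def)

lemma regular_map_id: "regular_map m Y (\<lambda>p\<in>Y. p)"
  unfolding regular_map_def
proof (intro conjI ballI)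
  fix i assume "i \<in> {0..m}"
  moreover have "(\<lambda>p\<in>Y. (\<lambda>p\<in>Y. p) p i) = coord_fun Y i" unfolding coord_fun_def by (rule restrict_ext) simp
  ultimately show "(\<lambda>p\<in>Y. (\<lambda>p\<in>Y. p) p i) \<in> regular_funs m Y" using coord_fun_regular[of i m Y] by simp
qed simp

lemma inv_into_G:
  assumes "\<phi> \<in> carrier G" "p \<in> Y"
  shows "inv_into Y \<phi> (\<phi> p) = p" "\<phi> (inv_into Y \<phi> p) = p"
  using assms unfolding G_carrier_iff Bij_def bij_betw_def by (auto simp: f_inv_into_f)

lemma group_G: "group G"
proof (rule groupI)
  show "\<one>\<^bsub>G\<^esub> \<in> carrier G"
    unfolding G_one by (rule G_carrierI[OF regular_map_id regular_map_id]) simp_all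
next
  fix \<phi> \<psi> assume *: "\<phi> \<in> carrier G" "\<psi> \<in> carrier G"
  let ?i = "\<lambda>\<phi>. restrict (inv_into Y \<phi>) Y"
  have r: "regular_map m Y (?i \<phi>)" "regular_map m Y (?i \<psi>)" using * unfolding G_carrier_iff by blast+
  show "\<phi> \<otimes>\<^bsub>G\<^esub> \<psi> \<in> carrier G"
    unfolding G_mult[OF *]
  proof (rule G_carrierI[OF regular_map_comp[OF G_regular[OF *(1)] G_regular[OF *(2)]] regular_map_comp[OF r(2,1)]])
    fix p assume p: "p \<in> Y"
    have i: "inv_into Y \<phi> p \<in> Y" using regular_map_in_Y[OF r(1) p] p by simp
    have i2: "inv_into Y \<psi> (inv_into Y \<phi> p) \<in> Y" using regular_map_in_Y[OF r(2) i] i by simp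
    show "compose Y (?i \<psi>) (?i \<phi>) (compose Y \<phi> \<psi> p) = p"
      using p G_in_Y[OF *(2) p] G_in_Y[OF *(1) G_in_Y[OF *(2) p]] inv_into_G[OF *(1)] inv_into_G[OF *(2)]
      by (simp add: compose_def)
    show "compose Y \<phi> \<psi> (compose Y (?i \<psi>) (?i \<phi>) p) = p"
      using p i i2 inv_into_G[OF *(1)] inv_into_G[OF *(2)] by (simp add: compose_def)
  qed
next
  fix \<phi> \<psi> \<chi> assume *: "\<phi> \<in> carrier G" "\<psi> \<in> carrier G" "\<chi> \<in> carrier G"
  have sub: "group (BijGroup Y)" by (rule group_BijGroup)
  have c: "\<phi> \<in> carrier (BijGroup Y)" "\<psi> \<in> carrier (BijGroup Y)" "\<chi> \<in> carrier (BijGroup Y)"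
    using * unfolding G_carrier_iff BijGroup_def by simp_all
  show "\<phi> \<otimes>\<^bsub>G\<^esub> \<psi> \<otimes>\<^bsub>G\<^esub> \<chi> = \<phi> \<otimes>\<^bsub>G\<^esub> (\<psi> \<otimes>\<^bsub>G\<^esub> \<chi>)"
    using monoid.m_assoc[OF group.is_monoid[OF sub] c] by (simp add: variety_aut_def)
next
  fix \<phi> assume *: "\<phi> \<in> carrier G"
  then have c: "\<phi> \<in> carrier (BijGroup Y)" unfolding G_carrier_iff BijGroup_def by simp
  show "\<one>\<^bsub>G\<^esub> \<otimes>\<^bsub>G\<^esub> \<phi> = \<phi>"
    using monoid.l_one[OF group.is_monoid[OF group_BijGroup] c] by (simp add: variety_aut_def)
  let ?\<psi> = "restrict (inv_into Y \<phi>) Y"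
  have r: "regular_map m Y ?\<psi>" using * unfolding G_carrier_iff by blast
  have \<psi>: "?\<psi> \<in> carrier G"
  proof (rule G_carrierI[OF r G_regular[OF *]])
    fix p assume p: "p \<in> Y"
    show "\<phi> (?\<psi> p) = p" "?\<psi> (\<phi> p) = p" using inv_into_G[OF * p] p G_in_Y[OF * p] by simp_all
  qed
  have "?\<psi> \<otimes>\<^bsub>G\<^esub> \<phi> = \<one>\<^bsub>G\<^esub>"
    unfolding G_mult[OF \<psi> *] G_one compose_def
    by (intro restrict_ext) (simp add: inv_into_G[OF *] G_in_Y[OF *])
  then show "\<exists>\<psi>\<in>carrier G. \<psi> \<otimes>\<^bsub>G\<^esub> \<phi> = \<one>\<^bsub>G\<^esub>" using \<psi> by (rule bexI)
qed

lemma G_inv_apply: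
  assumes "\<phi> \<in> carrier G" "p \<in> Y"
  shows "\<phi> ((inv\<^bsub>G\<^esub> \<phi>) p) = p" "(inv\<^bsub>G\<^esub> \<phi>) (\<phi> p) = p"
proof -
  interpret group G by (rule group_G)
  have "inv\<^bsub>G\<^esub> \<phi> \<in> carrier G" using assms by simp
  then show "\<phi> ((inv\<^bsub>G\<^esub> \<phi>) p) = p" "(inv\<^bsub>G\<^esub> \<phi>) (\<phi> p) = p"
    using G_mult_apply[OF assms(1) _ assms(2), of "inv\<^bsub>G\<^esub> \<phi>"] G_mult_apply[OF _ assms, of "inv\<^bsub>G\<^esub> \<phi>"] assms
    by (simp_all add: G_one r_inv l_inv)
qed

subsection \<open>The coordinate form of an automorphism\<close>

text \<open>The automorphism of the ring of Laurent representatives that corresponds to \<open>f \<mapsto> f \<circ> \<phi>\<close>.\<close>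

definition pull :: "((nat \<Rightarrow> 'a) \<Rightarrow> (nat \<Rightarrow> 'a)) \<Rightarrow> 'a laurent \<Rightarrow> 'a laurent" where
  "pull \<phi> F = formal (\<lambda>p\<in>Y. fun_of F (\<phi> p))"

lemma rep_pull:
  assumes "regular_map m Y \<phi>" "rep f F"
  shows "rep (\<lambda>p\<in>Y. f (\<phi> p)) (pull \<phi> F)"
  unfolding pull_def fun_of_eq[OF assms(2)]
  by (rule rep_formal[OF regular_comp[OF rep_regular[OF assms(2)] assms(1)]])

lemma pull_eq:
  assumes "regular_map m Y \<phi>" "rep f F" "rep g H" "\<And>p. p \<in> Y \<Longrightarrow> g p = f (\<phi> p)"
  shows "pull \<phi> F = H"
proof -
  have "rep (\<lambda>p\<in>Y. f (\<phi> p)) H" using assms(3,4) by (rule rep_cong)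
  then show ?thesis by (rule rep_unique[OF rep_pull[OF assms(1,2)]])
qed

lemma homA_pull:
  assumes "regular_map m Y \<phi>"
  shows "homA (pull \<phi>)"
  unfolding homA_def
proof (intro conjI ballI allI)
  note inY = regular_map_in_Y[OF assms]
  show "pull \<phi> F \<in> A" if "F \<in> A" for F
    using rep_pull[OF assms rep_fun_of[OF that]] by (rule rep_A)
  show "pull \<phi> (mon 0 c) = mon 0 c" for c
    by (rule pull_eq[OF assms rep_const rep_const]) (simp add: inY)
  show "pull \<phi> (F + H) = pull \<phi> F + pull \<phi> H" if "F \<in> A" "H \<in> A" for F H
    by (rule pull_eq[OF assms rep_add[OF rep_fun_of[OF that(1)] rep_fun_of[OF that(2)]]
          rep_add[OF rep_pull[OF assms rep_fun_of[OF that(1)]] rep_pull[OF assms rep_fun_of[OF that(2)]]]])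
       (simp add: inY)
  show "pull \<phi> (F * H) = pull \<phi> F * pull \<phi> H" if "F \<in> A" "H \<in> A" for F H
    by (rule pull_eq[OF assms rep_mult[OF rep_fun_of[OF that(1)] rep_fun_of[OF that(2)]]
          rep_mult[OF rep_pull[OF assms rep_fun_of[OF that(1)]] rep_pull[OF assms rep_fun_of[OF that(2)]]]])
       (simp add: inY)
qed

lemma autA_pull:
  assumes "regular_map m Y \<phi>" "regular_map m Y \<psi>"
    "\<And>p. p \<in> Y \<Longrightarrow> \<psi> (\<phi> p) = p" "\<And>p. p \<in> Y \<Longrightarrow> \<phi> (\<psi> p) = p"
  shows "autA (pull \<phi>) (pull \<psi>)"
  unfolding autA_def
proof (intro conjI ballI)
  fix F assume F: "F \<in> A"
  show "pull \<phi> (pull \<psi> F) = F"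
    by (rule pull_eq[OF assms(1) rep_pull[OF assms(2) rep_fun_of[OF F]] rep_fun_of[OF F]])
       (simp add: assms(3) regular_map_in_Y[OF assms(1)])
  show "pull \<psi> (pull \<phi> F) = F"
    by (rule pull_eq[OF assms(2) rep_pull[OF assms(1) rep_fun_of[OF F]] rep_fun_of[OF F]])
       (simp add: assms(4) regular_map_in_Y[OF assms(2)])
qed (rule homA_pull[OF assms(1)], rule homA_pull[OF assms(2)])

lemma rep_B_at:
  assumes "rep f F" "F \<in> B" "p \<in> Y"
  shows "f p = laurent_at p F"
  by (rule rep_low(2)[OF assms(1) _ assms(3)]) (use assms(2) d_ge_2 in \<open>auto simp: B_def\<close>)

lemma rep_B_cong:
  assumes "rep f F" "F \<in> B" "p \<in> Y" "q \<in> Y" "\<And>j. j \<in> {2..m} \<Longrightarrow> p j = q j"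
  shows "f p = f q"
  unfolding rep_B_at[OF assms(1-3)] rep_B_at[OF assms(1,2,4)]
proof (rule laurent_at_cong)
  fix s i assume "s \<in> expts F" "i \<in> expts s"
  then have "expts s \<subseteq> idx" "coef s 0 = 0" "i \<in> expts s"
    using assms(2) unfolding B_def nonneg_def by blast+
  then have "i \<in> idx" "i \<noteq> 0" by (blast, metis in_keys_iff)
  then have "i \<in> {2..m}" unfolding idx_def by blast
  then show "p i = q i" by (rule assms(5))
qed

text \<open>The theorem on automorphisms of the coordinate ring, read off at the points of \<open>Y\<close>. The shift \<open>f\<close> of \<open>z\<close> is
  represented by an element of \<open>B\<close>, hence depends on \<open>y\<^sub>2, \<dots>, y\<^sub>m\<close> only.\<close>

lemma aut_coordinates:
  assumes "\<phi> \<in> carrier G"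
  obtains a F f \<sigma> c where "a \<noteq> 0" "F \<in> B" "rep f F"
    "\<forall>p\<in>Y. \<phi> p 0 = a * p 0 + M p * f p"
    "\<forall>z. poly P (a * z) = a ^ d * poly P z" "inj_on \<sigma> {2..m}"
    "\<forall>j\<in>{2..m}. \<sigma> j \<in> {2..m} \<and> k (\<sigma> j) = k j \<and> c j \<noteq> 0"
    "\<forall>p\<in>Y. \<forall>j\<in>{2..m}. \<phi> p j = c j * p (\<sigma> j)"
proof -
  let ?\<psi> = "restrict (inv_into Y \<phi>) Y"
  note r = G_regular[OF assms]
  have r': "regular_map m Y ?\<psi>" using assms unfolding G_carrier_iff by blast
  have "autA (pull \<phi>) (pull ?\<psi>)"
    by (rule autA_pull[OF r r']) (simp_all add: inv_into_G[OF assms] G_in_Y[OF assms])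
  from aut_structure[OF this] obtain a F \<sigma> c where *: "a \<noteq> 0" "F \<in> B"
    "pull \<phi> (lvar 0) = lvar 0 * mon 0 a + mon kvec 1 * F"
    "\<forall>z. poly P (a * z) = a ^ d * poly P z" "inj_on \<sigma> {2..m}"
    "\<forall>j\<in>{2..m}. \<sigma> j \<in> {2..m} \<and> k (\<sigma> j) = k j \<and> c j \<noteq> 0 \<and> pull \<phi> (lvar j) = mon (unit_exp (\<sigma> j)) (c j)"
    by blast
  define f where "f = fun_of F"
  have f: "rep f F" unfolding f_def by (rule rep_fun_of[OF B_A[OF *(2)]])
  show ?thesis
  proof (rule that[OF *(1) *(2) f _ *(4) *(5)])
    show "\<forall>j\<in>{2..m}. \<sigma> j \<in> {2..m} \<and> k (\<sigma> j) = k j \<and> c j \<noteq> 0" using *(6) by blast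
    have "\<phi> p 0 = a * p 0 + M p * f p \<and> (\<forall>j\<in>{2..m}. \<phi> p j = c j * p (\<sigma> j))" if p: "p \<in> Y" for p
    proof (intro conjI ballI)
    have kv: "rep (fun_of (mon kvec 1)) (mon kvec 1)" by (rule rep_fun_of[OF kvec_A])
    have Mp: "fun_of (mon kvec 1) p = M p" using rep_B_at[OF kv B_kvec p] by (simp add: mono_at_kvec)
    have "rep (\<lambda>p\<in>Y. coord_fun Y 0 (\<phi> p)) (lvar 0 * mon 0 a + mon kvec 1 * F)"
      using rep_pull[OF r rep_coord[of 0]] *(3) by simp
    from rep_unique_fun[OF this rep_add[OF rep_mult[OF rep_coord rep_const] rep_mult[OF kv f]]]
    have "(\<lambda>p\<in>Y. coord_fun Y 0 (\<phi> p)) = (\<lambda>p\<in>Y. (\<lambda>p\<in>Y. coord_fun Y 0 p * (\<lambda>p\<in>Y. a) p) p + (\<lambda>p\<in>Y. fun_of (mon kvec 1) p * f p) p)"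
      by simp
    from fun_cong[OF this, of p] show "\<phi> p 0 = a * p 0 + M p * f p"
      using p G_in_Y[OF assms p] by (simp add: coord_fun_def Mp mult.commute)
    fix j assume j: "j \<in> {2..m}"
    have "rep (\<lambda>p\<in>Y. coord_fun Y j (\<phi> p)) (mon (unit_exp (\<sigma> j)) (c j))"
      using rep_pull[OF r rep_coord[of j]] *(6) j by simp
    moreover have "mon (unit_exp (\<sigma> j)) (c j) \<in> B"
    proof (rule B_mon[OF unit_exp_nonneg])
      have "\<sigma> j \<in> {2..m}" using *(6) j by blast
      then show "\<sigma> j \<in> idx" "coef (unit_exp (\<sigma> j)) 0 = 0" by (auto simp: coef_unit_exp)
    qed
    ultimately have "(\<lambda>p\<in>Y. coord_fun Y j (\<phi> p)) p = laurent_at p (mon (unit_exp (\<sigma> j)) (c j))"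
      using p by (rule rep_B_at)
    then show "\<phi> p j = c j * p (\<sigma> j)"
      using p G_in_Y[OF assms p] by (simp add: coord_fun_def)
    qed
    then show "\<forall>p\<in>Y. \<phi> p 0 = a * p 0 + M p * f p" "\<forall>p\<in>Y. \<forall>j\<in>{2..m}. \<phi> p j = c j * p (\<sigma> j)"
      by blast+
  qed
qed

subsection \<open>The canonical derivation of regular functions\<close>

lemma coord_ring_simps:
  "carrier (coord_ring m Y) = regular_funs m Y"
  "f \<otimes>\<^bsub>coord_ring m Y\<^esub> g = (\<lambda>p\<in>Y. f p * g p)"
  "f \<oplus>\<^bsub>coord_ring m Y\<^esub> g = (\<lambda>p\<in>Y. f p + g p)"
  "\<zero>\<^bsub>coord_ring m Y\<^esub> = (\<lambda>p\<in>Y. 0)" "\<one>\<^bsub>coord_ring m Y\<^esub> = (\<lambda>p\<in>Y. 1)"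
  by (simp_all add: coord_ring_def)

text \<open>The derivation of the ring of regular functions that corresponds to \<open>dz\<close>; it turns out to be the one
  described by its values on the coordinates.\<close>

definition dY :: "((nat \<Rightarrow> 'a) \<Rightarrow> 'a) \<Rightarrow> ((nat \<Rightarrow> 'a) \<Rightarrow> 'a)" where
  "dY = (\<lambda>f\<in>regular_funs m Y. fun_of (dz (formal f)))"

lemma rep_dY: "rep f F \<Longrightarrow> rep (dY f) (dz F)"
  using rep_fun_of[OF dz_A[OF rep_A]] rep_regular formal_eq by (simp add: dY_def)

lemma dY_eq: "rep f F \<Longrightarrow> rep g (dz F) \<Longrightarrow> dY f = g"
  using rep_dY rep_unique_fun by blast

lemma rep_zpoly: "rep (\<lambda>p\<in>Y. poly Q (p 0)) (poly (lift_poly Q) (lvar 0))"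
proof (induction Q)
  case 0
  show ?case using rep_const[of 0] by (simp only: poly_0 single_zero map_poly_0)
next
  case (pCons a Q)
  have "rep (\<lambda>p\<in>Y. poly (pCons a Q) (p 0)) (mon 0 a + lvar 0 * poly (lift_poly Q) (lvar 0))"
    by (rule rep_cong[OF rep_add[OF rep_const rep_mult[OF rep_coord pCons(2)]]]) (simp_all add: coord_fun_def)
  then show ?case unfolding lift_poly_pCons poly_pCons .
qed

lemma rep_M: "rep (\<lambda>p\<in>Y. M p) (mon kvec 1)"
proof (rule rep_cong[OF rep_fun_of[OF kvec_A]])
  show "fun_of (mon kvec 1) p = M p" if "p \<in> Y" for p
    using rep_B_at[OF rep_fun_of[OF kvec_A] B_kvec that] by (simp add: mono_at_kvec)
qed

lemma rep_zero: "rep (\<lambda>p\<in>Y. 0) 0"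
  using rep_const[of 0] by (simp only: single_zero)

lemma rep_scale:
  assumes "rep f F"
  shows "rep (\<lambda>p\<in>Y. c * f p) (mon 0 c * F)"
  by (rule rep_cong[OF rep_mult[OF rep_const assms]]) simp

definition canonical_conditions where
  "canonical_conditions \<delta> \<longleftrightarrow> derivation m Y \<delta> \<and>
        \<delta> (coord_fun Y 1) = (\<lambda>p\<in>Y. poly (pderiv P) (p 0)) \<and>
        \<delta> (coord_fun Y 0) = (\<lambda>p\<in>Y. \<Prod>i\<in>{2..m}. p i ^ k i) \<and>
        (\<forall>j\<in>{2..m}. \<delta> (coord_fun Y j) = \<zero>\<^bsub>coord_ring m Y\<^esub>)"

lemma derivation_iff:
  "derivation m Y \<delta> \<longleftrightarrow> \<delta> \<in> regular_funs m Y \<rightarrow>\<^sub>E regular_funs m Y \<and>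
     (\<forall>f\<in>regular_funs m Y. \<forall>g\<in>regular_funs m Y. \<delta> (\<lambda>p\<in>Y. f p + g p) = (\<lambda>p\<in>Y. \<delta> f p + \<delta> g p)) \<and>
     (\<forall>c. \<forall>f\<in>regular_funs m Y. \<delta> (\<lambda>p\<in>Y. c * f p) = (\<lambda>p\<in>Y. c * \<delta> f p)) \<and>
     (\<forall>f\<in>regular_funs m Y. \<forall>g\<in>regular_funs m Y.
        \<delta> (\<lambda>p\<in>Y. f p * g p) = (\<lambda>p\<in>Y. (\<lambda>p\<in>Y. f p * \<delta> g p) p + (\<lambda>p\<in>Y. g p * \<delta> f p) p))"
  unfolding derivation_def Let_def coord_ring_simps ..

lemma canonical_dY: "canonical_conditions dY"
  unfolding canonical_conditions_def derivation_iff
proof (intro conjI ballI allI)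
  show "dY \<in> regular_funs m Y \<rightarrow>\<^sub>E regular_funs m Y"
  proof (rule PiE_I)
    show "dY f \<in> regular_funs m Y" if "f \<in> regular_funs m Y" for f
      by (rule rep_regular[OF rep_dY[OF rep_formal[OF that]]])
    show "dY f = undefined" if "f \<notin> regular_funs m Y" for f
      using that by (simp add: dY_def)
  qed
  fix f assume f: "f \<in> regular_funs m Y"
  note rf = rep_formal[OF f]
  show "dY (\<lambda>p\<in>Y. c * f p) = (\<lambda>p\<in>Y. c * dY f p)" for c
  proof (rule dY_eq[OF rep_scale[OF rf]])
    have "dz (mon 0 c * formal f) = mon 0 c * dz (formal f)" by (simp add: dz_mult dz_const)
    then show "rep (\<lambda>p\<in>Y. c * dY f p) (dz (mon 0 c * formal f))" using rep_scale[OF rep_dY[OF rf], of c] by argo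
  qed
  fix g assume g: "g \<in> regular_funs m Y"
  note rg = rep_formal[OF g]
  show "dY (\<lambda>p\<in>Y. f p + g p) = (\<lambda>p\<in>Y. dY f p + dY g p)"
    by (rule dY_eq[OF rep_add[OF rf rg]], unfold dz_add, rule rep_add[OF rep_dY[OF rf] rep_dY[OF rg]])
  show "dY (\<lambda>p\<in>Y. f p * g p) = (\<lambda>p\<in>Y. (\<lambda>p\<in>Y. f p * dY g p) p + (\<lambda>p\<in>Y. g p * dY f p) p)"
    by (rule dY_eq[OF rep_mult[OF rf rg]], unfold dz_mult,
        rule rep_add[OF rep_mult[OF rf rep_dY[OF rg]] rep_mult[OF rg rep_dY[OF rf]]])
next
  show "dY (coord_fun Y 1) = (\<lambda>p\<in>Y. poly (pderiv P) (p 0))"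
    by (rule dY_eq[OF rep_y1], unfold dz_y1, rule rep_zpoly)
  show "dY (coord_fun Y 0) = (\<lambda>p\<in>Y. \<Prod>i\<in>{2..m}. p i ^ k i)"
    by (rule dY_eq[OF rep_coord], simp, unfold dz_lvar_0, rule rep_M[unfolded M_def])
  fix j assume j: "j \<in> {2..m}"
  have "dz (lvar j) = 0" using j by (intro dz_lvar) auto
  then show "dY (coord_fun Y j) = \<zero>\<^bsub>coord_ring m Y\<^esub>" unfolding coord_ring_simps
    using dY_eq[OF rep_coord[of j]] rep_zero j by simp
qed

lemma canonical_unique:
  assumes "canonical_conditions \<delta>"
  shows "\<delta> = dY"
proof -
  have der: "derivation m Y \<delta>" "derivation m Y dY"
    using assms canonical_dY unfolding canonical_conditions_def by blast+
  have E: "\<delta> \<in> regular_funs m Y \<rightarrow>\<^sub>E regular_funs m Y" "dY \<in> regular_funs m Y \<rightarrow>\<^sub>E regular_funs m Y"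
    using der unfolding derivation_iff by blast+
  have const: "D (\<lambda>p\<in>Y. c) = (\<lambda>p\<in>Y. 0)" if D: "derivation m Y D" for D c
  proof -
    have one: "(\<lambda>p\<in>Y. 1) \<in> regular_funs m Y" by (rule regular_funs_const)
    have "D (\<lambda>p\<in>Y. (\<lambda>p\<in>Y. 1) p * (\<lambda>p\<in>Y. 1) p) = (\<lambda>p\<in>Y. (\<lambda>p\<in>Y. (\<lambda>p\<in>Y. 1) p * D (\<lambda>p\<in>Y. 1) p) p + (\<lambda>p\<in>Y. (\<lambda>p\<in>Y. 1) p * D (\<lambda>p\<in>Y. 1) p) p)"
      using D one unfolding derivation_iff by blast
    moreover have "(\<lambda>p\<in>Y. (\<lambda>p\<in>Y. 1) p * (\<lambda>p\<in>Y. 1) p) = (\<lambda>p\<in>Y. 1 :: 'a)" by (rule restrict_ext) simp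
    ultimately have "D (\<lambda>p\<in>Y. 1) = (\<lambda>p\<in>Y. (\<lambda>p\<in>Y. (\<lambda>p\<in>Y. 1) p * D (\<lambda>p\<in>Y. 1) p) p + (\<lambda>p\<in>Y. (\<lambda>p\<in>Y. 1) p * D (\<lambda>p\<in>Y. 1) p) p)"
      by argo
    note D1 = fun_cong[OF this]
    have 1: "D (\<lambda>p\<in>Y. 1) p = 0" if "p \<in> Y" for p
    proof -
      note D1[of p]
      also have "(\<lambda>p\<in>Y. (\<lambda>p\<in>Y. (\<lambda>p\<in>Y. 1) p * D (\<lambda>p\<in>Y. 1) p) p + (\<lambda>p\<in>Y. (\<lambda>p\<in>Y. 1) p * D (\<lambda>p\<in>Y. 1) p) p) p
        = D (\<lambda>p\<in>Y. 1) p + D (\<lambda>p\<in>Y. 1) p" using that by simp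
      finally show ?thesis by simp
    qed
    have "D (\<lambda>p\<in>Y. c * (\<lambda>p\<in>Y. 1) p) = (\<lambda>p\<in>Y. c * D (\<lambda>p\<in>Y. 1) p)"
      using D one unfolding derivation_iff by blast
    moreover have "(\<lambda>p\<in>Y. c * (\<lambda>p\<in>Y. 1) p) = (\<lambda>p\<in>Y. c)" by (rule restrict_ext) simp
    moreover have "(\<lambda>p\<in>Y. c * D (\<lambda>p\<in>Y. 1) p) = (\<lambda>p\<in>Y. 0)" by (rule restrict_ext) (simp add: 1)
    ultimately show ?thesis by argo
  qed
  have "\<delta> f = dY f" if "rep f F" for f F
    using that
  proof (induction rule: rep.induct)
    case (rep_const c)
    show ?case using const[OF der(1), of c] const[OF der(2), of c] by argo
  next
    case (rep_coord i)
    then show ?case using assms canonical_dY unfolding canonical_conditions_def idx_def by auto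
  next
    case rep_y1
    show ?case using assms canonical_dY unfolding canonical_conditions_def by argo
  next
    case (rep_add f F g H)
    note r = rep_regular[OF rep_add(1)] rep_regular[OF rep_add(2)]
    have "D (\<lambda>p\<in>Y. f p + g p) = (\<lambda>p\<in>Y. D f p + D g p)" if "derivation m Y D" for D
      using that r unfolding derivation_iff by blast
    from this[OF der(1)] this[OF der(2)] show ?case unfolding rep_add(3,4) by argo
  next
    case (rep_mult f F g H)
    note r = rep_regular[OF rep_mult(1)] rep_regular[OF rep_mult(2)]
    have "D (\<lambda>p\<in>Y. f p * g p) = (\<lambda>p\<in>Y. (\<lambda>p\<in>Y. f p * D g p) p + (\<lambda>p\<in>Y. g p * D f p) p)" if "derivation m Y D" for D
      using that r unfolding derivation_iff by blast
    from this[OF der(1)] this[OF der(2)] show ?case unfolding rep_mult(3,4) by argo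
  qed
  then have "\<delta> f = dY f" if "f \<in> regular_funs m Y" for f using rep_formal[OF that] by blast
  then show ?thesis using E by (intro ext) (metis PiE_arb)
qed

lemma canonical_deriv_eq: "canonical_deriv m k P = dY"
  unfolding canonical_deriv_def Let_def canonical_conditions_def[symmetric]
  using canonical_dY canonical_unique by (rule the_equality)

end

subsection \<open>Exponentials\<close>

lemma higher_pderiv_pCons:
  fixes Q :: "'a::field_char_0 poly"
  shows "poly ((pderiv ^^ Suc n) (pCons a Q)) x =
    x * poly ((pderiv ^^ Suc n) Q) x + of_nat (Suc n) * poly ((pderiv ^^ n) Q) x"
proof -
  have "(pderiv ^^ Suc n) (pCons a Q) = pCons 0 ((pderiv ^^ Suc n) Q) + smult (of_nat (Suc n)) ((pderiv ^^ n) Q)"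
  proof (induction n)
    case (Suc n)
    have "(pderiv ^^ Suc (Suc n)) (pCons a Q) = pderiv ((pderiv ^^ Suc n) (pCons a Q))" by simp
    also have "\<dots> = pCons 0 ((pderiv ^^ Suc (Suc n)) Q) + smult (of_nat (Suc (Suc n))) ((pderiv ^^ Suc n) Q)"
      unfolding Suc pderiv_add pderiv_pCons pderiv_smult
      by (simp add: of_nat_Suc[of "Suc n"] smult_add_left add_ac del: of_nat_Suc)
    finally show ?case .
  qed (simp add: pderiv_pCons)
  then show ?thesis by simp
qed

lemma poly_taylor:
  fixes Q :: "'a::field_char_0 poly"
  assumes "degree Q \<le> N"
  shows "poly Q (x + h) = (\<Sum>n\<le>N. h ^ n * poly ((pderiv ^^ n) Q) x / fact n)"
  using assms
proof (induction Q arbitrary: N)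
  case 0
  show ?case by (simp only: higher_pderiv_0 poly_0) simp
next
  case (pCons a Q)
  show ?case
  proof (cases N)
    case 0
    then have "Q = 0" using pCons.prems by (auto split: if_splits)
    then show ?thesis using 0 by simp
  next
    case (Suc N')
    have deg: "degree Q \<le> N'" "degree Q \<le> N" using pCons.prems Suc by (auto split: if_splits)
    define D where "D n = poly ((pderiv ^^ n) Q) x" for n
    have T: "(\<Sum>n\<le>N'. h ^ n * D n / fact n) = poly Q (x + h)" "(\<Sum>n\<le>N. h ^ n * D n / fact n) = poly Q (x + h)"
      using pCons.IH[OF deg(1)] pCons.IH[OF deg(2)] unfolding D_def by simp_all
    have f: "of_nat (Suc n) / fact (Suc n) = (1 / fact n :: 'a)" for n
      by (simp only: fact_Suc of_nat_mult) (simp del: of_nat_Suc)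
    have "(\<Sum>n\<le>N. h ^ n * poly ((pderiv ^^ n) (pCons a Q)) x / fact n)
      = a + x * D 0 + (\<Sum>n\<le>N'. h ^ Suc n * (x * D (Suc n) + of_nat (Suc n) * D n) / fact (Suc n))"
      unfolding Suc sum.atMost_Suc_shift higher_pderiv_pCons D_def by simp
    also have "(\<Sum>n\<le>N'. h ^ Suc n * (x * D (Suc n) + of_nat (Suc n) * D n) / fact (Suc n))
      = (\<Sum>n\<le>N'. x * (h ^ Suc n * D (Suc n) / fact (Suc n)) + h * (h ^ n * D n / fact n))"
    proof (rule sum.cong[OF refl])
      fix n
      have "h ^ Suc n * (x * D (Suc n) + of_nat (Suc n) * D n) / fact (Suc n)
        = x * (h ^ Suc n * D (Suc n) / fact (Suc n)) + h ^ Suc n * D n * (of_nat (Suc n) / fact (Suc n))"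
        by (simp add: add_divide_distrib distrib_left mult_ac del: fact_Suc of_nat_Suc)
      then show "h ^ Suc n * (x * D (Suc n) + of_nat (Suc n) * D n) / fact (Suc n)
        = x * (h ^ Suc n * D (Suc n) / fact (Suc n)) + h * (h ^ n * D n / fact n)"
        unfolding f by simp
    qed
    also have "\<dots> = x * (\<Sum>n\<le>N'. h ^ Suc n * D (Suc n) / fact (Suc n)) + h * poly Q (x + h)"
      unfolding sum.distrib sum_distrib_left[symmetric] T ..
    also have "a + x * D 0 + (x * (\<Sum>n\<le>N'. h ^ Suc n * D (Suc n) / fact (Suc n)) + h * poly Q (x + h))
       = a + x * (\<Sum>n\<le>N. h ^ n * D n / fact n) + h * poly Q (x + h)"
      unfolding Suc sum.atMost_Suc_shift by (simp add: distrib_left del: fact_Suc)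
    also have "\<dots> = poly (pCons a Q) (x + h)" unfolding T by (simp add: algebra_simps)
    finally show ?thesis ..
  qed
qed

context suspension
begin

lemma dY_kernel:
  assumes "rep f F"
  shows "dY f = \<zero>\<^bsub>coord_ring m Y\<^esub> \<longleftrightarrow> F \<in> B"
proof -
  have "dY f = (\<lambda>p\<in>Y. 0) \<longleftrightarrow> dz F = 0"
    using rep_unique[OF _ rep_zero, of "dz F"] rep_unique_fun[OF _ rep_zero, of "dY f"] rep_dY[OF assms] by metis
  then show ?thesis unfolding coord_ring_simps using dz_eq_0_iff[OF rep_A[OF assms]] by argo
qed

definition replica :: "((nat \<Rightarrow> 'a) \<Rightarrow> 'a) \<Rightarrow> ((nat \<Rightarrow> 'a) \<Rightarrow> 'a) \<Rightarrow> ((nat \<Rightarrow> 'a) \<Rightarrow> 'a)" where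
  "replica f = (\<lambda>g\<in>regular_funs m Y. \<lambda>p\<in>Y. f p * dY g p)"

lemma replica_apply: "g \<in> regular_funs m Y \<Longrightarrow> replica f g = (\<lambda>p\<in>Y. f p * dY g p)"
  unfolding replica_def by (rule restrict_apply')

definition exp_map :: "((nat \<Rightarrow> 'a) \<Rightarrow> 'a) \<Rightarrow> (nat \<Rightarrow> 'a) \<Rightarrow> (nat \<Rightarrow> 'a)" where
  "exp_map f = map_of_algebra_map m Y (exp_deriv m Y (replica f))"

lemma rep_replica_iter:
  assumes "rep f F" "rep g H"
  shows "rep ((replica f ^^ n) g) (((\<lambda>H. F * dz H) ^^ n) H)"
proof (induction n)
  case 0
  show ?case using assms(2) by simp
next
  case (Suc n)
  have "replica f ((replica f ^^ n) g) = (\<lambda>p\<in>Y. f p * dY ((replica f ^^ n) g) p)"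
    by (rule replica_apply[OF rep_regular[OF Suc]])
  moreover have "rep (\<lambda>p\<in>Y. f p * dY ((replica f ^^ n) g) p) (F * dz (((\<lambda>H. F * dz H) ^^ n) H))"
    by (rule rep_mult[OF assms(1) rep_dY[OF Suc]])
  ultimately show ?case unfolding funpow.simps o_apply by argo
qed

lemma exp_replica:
  assumes "rep f F" "rep g H" "p \<in> Y" "\<And>n. n \<ge> N \<Longrightarrow> ((\<lambda>H. F * dz H) ^^ n) H = 0"
  shows "exp_deriv m Y (replica f) g p = (\<Sum>n<N. (replica f ^^ n) g p / fact n)"
proof -
  let ?S = "{n. (replica f ^^ n) g \<noteq> (\<lambda>p\<in>Y. 0)}"
  have sub: "?S \<subseteq> {..<N}"
  proof
    fix n assume "n \<in> ?S"
    then have "\<not> rep ((replica f ^^ n) g) 0" using rep_unique_fun[OF _ rep_zero] by blast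
    then have "\<not> n \<ge> N" using rep_replica_iter[OF assms(1,2), of n] assms(4)[of n] by auto
    then show "n \<in> {..<N}" by simp
  qed
  have "exp_deriv m Y (replica f) g p = (\<Sum>n\<in>?S. (replica f ^^ n) g p / fact n)"
    unfolding exp_deriv_def coord_ring_simps using rep_regular[OF assms(2)] assms(3) by simp
  also have "\<dots> = (\<Sum>n<N. (replica f ^^ n) g p / fact n)"
  proof (rule sum.mono_neutral_left[OF _ sub])
    show "\<forall>n\<in>{..<N} - ?S. (replica f ^^ n) g p / fact n = 0"
    proof
      fix n assume "n \<in> {..<N} - ?S"
      then have "(replica f ^^ n) g = (\<lambda>p\<in>Y. 0)" by blast
      then have "(replica f ^^ n) g p = 0" using assms(3) by (metis restrict_apply')
      then show "(replica f ^^ n) g p / fact n = 0" by simp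
    qed
  qed simp
  finally show ?thesis .
qed

lemma iter_0: "((\<lambda>H. F * dz H) ^^ n) 0 = 0"
proof -
  have "dz 0 = 0" using dz_const[of 0] by simp
  then show ?thesis by (induction n) simp_all
qed

lemma iter_vanish:
  assumes "((\<lambda>H. F * dz H) ^^ N) H = 0" "n \<ge> N"
  shows "((\<lambda>H. F * dz H) ^^ n) H = 0"
proof -
  have n: "n = (n - N) + N" using assms(2) by simp
  show ?thesis by (subst n) (simp only: funpow_add o_apply assms(1) iter_0)
qed

text \<open>Powers of \<open>F\<close> and \<open>M\<close> are annihilated by the derivation, so each step differentiates \<open>P\<close> once
  more and contributes one factor \<open>F\<close> and one factor \<open>M\<close>.\<close>

lemma iter_y1:
  assumes "F \<in> B"
  shows "((\<lambda>H. F * dz H) ^^ Suc n) y1 = F ^ Suc n * (mon kvec 1 ^ n * poly (lift_poly ((pderiv ^^ Suc n) P)) (lvar 0))"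
proof (induction n)
  case 0
  show ?case by (simp add: dz_y1)
next
  case (Suc n)
  let ?Q = "(pderiv ^^ Suc n) P" and ?M = "mon kvec 1 :: 'a laurent"
  have pow: "F' ^ i \<in> B" if "F' \<in> B" for F' i
    using that B_const[of 1] by (induction i) (simp_all add: B_mult)
  have dpow: "dz (F' ^ i) = 0" if "F' \<in> B" for F' i
    using dz_eq_0_iff[OF B_A[OF pow[OF that]]] pow[OF that] by blast
  have "((\<lambda>H. F * dz H) ^^ Suc (Suc n)) y1 = F * dz (F ^ Suc n * (?M ^ n * poly (lift_poly ?Q) (lvar 0)))"
    by (subst funpow.simps(2)) (simp only: o_apply Suc)
  also have "dz (F ^ Suc n * (?M ^ n * poly (lift_poly ?Q) (lvar 0))) = F ^ Suc n * (?M ^ n * dz (poly (lift_poly ?Q) (lvar 0)))"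
    unfolding dz_mult dpow[OF assms] dpow[OF B_kvec] by simp
  also have "dz (poly (lift_poly ?Q) (lvar 0)) = poly (lift_poly (pderiv ?Q)) (lvar 0) * ?M"
    using derivA_zpoly[OF derivA_dz, of ?Q] dz_lvar_0 by simp
  finally show ?case by (simp add: mult_ac)
qed

text \<open>After multiplication by \<open>M\<close>, the series for \<open>y\<^sub>1\<close> is the Taylor expansion of \<open>P\<close> at \<open>z\<close> with increment
  \<open>f M\<close>.\<close>

lemma exp_map_apply:
  assumes "rep f F" "F \<in> B" "p \<in> Y"
  shows "exp_map f p 0 = p 0 + f p * M p" "j \<in> {2..m} \<Longrightarrow> exp_map f p j = p j"
    "exp_map f p 1 = (\<Sum>n<Suc d. (replica f ^^ n) (coord_fun Y 1) p / fact n)"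
    "exp_map f p 1 * M p = poly P (p 0 + f p * M p)"
proof -
  have ap: "exp_map f p i = exp_deriv m Y (replica f) (coord_fun Y i) p" if "i \<le> m" for i
    using assms(3) that by (simp add: exp_map_def map_of_algebra_map_def)
  have "((\<lambda>H. F * dz H) ^^ 2) (lvar 0) = F * dz (F * mon kvec 1)"
    by (simp add: numeral_2_eq_2 dz_lvar_0)
  also have "\<dots> = 0" using dz_eq_0_iff[OF B_A[OF B_mult[OF assms(2) B_kvec]]] B_mult[OF assms(2) B_kvec] by simp
  finally have z0: "((\<lambda>H. F * dz H) ^^ 2) (lvar 0) = 0" .
  have r0: "rep (coord_fun Y 0) (lvar 0)" by (rule rep_coord) simp
  have fM: "replica f (coord_fun Y 0) p = f p * M p"
  proof -
    have "dY (coord_fun Y 0) = (\<lambda>p\<in>Y. M p)"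
      by (rule dY_eq[OF r0]) (simp add: dz_lvar_0 rep_M)
    then show ?thesis using replica_apply[OF rep_regular[OF r0]] assms(3) by simp
  qed
  have "exp_map f p 0 = (\<Sum>n<2. (replica f ^^ n) (coord_fun Y 0) p / fact n)"
    using ap[of 0] exp_replica[OF assms(1) r0 assms(3) iter_vanish[OF z0]] by simp
  also have "\<dots> = coord_fun Y 0 p + replica f (coord_fun Y 0) p" by (simp add: numeral_2_eq_2)
  also have "\<dots> = p 0 + f p * M p" unfolding fM using assms(3) by (simp add: coord_fun_def)
  finally show "exp_map f p 0 = p 0 + f p * M p" .
  show "exp_map f p j = p j" if j: "j \<in> {2..m}"
  proof -
    have rj: "rep (coord_fun Y j) (lvar j)" using j by (intro rep_coord) simp
    have zj: "((\<lambda>H. F * dz H) ^^ 1) (lvar j) = 0" using j by (simp add: dz_lvar)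
    have "exp_map f p j = (\<Sum>n<1. (replica f ^^ n) (coord_fun Y j) p / fact n)"
      using ap[of j] j exp_replica[OF assms(1) rj assms(3) iter_vanish[OF zj]] by simp
    then show ?thesis using assms(3) by (simp add: coord_fun_def)
  qed
  have z1: "((\<lambda>H. F * dz H) ^^ Suc d) y1 = 0"
  proof -
    have "(pderiv ^^ Suc d) P = 0"
    proof -
      have "degree ((pderiv ^^ d) P) = 0" by (simp add: degree_higher_pderiv)
      then show ?thesis by (simp add: pderiv_eq_0_iff)
    qed
    then show ?thesis unfolding iter_y1[OF assms(2)] by simp
  qed
  have "1 \<le> m" using m_ge_2 by simp
  show e1: "exp_map f p 1 = (\<Sum>n<Suc d. (replica f ^^ n) (coord_fun Y 1) p / fact n)"
    unfolding ap[OF \<open>1 \<le> m\<close>] by (rule exp_replica[OF assms(1) rep_y1 assms(3) iter_vanish[OF z1]])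
  have it: "(replica f ^^ Suc n) (coord_fun Y 1) p = f p ^ Suc n * (M p ^ n * poly ((pderiv ^^ Suc n) P) (p 0))" for n
  proof -
    have "rep (\<lambda>p\<in>Y. (\<lambda>p\<in>Y. f p ^ Suc n) p * (\<lambda>p\<in>Y. (\<lambda>p\<in>Y. (\<lambda>p\<in>Y. M p) p ^ n) p * (\<lambda>p\<in>Y. poly ((pderiv ^^ Suc n) P) (p 0)) p) p)
      (((\<lambda>H. F * dz H) ^^ Suc n) y1)"
      unfolding iter_y1[OF assms(2)] by (intro rep_mult rep_power rep_zpoly assms(1) rep_M)
    from fun_cong[OF rep_unique_fun[OF rep_replica_iter[OF assms(1) rep_y1] this], of p]
    show ?thesis using assms(3) by simp
  qed
  have "exp_map f p 1 * M p = p 1 * M p + (\<Sum>n<d. f p ^ Suc n * (M p ^ n * poly ((pderiv ^^ Suc n) P) (p 0)) / fact (Suc n)) * M p"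
    unfolding e1 sum.lessThan_Suc_shift it using assms(3)
    by (simp add: coord_fun_def distrib_right del: fact_Suc)
  also have "p 1 * M p = poly P (p 0)" using assms(3) Y_iff by blast
  also have "(\<Sum>n<d. f p ^ Suc n * (M p ^ n * poly ((pderiv ^^ Suc n) P) (p 0)) / fact (Suc n)) * M p
    = (\<Sum>n<d. (f p * M p) ^ Suc n * poly ((pderiv ^^ Suc n) P) (p 0) / fact (Suc n))"
    unfolding sum_distrib_right by (rule sum.cong) (simp_all add: power_mult_distrib mult_ac del: fact_Suc)
  also have "poly P (p 0) + \<dots> = (\<Sum>n\<le>d. (f p * M p) ^ n * poly ((pderiv ^^ n) P) (p 0) / fact n)"
    unfolding lessThan_Suc_atMost[symmetric] sum.lessThan_Suc_shift by simp
  also have "\<dots> = poly P (p 0 + f p * M p)" by (rule poly_taylor[symmetric]) simp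
  finally show "exp_map f p 1 * M p = poly P (p 0 + f p * M p)" .
qed

lemma M_cong: "(\<And>j. j \<in> {2..m} \<Longrightarrow> p j = q j) \<Longrightarrow> M p = M q"
  unfolding M_def by (intro prod.cong) auto

lemma exp_map_regular:
  assumes "rep f F" "F \<in> B"
  shows "regular_map m Y (exp_map f)"
  unfolding regular_map_def
proof (intro conjI ballI PiE_I)
  fix p assume p: "p \<in> Y"
  have "M (exp_map f p) = M p" using exp_map_apply(2)[OF assms p] by (intro M_cong)
  then show "exp_map f p \<in> Y"
    unfolding Y_iff using exp_map_apply(1,4)[OF assms p] p
    by (simp add: exp_map_def map_of_algebra_map_def)
next
  fix p assume "p \<notin> Y"
  then show "exp_map f p = undefined" by (simp add: exp_map_def map_of_algebra_map_def)
next
  fix i assume i: "i \<in> {0..m}"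
  consider "i = 0" | "i = 1" | "i \<in> {2..m}" using i by fastforce
  then show "(\<lambda>p\<in>Y. exp_map f p i) \<in> regular_funs m Y"
  proof cases
    case 1
    have "rep (\<lambda>p\<in>Y. exp_map f p i) (lvar 0 + F * mon kvec 1)"
      by (rule rep_cong[OF rep_add[OF rep_coord rep_mult[OF assms(1) rep_M]]])
         (simp_all add: coord_fun_def exp_map_apply(1)[OF assms] 1)
    then show ?thesis by (rule rep_regular)
  next
    case 2
    have "(\<lambda>p\<in>Y. exp_map f p i) = (\<lambda>p\<in>Y. \<Sum>n<Suc d. (\<lambda>p\<in>Y. inverse (fact n) * (replica f ^^ n) (coord_fun Y 1) p) p)"
      by (rule restrict_ext, unfold 2, subst exp_map_apply(3)[OF assms], assumption, rule sum.cong)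
         (simp_all add: divide_inverse mult.commute)
    also have "\<dots> \<in> regular_funs m Y"
      by (rule regular_funs_sum, simp, rule rep_regular[OF rep_scale[OF rep_replica_iter[OF assms(1) rep_y1]]])
    finally show ?thesis .
  next
    case 3
    have "rep (\<lambda>p\<in>Y. exp_map f p i) (lvar i)"
      by (rule rep_cong[OF rep_coord]) (use 3 in \<open>simp_all add: coord_fun_def exp_map_apply(2)[OF assms]\<close>)
    then show ?thesis by (rule rep_regular)
  qed
qed

text \<open>The shift \<open>f M\<close> depends only on the coordinates that the exponential fixes, so the opposite shift undoes
  it.\<close>

lemma exp_map_inverse:
  assumes "rep f F" "F \<in> B" "rep g H" "H \<in> B" "\<And>p. p \<in> Y \<Longrightarrow> g p = - f p" and p: "p \<in> Y"
  shows "exp_map g (exp_map f p) = p"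
proof -
  note rf = exp_map_regular[OF assms(1,2)] and rg = exp_map_regular[OF assms(3,4)]
  note inY = regular_map_in_Y[OF rf]
  have "compose Y (exp_map g) (exp_map f) = (\<lambda>p\<in>Y. p)"
  proof (rule regular_map_eqI[OF regular_map_comp[OF rg rf] regular_map_id])
    fix q i assume q: "q \<in> Y" and i: "i \<in> idx"
    note ef = exp_map_apply(1,2)[OF assms(1,2) q]
    note eg = exp_map_apply(1,2)[OF assms(3,4) inY[OF q]]
    have "g (exp_map f q) = g q"
      using rep_B_cong[OF assms(3,4) inY[OF q] q] ef(2) by blast
    moreover have "M (exp_map f q) = M q" using ef(2) by (intro M_cong)
    ultimately have "exp_map g (exp_map f q) 0 = q 0"
      using ef(1) eg(1) assms(5)[OF q] by simp
    moreover have "exp_map g (exp_map f q) j = q j" if "j \<in> {2..m}" for j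
      using ef(2)[OF that] eg(2)[OF that] by simp
    ultimately have "exp_map g (exp_map f q) i = q i" using i unfolding idx_def by blast
    then show "compose Y (exp_map g) (exp_map f) q i = (\<lambda>p\<in>Y. p) q i" using q by (simp add: compose_def)
  next
    fix q j assume q: "q \<in> Y" and nz: "\<And>j. j \<in> {2..m} \<Longrightarrow> q j \<noteq> 0" and j: "j \<in> {2..m}"
    show "compose Y (exp_map g) (exp_map f) q j \<noteq> 0"
      using exp_map_apply(2)[OF assms(1,2) q j] exp_map_apply(2)[OF assms(3,4) inY[OF q] j] nz[OF j] q
      by (simp add: compose_def)
  qed
  from fun_cong[OF this, of p] show ?thesis using p by (simp add: compose_def)
qed

lemma exp_map_G:
  assumes "rep f F" "F \<in> B"
  shows "exp_map f \<in> carrier G"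
proof -
  define g where "g = (\<lambda>p\<in>Y. (-1) * f p)"
  have g: "rep g (mon 0 (-1) * F)" unfolding g_def by (rule rep_scale[OF assms(1)])
  have gB: "mon 0 (-1) * F \<in> B" by (rule B_mult[OF B_const assms(2)])
  show ?thesis
  proof (rule G_carrierI[OF exp_map_regular[OF assms] exp_map_regular[OF g gB]])
    fix p assume p: "p \<in> Y"
    show "exp_map g (exp_map f p) = p" by (rule exp_map_inverse[OF assms g gB _ p]) (simp add: g_def)
    show "exp_map f (exp_map g p) = p" by (rule exp_map_inverse[OF g gB assms _ p]) (simp add: g_def)
  qed
qed

text \<open>An intrinsic description of the big unipotent subgroup, without derivations: the shift of \<open>z\<close> is the
  same at all points of a fibre of \<open>(y\<^sub>2, \<dots>, y\<^sub>m)\<close>.\<close>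

definition z_shifts :: "((nat \<Rightarrow> 'a) \<Rightarrow> (nat \<Rightarrow> 'a)) set" where
  "z_shifts = {\<phi> \<in> carrier G. (\<forall>p\<in>Y. \<forall>j\<in>{2..m}. \<phi> p j = p j) \<and>
     (\<forall>p\<in>Y. \<forall>q\<in>Y. (\<forall>j\<in>{2..m}. p j = q j) \<longrightarrow> \<phi> p 0 - p 0 = \<phi> q 0 - q 0)}"

lemma exp_map_z_shift:
  assumes "rep f F" "F \<in> B"
  shows "exp_map f \<in> z_shifts"
  unfolding z_shifts_def
proof (intro CollectI conjI ballI impI)
  show "exp_map f \<in> carrier G" by (rule exp_map_G[OF assms])
  show "exp_map f p j = p j" if "p \<in> Y" "j \<in> {2..m}" for p j by (rule exp_map_apply(2)[OF assms that])
  fix p q assume pq: "p \<in> Y" "q \<in> Y" "\<forall>j\<in>{2..m}. p j = q j"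
  have "f p = f q" by (rule rep_B_cong[OF assms pq(1,2)]) (use pq(3) in blast)
  moreover have "M p = M q" using pq(3) by (intro M_cong) blast
  ultimately show "exp_map f p 0 - p 0 = exp_map f q 0 - q 0"
    using exp_map_apply(1)[OF assms pq(1)] exp_map_apply(1)[OF assms pq(2)] by simp
qed

text \<open>The coordinate form of an automorphism leaves a scalar \<open>a\<close> in front of \<open>z\<close>. Two points of one fibre
  with different \<open>z\<close> show that \<open>a = 1\<close>, and then the automorphism is an exponential.\<close>

lemma z_shift_exp_map:
  assumes "\<phi> \<in> z_shifts"
  obtains f F where "rep f F" "F \<in> B" "\<phi> = exp_map f"
proof -
  have \<phi>: "\<phi> \<in> carrier G" and fix_y: "\<And>p j. p \<in> Y \<Longrightarrow> j \<in> {2..m} \<Longrightarrow> \<phi> p j = p j"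
    and tr: "\<And>p q. p \<in> Y \<Longrightarrow> q \<in> Y \<Longrightarrow> (\<And>j. j \<in> {2..m} \<Longrightarrow> p j = q j) \<Longrightarrow> \<phi> p 0 - p 0 = \<phi> q 0 - q 0"
    using assms unfolding z_shifts_def by blast+
  obtain a F f \<sigma> c where *: "a \<noteq> 0" "F \<in> B" "rep f F"
    "\<forall>p\<in>Y. \<phi> p 0 = a * p 0 + M p * f p"
    by (rule aut_coordinates[OF \<phi>])
  have a: "a = 1"
  proof -
    obtain p where p: "p \<in> Y" "\<And>i. i \<in> idx \<Longrightarrow> p i = (\<lambda>i. if i = 0 then 0 else 1) i"
      by (rule point_exists[of "\<lambda>i. if i = 0 then 0 else 1"]) auto
    obtain q where q: "q \<in> Y" "\<And>i. i \<in> idx \<Longrightarrow> q i = (\<lambda>i. 1) i"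
      by (rule point_exists[of "\<lambda>i. 1"]) auto
    have pq: "p j = q j" if "j \<in> {2..m}" for j using p(2)[of j] q(2)[of j] that by auto
    have "f p = f q" by (rule rep_B_cong[OF *(3,2) p(1) q(1) pq])
    moreover have "M p = M q" using pq by (rule M_cong)
    moreover have "p 0 = 0" "q 0 = 1" using p(2)[of 0] q(2)[of 0] by auto
    ultimately show ?thesis using tr[OF p(1) q(1) pq] bspec[OF *(4) p(1)] bspec[OF *(4) q(1)] by simp
  qed
  have "\<phi> = exp_map f"
  proof (rule regular_map_eqI[OF G_regular[OF \<phi>] exp_map_regular[OF *(3,2)]])
    fix p i assume p: "p \<in> Y" and i: "i \<in> idx"
    show "\<phi> p i = exp_map f p i"
      using i bspec[OF *(4) p] fix_y[OF p] exp_map_apply(1,2)[OF *(3,2) p] unfolding idx_def a by (auto simp: mult.commute)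
  next
    fix p j assume p: "p \<in> Y" and nz: "\<And>j. j \<in> {2..m} \<Longrightarrow> p j \<noteq> 0" and j: "j \<in> {2..m}"
    show "\<phi> p j \<noteq> 0" using fix_y[OF p j] nz[OF j] by simp
  qed
  with *(3,2) show ?thesis by (rule that)
qed

lemma big_unipotent_eq: "big_unipotent m k P = G\<lparr>carrier := z_shifts\<rparr>"
proof -
  have eq: "(\<lambda>g\<in>regular_funs m Y. f \<otimes>\<^bsub>coord_ring m Y\<^esub> dY g) = replica f" for f
    unfolding coord_ring_simps replica_def ..
  have "{map_of_algebra_map m Y (exp_deriv m Y (\<lambda>g\<in>regular_funs m Y. f \<otimes>\<^bsub>coord_ring m Y\<^esub> dY g)) | f.
     f \<in> regular_funs m Y \<and> dY f = \<zero>\<^bsub>coord_ring m Y\<^esub>} = z_shifts"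
    unfolding eq exp_map_def[symmetric]
  proof (intro equalityI subsetI)
    fix \<phi> assume "\<phi> \<in> {exp_map f | f. f \<in> regular_funs m Y \<and> dY f = \<zero>\<^bsub>coord_ring m Y\<^esub>}"
    then obtain f where f: "\<phi> = exp_map f" "f \<in> regular_funs m Y" "dY f = \<zero>\<^bsub>coord_ring m Y\<^esub>" by blast
    note rf = rep_formal[OF f(2)]
    have "formal f \<in> B" using dY_kernel[OF rf] f(3) by blast
    then show "\<phi> \<in> z_shifts" unfolding f(1) by (rule exp_map_z_shift[OF rf])
  next
    fix \<phi> assume "\<phi> \<in> z_shifts"
    then obtain f F where f: "rep f F" "F \<in> B" "\<phi> = exp_map f" by (rule z_shift_exp_map)
    have "f \<in> regular_funs m Y" "dY f = \<zero>\<^bsub>coord_ring m Y\<^esub>"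
      using rep_regular[OF f(1)] dY_kernel[OF f(1)] f(2) by blast+
    with f(3) show "\<phi> \<in> {exp_map f | f. f \<in> regular_funs m Y \<and> dY f = \<zero>\<^bsub>coord_ring m Y\<^esub>}" by blast
  qed
  then show ?thesis
    unfolding big_unipotent_def Let_def canonical_deriv_eq coord_ring_simps(1) by (rule arg_cong)
qed

end

section \<open>Semidirect products from conjugation\<close>

lemma AutoGroup_mult: "f \<in> carrier (AutoGroup H) \<Longrightarrow> g \<in> carrier (AutoGroup H) \<Longrightarrow>
    f \<otimes>\<^bsub>AutoGroup H\<^esub> g = compose (carrier H) f g"
  by (simp add: AutoGroup_def BijGroup_def auto_def)

text \<open>A group \<open>H\<close> embedded in \<open>G\<close> by \<open>\<iota>\<close> and a group \<open>B\<close> mapped to \<open>G\<close> by \<open>s\<close>, such that conjugation by \<open>B\<close>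
  preserves \<open>H\<close> and is described by \<open>\<theta>\<close> in terms of \<open>H\<close>. As \<open>\<iota>\<close> is injective, every law that \<open>\<theta>\<close> has to satisfy follows from
  the corresponding law of conjugation in \<open>G\<close>.\<close>

locale conjugation_action = G: group G + H: group H + B: group B
  for G (structure) and H (structure) and B (structure) +
  fixes \<iota> and s and \<theta>
  assumes \<iota>_hom: "\<iota> \<in> hom H G" and \<iota>_inj: "inj_on \<iota> (carrier H)" and s_hom: "s \<in> hom B G"
    and \<theta>_ext: "\<And>b. b \<in> carrier B \<Longrightarrow> \<theta> b \<in> extensional (carrier H)"
    and \<theta>_mem: "\<And>b h. b \<in> carrier B \<Longrightarrow> h \<in> carrier H \<Longrightarrow> \<theta> b h \<in> carrier H"
    and \<theta>_conj: "\<And>b h. b \<in> carrier B \<Longrightarrow> h \<in> carrier H \<Longrightarrow>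
        \<iota> (\<theta> b h) \<otimes>\<^bsub>G\<^esub> s b = s b \<otimes>\<^bsub>G\<^esub> \<iota> h"
begin

lemma \<iota>_mem: "h \<in> carrier H \<Longrightarrow> \<iota> h \<in> carrier G" using \<iota>_hom by (rule hom_in_carrier)
lemma s_mem: "b \<in> carrier B \<Longrightarrow> s b \<in> carrier G" using s_hom by (rule hom_in_carrier)
lemma \<iota>_mult: "h \<in> carrier H \<Longrightarrow> h' \<in> carrier H \<Longrightarrow> \<iota> (h \<otimes>\<^bsub>H\<^esub> h') = \<iota> h \<otimes>\<^bsub>G\<^esub> \<iota> h'"
  using \<iota>_hom by (rule hom_mult)
lemma s_mult: "b \<in> carrier B \<Longrightarrow> b' \<in> carrier B \<Longrightarrow> s (b \<otimes>\<^bsub>B\<^esub> b') = s b \<otimes>\<^bsub>G\<^esub> s b'"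
  using s_hom by (rule hom_mult)
lemma s_one: "s \<one>\<^bsub>B\<^esub> = \<one>\<^bsub>G\<^esub>" by (rule hom_one[OF s_hom B.is_group G.is_group])
lemma \<iota>_one: "\<iota> \<one>\<^bsub>H\<^esub> = \<one>\<^bsub>G\<^esub>" by (rule hom_one[OF \<iota>_hom H.is_group G.is_group])

text \<open>The way in which all laws for \<open>\<theta>\<close> are transferred from \<open>G\<close>.\<close>

lemma \<theta>_eqI:
  assumes "b \<in> carrier B" "h \<in> carrier H" "h' \<in> carrier H" "\<iota> h' \<otimes>\<^bsub>G\<^esub> s b = s b \<otimes>\<^bsub>G\<^esub> \<iota> h"
  shows "\<theta> b h = h'"
proof -
  have "\<iota> (\<theta> b h) \<otimes>\<^bsub>G\<^esub> s b = \<iota> h' \<otimes>\<^bsub>G\<^esub> s b" using \<theta>_conj assms by simp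
  from iffD1[OF G.right_cancel[OF s_mem[OF assms(1)] \<iota>_mem[OF \<theta>_mem[OF assms(1,2)]] \<iota>_mem[OF assms(3)]] this]
  have "\<iota> (\<theta> b h) = \<iota> h'" .
  then show ?thesis using \<iota>_inj \<theta>_mem assms by (simp add: inj_on_eq_iff)
qed

lemma \<theta>_one: "h \<in> carrier H \<Longrightarrow> \<theta> \<one>\<^bsub>B\<^esub> h = h"
  by (rule \<theta>_eqI) (simp_all add: s_one \<iota>_mem)

lemma \<theta>_comp:
  assumes "a \<in> carrier B" "b \<in> carrier B" "h \<in> carrier H"
  shows "\<theta> (a \<otimes>\<^bsub>B\<^esub> b) h = \<theta> a (\<theta> b h)"
proof (rule \<theta>_eqI)
  have "\<iota> (\<theta> a (\<theta> b h)) \<otimes>\<^bsub>G\<^esub> s (a \<otimes>\<^bsub>B\<^esub> b) = (\<iota> (\<theta> a (\<theta> b h)) \<otimes>\<^bsub>G\<^esub> s a) \<otimes>\<^bsub>G\<^esub> s b"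
    using assms by (simp add: s_mult \<iota>_mem s_mem \<theta>_mem G.m_assoc)
  also have "\<dots> = s a \<otimes>\<^bsub>G\<^esub> (\<iota> (\<theta> b h) \<otimes>\<^bsub>G\<^esub> s b)"
    using assms by (simp add: \<theta>_conj \<iota>_mem s_mem \<theta>_mem G.m_assoc)
  also have "\<dots> = s (a \<otimes>\<^bsub>B\<^esub> b) \<otimes>\<^bsub>G\<^esub> \<iota> h"
    using assms by (simp add: \<theta>_conj s_mult \<iota>_mem s_mem \<theta>_mem G.m_assoc)
  finally show "\<iota> (\<theta> a (\<theta> b h)) \<otimes>\<^bsub>G\<^esub> s (a \<otimes>\<^bsub>B\<^esub> b) = s (a \<otimes>\<^bsub>B\<^esub> b) \<otimes>\<^bsub>G\<^esub> \<iota> h" .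
qed (use assms \<theta>_mem in simp_all)

lemma \<theta>_mult:
  assumes "b \<in> carrier B" "h \<in> carrier H" "h' \<in> carrier H"
  shows "\<theta> b (h \<otimes>\<^bsub>H\<^esub> h') = \<theta> b h \<otimes>\<^bsub>H\<^esub> \<theta> b h'"
proof (rule \<theta>_eqI)
  have "\<iota> (\<theta> b h \<otimes>\<^bsub>H\<^esub> \<theta> b h') \<otimes>\<^bsub>G\<^esub> s b = \<iota> (\<theta> b h) \<otimes>\<^bsub>G\<^esub> (\<iota> (\<theta> b h') \<otimes>\<^bsub>G\<^esub> s b)"
    using assms by (simp add: \<iota>_mult \<iota>_mem s_mem \<theta>_mem G.m_assoc)
  also have "\<dots> = (\<iota> (\<theta> b h) \<otimes>\<^bsub>G\<^esub> s b) \<otimes>\<^bsub>G\<^esub> \<iota> h'"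
    unfolding \<theta>_conj[OF assms(1,3)] using assms by (simp add: \<iota>_mem s_mem \<theta>_mem G.m_assoc)
  also have "\<dots> = s b \<otimes>\<^bsub>G\<^esub> \<iota> (h \<otimes>\<^bsub>H\<^esub> h')"
    unfolding \<theta>_conj[OF assms(1,2)] using assms by (simp add: \<iota>_mult \<iota>_mem s_mem G.m_assoc)
  finally show "\<iota> (\<theta> b h \<otimes>\<^bsub>H\<^esub> \<theta> b h') \<otimes>\<^bsub>G\<^esub> s b = s b \<otimes>\<^bsub>G\<^esub> \<iota> (h \<otimes>\<^bsub>H\<^esub> h')" .
qed (use assms \<theta>_mem in simp_all)

lemma \<theta>_auto:
  assumes b: "b \<in> carrier B"
  shows "\<theta> b \<in> carrier (AutoGroup H)"
proof -
  have "\<theta> b \<in> hom H H" using b \<theta>_mem \<theta>_mult by (auto simp: hom_def)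
  moreover have "bij_betw (\<theta> b) (carrier H) (carrier H)"
  proof (rule bij_betwI[where g = "\<theta> (inv\<^bsub>B\<^esub> b)"])
    show "\<theta> (inv\<^bsub>B\<^esub> b) (\<theta> b h) = h" "\<theta> b (\<theta> (inv\<^bsub>B\<^esub> b) h) = h" if "h \<in> carrier H" for h
      using b that \<theta>_comp[of "inv\<^bsub>B\<^esub> b" b h] \<theta>_comp[of b "inv\<^bsub>B\<^esub> b" h] \<theta>_one by simp_all
  qed (use b \<theta>_mem in auto)
  ultimately show ?thesis using \<theta>_ext[OF b] by (simp add: AutoGroup_def auto_def Bij_def)
qed

lemma \<theta>_hom: "\<theta> \<in> hom B (AutoGroup H)"
proof (rule homI)
  show "\<theta> b \<in> carrier (AutoGroup H)" if "b \<in> carrier B" for b using \<theta>_auto[OF that] .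
  fix a b assume ab: "a \<in> carrier B" "b \<in> carrier B"
  have ext: "\<theta> (a \<otimes>\<^bsub>B\<^esub> b) \<in> extensional (carrier H)" using ab by (intro \<theta>_ext) simp
  have "\<theta> (a \<otimes>\<^bsub>B\<^esub> b) = compose (carrier H) (\<theta> a) (\<theta> b)"
    by (rule extensionalityI[OF ext compose_extensional]) (simp add: compose_def \<theta>_comp ab)
  then show "\<theta> (a \<otimes>\<^bsub>B\<^esub> b) = \<theta> a \<otimes>\<^bsub>AutoGroup H\<^esub> \<theta> b"
    using AutoGroup_mult[OF \<theta>_auto[OF ab(1)] \<theta>_auto[OF ab(2)]] by simp
qed

lemma semidirect_carrier: "carrier (semidirect B H \<theta>) = carrier B \<times> carrier H"
  by (simp add: semidirect_def)

lemma semidirect_mult: "(b, h) \<otimes>\<^bsub>semidirect B H \<theta>\<^esub> (b', h') = (b \<otimes>\<^bsub>B\<^esub> b', h \<otimes>\<^bsub>H\<^esub> \<theta> b h')"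
  by (simp add: semidirect_def)

lemma semidirect_one: "\<one>\<^bsub>semidirect B H \<theta>\<^esub> = (\<one>\<^bsub>B\<^esub>, \<one>\<^bsub>H\<^esub>)"
  by (simp add: semidirect_def)

lemma group_semidirect: "group (semidirect B H \<theta>)"
proof (rule groupI, unfold semidirect_carrier semidirect_one)
  show "(\<one>\<^bsub>B\<^esub>, \<one>\<^bsub>H\<^esub>) \<in> carrier B \<times> carrier H" by simp
next
  fix x y assume "x \<in> carrier B \<times> carrier H" "y \<in> carrier B \<times> carrier H"
  then show "x \<otimes>\<^bsub>semidirect B H \<theta>\<^esub> y \<in> carrier B \<times> carrier H"
    by (cases x, cases y) (simp add: semidirect_mult \<theta>_mem)
next
  fix x y z assume "x \<in> carrier B \<times> carrier H" "y \<in> carrier B \<times> carrier H" "z \<in> carrier B \<times> carrier H"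
  then show "x \<otimes>\<^bsub>semidirect B H \<theta>\<^esub> y \<otimes>\<^bsub>semidirect B H \<theta>\<^esub> z = x \<otimes>\<^bsub>semidirect B H \<theta>\<^esub> (y \<otimes>\<^bsub>semidirect B H \<theta>\<^esub> z)"
    by (cases x, cases y, cases z)
      (simp add: semidirect_mult \<theta>_mem \<theta>_comp \<theta>_mult B.m_assoc H.m_assoc)
next
  fix x assume "x \<in> carrier B \<times> carrier H"
  then obtain b h where x: "x = (b, h)" "b \<in> carrier B" "h \<in> carrier H" by blast
  show "(\<one>\<^bsub>B\<^esub>, \<one>\<^bsub>H\<^esub>) \<otimes>\<^bsub>semidirect B H \<theta>\<^esub> x = x"
    using x by (simp add: semidirect_mult \<theta>_one)
  have "(inv\<^bsub>B\<^esub> b, inv\<^bsub>H\<^esub> (\<theta> (inv\<^bsub>B\<^esub> b) h)) \<otimes>\<^bsub>semidirect B H \<theta>\<^esub> x = (\<one>\<^bsub>B\<^esub>, \<one>\<^bsub>H\<^esub>)"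
    using x by (simp add: semidirect_mult \<theta>_mem)
  moreover have "(inv\<^bsub>B\<^esub> b, inv\<^bsub>H\<^esub> (\<theta> (inv\<^bsub>B\<^esub> b) h)) \<in> carrier B \<times> carrier H"
    using x by (simp add: \<theta>_mem)
  ultimately show "\<exists>y\<in>carrier B \<times> carrier H. y \<otimes>\<^bsub>semidirect B H \<theta>\<^esub> x = (\<one>\<^bsub>B\<^esub>, \<one>\<^bsub>H\<^esub>)" by blast
qed

definition embed where "embed = (\<lambda>(b, h). \<iota> h \<otimes>\<^bsub>G\<^esub> s b)"

lemma embed_hom: "embed \<in> hom (semidirect B H \<theta>) G"
proof (rule homI, unfold semidirect_carrier)
  fix x assume "x \<in> carrier B \<times> carrier H"
  then show "embed x \<in> carrier G" by (cases x) (simp add: embed_def \<iota>_mem s_mem)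
next
  fix x y assume "x \<in> carrier B \<times> carrier H" "y \<in> carrier B \<times> carrier H"
  then obtain b h b' h' where x: "x = (b, h)" "b \<in> carrier B" "h \<in> carrier H"
    and y: "y = (b', h')" "b' \<in> carrier B" "h' \<in> carrier H" by blast
  have "embed (x \<otimes>\<^bsub>semidirect B H \<theta>\<^esub> y) = \<iota> h \<otimes>\<^bsub>G\<^esub> (\<iota> (\<theta> b h') \<otimes>\<^bsub>G\<^esub> s b) \<otimes>\<^bsub>G\<^esub> s b'"
    using x y by (simp add: semidirect_mult embed_def \<iota>_mem s_mem \<iota>_mult s_mult \<theta>_mem G.m_assoc)
  also have "\<dots> = embed x \<otimes>\<^bsub>G\<^esub> embed y"
    using x y by (simp add: \<theta>_conj embed_def \<iota>_mem s_mem G.m_assoc)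
  finally show "embed (x \<otimes>\<^bsub>semidirect B H \<theta>\<^esub> y) = embed x \<otimes>\<^bsub>G\<^esub> embed y" .
qed

lemma embed_inj:
  assumes "\<And>b h. b \<in> carrier B \<Longrightarrow> h \<in> carrier H \<Longrightarrow> \<iota> h \<otimes>\<^bsub>G\<^esub> s b = \<one>\<^bsub>G\<^esub> \<Longrightarrow> b = \<one>\<^bsub>B\<^esub>"
  shows "inj_on embed (carrier (semidirect B H \<theta>))"
proof -
  have hom: "group_hom (semidirect B H \<theta>) G embed"
    using group_semidirect G.is_group embed_hom by (simp add: group_hom_def group_hom_axioms_def)
  have "x = \<one>\<^bsub>semidirect B H \<theta>\<^esub>" if x: "x \<in> carrier (semidirect B H \<theta>)" "embed x = \<one>\<^bsub>G\<^esub>" for x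
  proof -
    obtain b h where bh: "x = (b, h)" "b \<in> carrier B" "h \<in> carrier H"
      using x(1) unfolding semidirect_carrier by blast
    have 1: "b = \<one>\<^bsub>B\<^esub>" using assms[OF bh(2,3)] x(2) bh(1) by (simp add: embed_def)
    then have "\<iota> h = \<iota> \<one>\<^bsub>H\<^esub>" using x(2) bh by (simp add: embed_def s_one \<iota>_one \<iota>_mem)
    then have "h = \<one>\<^bsub>H\<^esub>" using \<iota>_inj bh(3) by (simp add: inj_on_eq_iff)
    then show ?thesis using 1 bh(1) by (simp add: semidirect_one)
  qed
  then show ?thesis using group_hom.inj_on_one_iff[OF hom] by blast
qed

end

section \<open>The torus, the quasitorus and the symmetric group\<close>

context suspension
begin

lemma y_monomial_M: "y_monomial m k p = p 1 * M p"
  by (simp add: y_monomial_def M_def)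

text \<open>An action by regular maps is an action by automorphisms, since inverse elements act by inverse maps.\<close>

lemma action_hom:
  assumes X: "group X" and reg: "\<And>x. x \<in> carrier X \<Longrightarrow> regular_map m Y (act x)"
    and mult: "\<And>x y p. x \<in> carrier X \<Longrightarrow> y \<in> carrier X \<Longrightarrow> p \<in> Y \<Longrightarrow> act (x \<otimes>\<^bsub>X\<^esub> y) p = act x (act y p)"
    and one: "\<And>p. p \<in> Y \<Longrightarrow> act \<one>\<^bsub>X\<^esub> p = p"
  shows "act \<in> hom X G"
proof -
  interpret X: group X by (rule X)
  have mem: "act x \<in> carrier G" if x: "x \<in> carrier X" for x
  proof (rule G_carrierI[OF reg[OF x] reg[OF X.inv_closed[OF x]]])
    fix p assume p: "p \<in> Y"
    show "act (inv\<^bsub>X\<^esub> x) (act x p) = p" "act x (act (inv\<^bsub>X\<^esub> x) p) = p"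
      using mult[of "inv\<^bsub>X\<^esub> x" x p] mult[of x "inv\<^bsub>X\<^esub> x" p] x p one[OF p] by simp_all
  qed
  interpret G: group G by (rule group_G)
  show ?thesis
  proof (rule homI[OF mem])
    fix x y assume xy: "x \<in> carrier X" "y \<in> carrier X"
    show "act (x \<otimes>\<^bsub>X\<^esub> y) = act x \<otimes>\<^bsub>G\<^esub> act y"
      by (rule G_ext) (simp_all add: mem xy mult G_mult_apply)
  qed
qed

lemma regular_map_scaled:
  assumes "\<phi> \<in> extensional Y" "\<And>p. p \<in> Y \<Longrightarrow> \<phi> p \<in> Y"
    "\<And>i. i \<le> m \<Longrightarrow> j i \<le> m" "\<And>p i. p \<in> Y \<Longrightarrow> i \<le> m \<Longrightarrow> \<phi> p i = c i * p (j i)"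
  shows "regular_map m Y \<phi>"
  unfolding regular_map_def
proof (intro conjI ballI)
  show "\<phi> \<in> Y \<rightarrow>\<^sub>E Y" using assms(1,2) by (auto simp: PiE_def)
  fix i assume i: "i \<in> {0..m}"
  have "rep (\<lambda>p\<in>Y. \<phi> p i) (mon 0 (c i) * coord_laurent (j i))"
    by (rule rep_cong[OF rep_scale[OF rep_coord_laurent]])
       (use i assms(3,4) in \<open>simp_all add: coord_fun_def\<close>)
  then show "(\<lambda>p\<in>Y. \<phi> p i) \<in> regular_funs m Y" by (rule rep_regular)
qed

text \<open>The automorphisms that act on \<open>z\<close> by a scalar, and on \<open>y\<^sub>2, \<dots>, y\<^sub>m\<close> by scalars and a permutation,
  normalize the big unipotent subgroup.\<close>

definition monomial_aut where
  "monomial_aut g b c \<tau> \<longleftrightarrow> g \<in> carrier G \<and> bij_betw \<tau> {2..m} {2..m} \<and> (\<forall>j\<in>{2..m}. c j \<noteq> (0::'a)) \<and>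
     (\<forall>p\<in>Y. g p 0 = b * p 0 \<and> (\<forall>j\<in>{2..m}. g p j = c j * p (\<tau> j)))"

lemma monomial_autD:
  assumes "monomial_aut g b c \<tau>"
  shows "g \<in> carrier G" "bij_betw \<tau> {2..m} {2..m}" "j \<in> {2..m} \<Longrightarrow> c j \<noteq> 0"
    "p \<in> Y \<Longrightarrow> g p 0 = b * p 0" "p \<in> Y \<Longrightarrow> j \<in> {2..m} \<Longrightarrow> g p j = c j * p (\<tau> j)"
  using assms unfolding monomial_aut_def by blast+

text \<open>Up to scalars and a permutation, \<open>g p\<close> has the same coordinates \<open>y\<^sub>2, \<dots>, y\<^sub>m\<close> as \<open>p\<close>.\<close>

lemma monomial_aut_fibres:
  assumes "monomial_aut g b c \<tau>" "p \<in> Y" "q \<in> Y" "\<And>j. j \<in> {2..m} \<Longrightarrow> g p j = g q j" "j \<in> {2..m}"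
  shows "p j = q j"
proof -
  note g = monomial_autD[OF assms(1)]
  obtain i where i: "i \<in> {2..m}" "\<tau> i = j"
    using bij_betw_imp_surj_on[OF g(2)] assms(5) by (metis imageE)
  have "c i * p (\<tau> i) = c i * q (\<tau> i)"
    using assms(4)[OF i(1)] unfolding g(5)[OF assms(2) i(1)] g(5)[OF assms(3) i(1)] .
  then show ?thesis using g(3)[OF i(1)] i(2) by simp
qed

lemma z_shiftsD:
  assumes "u \<in> z_shifts"
  shows "u \<in> carrier G" "\<And>p j. p \<in> Y \<Longrightarrow> j \<in> {2..m} \<Longrightarrow> u p j = p j"
    "\<And>p q. p \<in> Y \<Longrightarrow> q \<in> Y \<Longrightarrow> (\<And>j. j \<in> {2..m} \<Longrightarrow> p j = q j) \<Longrightarrow> u p 0 - p 0 = u q 0 - q 0"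
  using assms unfolding z_shifts_def by blast+

lemma z_shiftsI:
  assumes "u \<in> carrier G" "\<And>p j. p \<in> Y \<Longrightarrow> j \<in> {2..m} \<Longrightarrow> u p j = p j"
    "\<And>p q. p \<in> Y \<Longrightarrow> q \<in> Y \<Longrightarrow> (\<And>j. j \<in> {2..m} \<Longrightarrow> p j = q j) \<Longrightarrow> u p 0 - p 0 = u q 0 - q 0"
  shows "u \<in> z_shifts"
  using assms unfolding z_shifts_def by blast

lemma monomial_aut_normalizes:
  assumes g: "monomial_aut g b c \<tau>" and u: "u \<in> z_shifts"
  shows "conj_by G g u \<in> z_shifts"
proof -
  interpret G: group G by (rule group_G)
  note gG = monomial_autD(1)[OF g]
  have uG: "u \<in> carrier G" by (rule z_shiftsD(1)[OF u])
  let ?h = "inv\<^bsub>G\<^esub> g"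
  have hG: "?h \<in> carrier G" using gG by simp
  have g_at: "g p 0 = b * p 0" "\<And>j. j \<in> {2..m} \<Longrightarrow> g p j = c j * p (\<tau> j)" if "p \<in> Y" for p
    using monomial_autD(4,5)[OF g] that by simp_all
  have \<tau>: "\<tau> j \<in> {2..m}" if "j \<in> {2..m}" for j
    using bij_betwE[OF monomial_autD(2)[OF g]] that by blast
  have at: "conj_by G g u p = g (u (?h p))" if "p \<in> Y" for p
    unfolding conj_by_def using that gG uG hG by (simp add: G_mult_apply G_in_Y)
  show ?thesis
  proof (rule z_shiftsI)
    show "conj_by G g u \<in> carrier G" unfolding conj_by_def using gG uG by simp
    fix p assume p: "p \<in> Y"
    note q = G_in_Y[OF hG p] and uq = G_in_Y[OF uG G_in_Y[OF hG p]]
    show "conj_by G g u p j = p j" if j: "j \<in> {2..m}" for j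
    proof -
      have "conj_by G g u p j = c j * u (?h p) (\<tau> j)" unfolding at[OF p] by (rule g_at(2)[OF uq j])
      also have "\<dots> = c j * ?h p (\<tau> j)" using z_shiftsD(2)[OF u q \<tau>[OF j]] by simp
      also have "\<dots> = g (?h p) j" by (rule g_at(2)[OF q j, symmetric])
      finally show ?thesis using G_inv_apply(1)[OF gG p] by simp
    qed
    fix p' assume p': "p' \<in> Y" and eq: "\<And>j. j \<in> {2..m} \<Longrightarrow> p j = p' j"
    have diff: "conj_by G g u x 0 - x 0 = b * (u (?h x) 0 - ?h x 0)" if x: "x \<in> Y" for x
    proof -
      have "conj_by G g u x 0 = b * u (?h x) 0" unfolding at[OF x] by (rule g_at(1)[OF G_in_Y[OF uG G_in_Y[OF hG x]]])
      moreover have "x 0 = b * ?h x 0" using g_at(1)[OF G_in_Y[OF hG x]] G_inv_apply(1)[OF gG x] by simp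
      ultimately show ?thesis by (simp add: right_diff_distrib)
    qed
    have "?h p j = ?h p' j" if "j \<in> {2..m}" for j
      by (rule monomial_aut_fibres[OF g q G_in_Y[OF hG p'] _ that])
         (use eq G_inv_apply(1)[OF gG p] G_inv_apply(1)[OF gG p'] in simp)
    then have "u (?h p) 0 - ?h p 0 = u (?h p') 0 - ?h p' 0"
      by (rule z_shiftsD(3)[OF u q G_in_Y[OF hG p']])
    then show "conj_by G g u p 0 - p 0 = conj_by G g u p' 0 - p' 0"
      unfolding diff[OF p] diff[OF p'] by simp
  qed
qed

lemma subgroup_z_shifts: "subgroup z_shifts G"
proof -
  interpret G: group G by (rule group_G)
  show ?thesis
  proof (rule G.subgroupI)
    show "z_shifts \<subseteq> carrier G" using z_shiftsD(1) by blast
    have "\<one>\<^bsub>G\<^esub> \<in> z_shifts" by (rule z_shiftsI) (simp_all, simp_all add: G_one)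
    then show "z_shifts \<noteq> {}" by blast
  next
    fix u assume u: "u \<in> z_shifts"
    note uG = z_shiftsD(1)[OF u]
    have iG: "inv\<^bsub>G\<^esub> u \<in> carrier G" using uG by simp
    have y: "(inv\<^bsub>G\<^esub> u) p j = p j" if "p \<in> Y" "j \<in> {2..m}" for p j
      using z_shiftsD(2)[OF u G_in_Y[OF iG that(1)] that(2)] G_inv_apply(1)[OF uG that(1)] by simp
    show "inv\<^bsub>G\<^esub> u \<in> z_shifts"
    proof (rule z_shiftsI[OF iG y])
      fix p q assume pq: "p \<in> Y" "q \<in> Y" "\<And>j. j \<in> {2..m} \<Longrightarrow> p j = q j"
      have "u ((inv\<^bsub>G\<^esub> u) p) 0 - (inv\<^bsub>G\<^esub> u) p 0 = u ((inv\<^bsub>G\<^esub> u) q) 0 - (inv\<^bsub>G\<^esub> u) q 0"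
        by (rule z_shiftsD(3)[OF u G_in_Y[OF iG pq(1)] G_in_Y[OF iG pq(2)]]) (simp add: y pq)
      then show "(inv\<^bsub>G\<^esub> u) p 0 - p 0 = (inv\<^bsub>G\<^esub> u) q 0 - q 0"
        unfolding G_inv_apply(1)[OF uG pq(1)] G_inv_apply(1)[OF uG pq(2)] by (simp add: algebra_simps)
    qed
  next
    fix u v assume u: "u \<in> z_shifts" and v: "v \<in> z_shifts"
    note G = z_shiftsD(1)[OF u] z_shiftsD(1)[OF v]
    show "u \<otimes>\<^bsub>G\<^esub> v \<in> z_shifts"
    proof (rule z_shiftsI)
      show "u \<otimes>\<^bsub>G\<^esub> v \<in> carrier G" using G by simp
      fix p assume p: "p \<in> Y"
      show "(u \<otimes>\<^bsub>G\<^esub> v) p j = p j" if "j \<in> {2..m}" for j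
        using z_shiftsD(2)[OF u G_in_Y[OF G(2) p] that] z_shiftsD(2)[OF v p that] by (simp add: G_mult_apply G p)
      fix q assume q: "q \<in> Y" and eq: "\<And>j. j \<in> {2..m} \<Longrightarrow> p j = q j"
      have e1: "v p 0 - p 0 = v q 0 - q 0" by (rule z_shiftsD(3)[OF v p q eq])
      have e2: "u (v p) 0 - v p 0 = u (v q) 0 - v q 0"
        by (rule z_shiftsD(3)[OF u G_in_Y[OF G(2) p] G_in_Y[OF G(2) q]]) (simp add: z_shiftsD(2)[OF v] p q eq)
      have split: "(u \<otimes>\<^bsub>G\<^esub> v) x 0 - x 0 = (u (v x) 0 - v x 0) + (v x 0 - x 0)" if "x \<in> Y" for x
        using that by (simp add: G_mult_apply G)
      show "(u \<otimes>\<^bsub>G\<^esub> v) p 0 - p 0 = (u \<otimes>\<^bsub>G\<^esub> v) q 0 - q 0"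
        unfolding split[OF p] split[OF q] e1 e2 ..
    qed
  qed
qed

abbreviation U where "U \<equiv> big_unipotent m k P"

lemma carrier_U: "carrier U = z_shifts" by (simp add: big_unipotent_eq)

lemma group_U: "group U"
  unfolding big_unipotent_eq by (rule group.subgroup_imp_group[OF group_G subgroup_z_shifts])

subsection \<open>The torus\<close>

abbreviation T where "T \<equiv> proper_torus m k :: (nat \<Rightarrow> 'a) monoid"
abbreviation tact where "tact \<equiv> torus_act m k P"

lemma T_carrier_iff: "t \<in> carrier T \<longleftrightarrow> t \<in> extensional {1..m} \<and> (\<forall>i\<in>{1..m}. t i \<noteq> 0) \<and> t 1 * M t = 1"
  by (auto simp: proper_torus_def y_monomial_M PiE_def)

lemma T_mult: "t \<otimes>\<^bsub>T\<^esub> t' = (\<lambda>i\<in>{1..m}. t i * t' i)"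
  by (simp add: proper_torus_def product_group_def field_units_def)

lemma T_one: "\<one>\<^bsub>T\<^esub> = (\<lambda>i\<in>{1..m}. 1)"
  by (simp add: proper_torus_def product_group_def field_units_def)

lemma M_mult: "(\<And>j. j \<in> {2..m} \<Longrightarrow> r j = p j * q j) \<Longrightarrow> M r = M p * M q"
  unfolding M_def by (simp add: power_mult_distrib prod.distrib)

lemma M_one: "(\<And>j. j \<in> {2..m} \<Longrightarrow> p j = 1) \<Longrightarrow> M p = 1"
  unfolding M_def by simp

lemma group_T: "group T"
proof (rule groupI)
  have m1: "1 \<in> {1..m}" using m_ge_2 by simp
  have "M (\<lambda>i\<in>{1..m}. 1) = 1" by (rule M_one) simp
  then show "\<one>\<^bsub>T\<^esub> \<in> carrier T" unfolding T_carrier_iff T_one using m1 by simp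
  fix t assume t: "t \<in> carrier T"
  show "\<one>\<^bsub>T\<^esub> \<otimes>\<^bsub>T\<^esub> t = t"
    unfolding T_mult T_one using t unfolding T_carrier_iff by (auto simp: extensional_def fun_eq_iff)
  have "M (\<lambda>i\<in>{1..m}. inverse (t i)) * M t = 1"
  proof -
    have "M (\<lambda>_. 1) = M (\<lambda>i\<in>{1..m}. inverse (t i)) * M t"
      by (rule M_mult) (use t in \<open>auto simp: T_carrier_iff\<close>)
    then show ?thesis using M_one[of "\<lambda>_. 1"] by simp
  qed
  moreover have t1: "t 1 * M t = 1" using t T_carrier_iff by blast
  ultimately have "M (\<lambda>i\<in>{1..m}. inverse (t i)) = t 1"
    by (metis mult_cancel_right mult_zero_right zero_neq_one)
  then have "inverse (t 1) * M (\<lambda>i\<in>{1..m}. inverse (t i)) = 1"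
    using t1 by (metis left_inverse mult_zero_left zero_neq_one)
  then have inv: "(\<lambda>i\<in>{1..m}. inverse (t i)) \<in> carrier T"
    using t m1 unfolding T_carrier_iff by simp
  have "(\<lambda>i\<in>{1..m}. inverse (t i)) \<otimes>\<^bsub>T\<^esub> t = \<one>\<^bsub>T\<^esub>"
    unfolding T_mult T_one using t unfolding T_carrier_iff by (intro restrict_ext) simp
  with inv show "\<exists>t'\<in>carrier T. t' \<otimes>\<^bsub>T\<^esub> t = \<one>\<^bsub>T\<^esub>" by blast
  fix t' assume t': "t' \<in> carrier T"
  have "M (\<lambda>i\<in>{1..m}. t i * t' i) = M t * M t'" by (rule M_mult) simp
  then have "(t 1 * t' 1) * M (\<lambda>i\<in>{1..m}. t i * t' i) = (t 1 * M t) * (t' 1 * M t')"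
    by (simp only: mult_ac)
  also have "\<dots> = 1" using t t' by (simp only: T_carrier_iff mult_1_left)
  finally show "t \<otimes>\<^bsub>T\<^esub> t' \<in> carrier T"
    unfolding T_mult using t t' m1 unfolding T_carrier_iff by simp
  fix t'' assume "t'' \<in> carrier T"
  show "t \<otimes>\<^bsub>T\<^esub> t' \<otimes>\<^bsub>T\<^esub> t'' = t \<otimes>\<^bsub>T\<^esub> (t' \<otimes>\<^bsub>T\<^esub> t'')"
    unfolding T_mult by (intro restrict_ext) (simp add: mult.assoc)
qed

lemma tact_apply: "p \<in> Y \<Longrightarrow> i \<le> m \<Longrightarrow> tact t p i = (if i = 0 then p 0 else t i * p i)"
  by (simp add: torus_act_def)

lemma tact_Y:
  assumes "t \<in> carrier T" "p \<in> Y"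
  shows "tact t p \<in> Y"
proof -
  have m1: "1 \<le> m" using m_ge_2 by simp
  have "M (tact t p) = M t * M p" by (rule M_mult) (simp add: tact_apply assms(2))
  then have "tact t p 1 * M (tact t p) = (t 1 * M t) * (p 1 * M p)"
    using tact_apply[OF assms(2) m1] by simp
  also have "\<dots> = poly P (tact t p 0)"
    using assms tact_apply[OF assms(2), of 0] by (simp add: T_carrier_iff Y_iff)
  finally show ?thesis unfolding Y_iff using assms(2) by (simp add: torus_act_def)
qed

lemma tact_regular: "t \<in> carrier T \<Longrightarrow> regular_map m Y (tact t)"
  by (rule regular_map_scaled[where j = id and c = "\<lambda>i. if i = 0 then 1 else t i"])
     (simp_all add: tact_Y tact_apply, simp add: torus_act_def)

lemma tact_hom: "tact \<in> hom T G"
proof (rule action_hom[OF group_T tact_regular])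
  interpret T: group T by (rule group_T)
  fix p assume p: "p \<in> Y"
  show "tact \<one>\<^bsub>T\<^esub> p = p"
    by (rule point_eqI[OF tact_Y[OF T.one_closed p] p]) (simp add: tact_apply p T_one)
  fix t t' assume t: "t \<in> carrier T" "t' \<in> carrier T"
  show "tact (t \<otimes>\<^bsub>T\<^esub> t') p = tact t (tact t' p)"
    by (rule point_eqI[OF tact_Y[OF T.m_closed[OF t] p] tact_Y[OF t(1) tact_Y[OF t(2) p]]])
       (simp add: tact_apply p tact_Y t T_mult)
qed

subsection \<open>The quasitorus\<close>

abbreviation D where "D \<equiv> quasitorus P"
abbreviation dact where "dact \<equiv> quasitorus_act m k P"

lemma D_carrier_iff: "s \<in> carrier D \<longleftrightarrow> s \<noteq> 0 \<and> (\<forall>z. poly P (s * z) = s ^ d * poly P z)"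
proof -
  have "pcompose P [:0, s:] = smult (s ^ d) P \<longleftrightarrow> (\<forall>z. poly P (s * z) = s ^ d * poly P z)"
    by (simp add: poly_eq_poly_eq_iff[symmetric] fun_eq_iff poly_pcompose mult.commute)
  then show ?thesis by (simp add: quasitorus_def)
qed

lemma D_mult: "s \<otimes>\<^bsub>D\<^esub> s' = s * s'" and D_one: "\<one>\<^bsub>D\<^esub> = 1"
  by (simp_all add: quasitorus_def field_units_def)

lemma group_D: "group D"
proof (rule groupI, unfold D_mult D_one)
  show "1 \<in> carrier D" by (simp add: D_carrier_iff)
  fix s assume s: "s \<in> carrier D"
  show "1 * s = s" by simp
  have "poly P (inverse s * z) = inverse s ^ d * poly P z" for z
  proof -
    have "poly P (s * (inverse s * z)) = s ^ d * poly P (inverse s * z)" using s D_carrier_iff by blast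
    moreover have "s * (inverse s * z) = z" using s D_carrier_iff by simp
    ultimately show ?thesis using s D_carrier_iff by (simp add: field_simps)
  qed
  then have "inverse s \<in> carrier D" "inverse s * s = 1" using s by (simp_all add: D_carrier_iff)
  then show "\<exists>s'\<in>carrier D. s' * s = 1" by blast
  fix s' assume s': "s' \<in> carrier D"
  have "poly P (s * s' * z) = (s * s') ^ d * poly P z" for z
  proof -
    have "poly P (s * (s' * z)) = s ^ d * poly P (s' * z)" using s D_carrier_iff by blast
    also have "poly P (s' * z) = s' ^ d * poly P z" using s' D_carrier_iff by blast
    finally show ?thesis by (simp add: power_mult_distrib mult_ac)
  qed
  then show "s * s' \<in> carrier D" using s s' by (simp add: D_carrier_iff)
  show "s * s' * s'' = s * (s' * s'')" for s'' by simp
qed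

lemma dact_apply: "p \<in> Y \<Longrightarrow> i \<le> m \<Longrightarrow>
    dact s p i = (if i = 0 then s * p 0 else if i = 1 then s ^ d * p 1 else p i)"
  by (simp add: quasitorus_act_def)

lemma dact_Y:
  assumes "s \<in> carrier D" "p \<in> Y"
  shows "dact s p \<in> Y"
proof -
  have m1: "1 \<le> m" using m_ge_2 by simp
  have "M (dact s p) = M p" by (rule M_cong) (simp add: dact_apply assms(2))
  then have "dact s p 1 * M (dact s p) = s ^ d * (p 1 * M p)"
    using dact_apply[OF assms(2) m1] by simp
  also have "p 1 * M p = poly P (p 0)" using assms(2) Y_iff by blast
  also have "s ^ d * poly P (p 0) = poly P (dact s p 0)"
    using assms dact_apply[OF assms(2), of 0] by (simp add: D_carrier_iff)
  finally have "dact s p 1 * M (dact s p) = poly P (dact s p 0)" .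
  moreover have "dact s p \<in> extensional {0..m}" using assms(2) by (simp add: quasitorus_act_def)
  ultimately show ?thesis unfolding Y_iff by blast
qed

lemma dact_regular: "s \<in> carrier D \<Longrightarrow> regular_map m Y (dact s)"
  by (rule regular_map_scaled[where j = id and c = "\<lambda>i. if i = 0 then s else if i = 1 then s ^ d else 1"])
     (simp_all add: dact_Y dact_apply, simp add: quasitorus_act_def)

lemma dact_hom: "dact \<in> hom D G"
proof (rule action_hom[OF group_D dact_regular])
  interpret D: group D by (rule group_D)
  fix p assume p: "p \<in> Y"
  show "dact \<one>\<^bsub>D\<^esub> p = p"
    by (rule point_eqI[OF dact_Y[OF D.one_closed p] p]) (simp add: dact_apply p D_one)
  fix s s' assume s: "s \<in> carrier D" "s' \<in> carrier D"
  show "dact (s \<otimes>\<^bsub>D\<^esub> s') p = dact s (dact s' p)"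
    by (rule point_eqI[OF dact_Y[OF D.m_closed[OF s] p] dact_Y[OF s(1) dact_Y[OF s(2) p]]])
       (simp add: dact_apply p dact_Y s D_mult power_mult_distrib)
qed

subsection \<open>The symmetric group\<close>

abbreviation sact where "sact \<equiv> sym_act m k P"

lemma S_carrier_iff: "\<sigma> \<in> carrier (sym_Y TYPE('a) m k) \<longleftrightarrow> \<sigma> permutes {1..m} \<and> (\<forall>y::nat \<Rightarrow> 'a. y_monomial m k (y \<circ> \<sigma>) = y_monomial m k y)"
  by (simp add: sym_Y_def)

lemma S_mult: "\<sigma> \<otimes>\<^bsub>sym_Y TYPE('a) m k\<^esub> \<tau> = \<sigma> \<circ> \<tau>" and S_one: "\<one>\<^bsub>sym_Y TYPE('a) m k\<^esub> = id"
  by (simp_all add: sym_Y_def sym_group_def)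

lemma S_inv:
  assumes "\<sigma> \<in> carrier (sym_Y TYPE('a) m k)"
  shows "inv_into UNIV \<sigma> \<in> carrier (sym_Y TYPE('a) m k)"
  unfolding S_carrier_iff
proof (intro conjI allI)
  have \<sigma>: "\<sigma> permutes {1..m}" using assms S_carrier_iff by blast
  then show "inv_into UNIV \<sigma> permutes {1..m}" by (rule permutes_inv)
  fix y :: "nat \<Rightarrow> 'a"
  have "y_monomial m k ((y \<circ> inv_into UNIV \<sigma>) \<circ> \<sigma>) = y_monomial m k (y \<circ> inv_into UNIV \<sigma>)"
    using assms S_carrier_iff by blast
  moreover have "(y \<circ> inv_into UNIV \<sigma>) \<circ> \<sigma> = y"
    using permutes_inv_o(2)[OF \<sigma>] by (simp add: comp_assoc)
  ultimately show "y_monomial m k (y \<circ> inv_into UNIV \<sigma>) = y_monomial m k y" by simp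
qed

lemma group_S: "group (sym_Y TYPE('a) m k)"
proof (rule groupI, unfold S_mult S_one)
  show "id \<in> carrier (sym_Y TYPE('a) m k)" by (simp add: S_carrier_iff permutes_id)
  fix \<sigma> assume \<sigma>: "\<sigma> \<in> carrier (sym_Y TYPE('a) m k)"
  show "id \<circ> \<sigma> = \<sigma>" by simp
  have "inv_into UNIV \<sigma> \<circ> \<sigma> = id" using \<sigma> S_carrier_iff permutes_inv_o(2) by blast
  then show "\<exists>\<tau>\<in>carrier (sym_Y TYPE('a) m k). \<tau> \<circ> \<sigma> = id" using S_inv[OF \<sigma>] by blast
  fix \<tau> assume \<tau>: "\<tau> \<in> carrier (sym_Y TYPE('a) m k)"
  show "\<sigma> \<circ> \<tau> \<in> carrier (sym_Y TYPE('a) m k)"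
    unfolding S_carrier_iff
  proof (intro conjI allI)
    show "\<sigma> \<circ> \<tau> permutes {1..m}" using \<sigma> \<tau> S_carrier_iff permutes_compose by blast
    fix y :: "nat \<Rightarrow> 'a"
    have "y_monomial m k ((y \<circ> \<sigma>) \<circ> \<tau>) = y_monomial m k (y \<circ> \<sigma>)" using \<tau> S_carrier_iff by blast
    also have "\<dots> = y_monomial m k y" using \<sigma> S_carrier_iff by blast
    finally show "y_monomial m k (y \<circ> (\<sigma> \<circ> \<tau>)) = y_monomial m k y" by (simp add: comp_assoc)
  qed
  show "\<sigma> \<circ> \<tau> \<circ> \<chi> = \<sigma> \<circ> (\<tau> \<circ> \<chi>)" for \<chi> by (rule comp_assoc)
qed

text \<open>Setting one variable to \<open>2\<close> and the others to \<open>1\<close> reads off its exponent in the monomial. The exponent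
  \<open>1\<close> occurs only at \<open>y\<^sub>1\<close>, because all other exponents are at least \<open>2\<close>.\<close>

lemma S_fixes:
  assumes "\<sigma> \<in> carrier (sym_Y TYPE('a) m k)"
  shows "\<sigma> 0 = 0" "\<sigma> 1 = 1" "bij_betw \<sigma> {2..m} {2..m}"
proof -
  have \<sigma>: "\<sigma> permutes {1..m}" using assms S_carrier_iff by blast
  show "\<sigma> 0 = 0" using permutes_not_in[OF \<sigma>, of 0] by simp
  obtain i where i: "\<sigma> i = 1" using permutes_surj[OF \<sigma>] by (metis surjD)
  have im: "i \<in> {1..m}" using permutes_in_image[OF \<sigma>, of i] i m_ge_2 by simp
  have "i = 1"
  proof (rule ccontr)
    assume "i \<noteq> 1"
    then have i2: "i \<in> {2..m}" using im by auto
    define y where "y = (\<lambda>j::nat. if j = 1 then 2 else 1 :: 'a)"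
    have y\<sigma>: "(y \<circ> \<sigma>) j = (if j = i then 2 else 1)" for j
    proof -
      have "\<sigma> j = 1 \<longleftrightarrow> j = i" using i inj_eq[OF permutes_inj[OF \<sigma>], of j i] by simp
      then show ?thesis by (simp add: y_def)
    qed
    have "M y = 1" by (rule M_one) (auto simp: y_def)
    moreover have "M (y \<circ> \<sigma>) = 2 ^ k i"
    proof -
      have "M (y \<circ> \<sigma>) = (\<Prod>j\<in>{2..m}. if j = i then 2 ^ k i else 1)"
        unfolding M_def y\<sigma> by (rule prod.cong) auto
      then show ?thesis using i2 by simp
    qed
    moreover have "y_monomial m k (y \<circ> \<sigma>) = y_monomial m k y" using assms S_carrier_iff by blast
    moreover have "(y \<circ> \<sigma>) 1 = 1" "y 1 = 2" using y\<sigma>[of 1] \<open>i \<noteq> 1\<close> by (auto simp: y_def)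
    ultimately have "(2::'a) ^ k i = 2" unfolding y_monomial_M by simp
    then have "of_nat (2 ^ k i) = (of_nat 2 :: 'a)" by simp
    then have "(2::nat) ^ k i = 2" unfolding of_nat_eq_iff .
    moreover have "(2::nat) ^ k i \<ge> 2 ^ 2" using bspec[OF k_ge_2 i2] by (intro power_increasing) auto
    ultimately show False by simp
  qed
  then show s1: "\<sigma> 1 = 1" using i by simp
  show "bij_betw \<sigma> {2..m} {2..m}"
  proof -
    have "{2..m} = {1..m} - {1}" by auto
    moreover have "bij_betw \<sigma> ({1..m} - {1}) ({1..m} - {\<sigma> 1})"
      using permutes_imp_bij[OF \<sigma>] m_ge_2 by (intro bij_betw_DiffI) (auto simp: bij_betw_def)
    ultimately show ?thesis using s1 by simp
  qed
qed

lemma sact_apply: "p \<in> Y \<Longrightarrow> i \<le> m \<Longrightarrow> sact \<sigma> p i = p (inv_into UNIV \<sigma> i)"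
  by (simp add: sym_act_def)

lemma S_le:
  assumes "\<sigma> \<in> carrier (sym_Y TYPE('a) m k)" "i \<le> m"
  shows "\<sigma> i \<le> m"
  using permutes_in_image[of \<sigma> "{1..m}" i] S_fixes(1)[OF assms(1)] assms S_carrier_iff[of \<sigma>] by (cases "i = 0") auto

lemma y_monomial_cong:
  fixes p q :: "nat \<Rightarrow> 'a"
  shows "(\<And>i. i \<in> {1..m} \<Longrightarrow> p i = q i) \<Longrightarrow> y_monomial m k p = y_monomial m k q"
  unfolding y_monomial_M using m_ge_2 M_cong[of p q] by simp

lemma sact_Y:
  assumes "\<sigma> \<in> carrier (sym_Y TYPE('a) m k)" "p \<in> Y"
  shows "sact \<sigma> p \<in> Y"
proof -
  have "y_monomial m k (sact \<sigma> p) = y_monomial m k (p \<circ> inv_into UNIV \<sigma>)"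
    by (rule y_monomial_cong) (simp add: sact_apply assms(2))
  also have "\<dots> = y_monomial m k p" using S_inv[OF assms(1)] S_carrier_iff by blast
  also have "\<dots> = poly P (p 0)" using assms(2) by (simp add: y_monomial_M Y_iff)
  also have "p 0 = sact \<sigma> p 0" using S_fixes(1)[OF S_inv[OF assms(1)]] assms(2) by (simp add: sact_apply)
  finally have "y_monomial m k (sact \<sigma> p) = poly P (sact \<sigma> p 0)" .
  moreover have "sact \<sigma> p \<in> extensional {0..m}" using assms(2) by (simp add: sym_act_def)
  ultimately show ?thesis unfolding Y_iff y_monomial_M by blast
qed

lemma sact_regular: "\<sigma> \<in> carrier (sym_Y TYPE('a) m k) \<Longrightarrow> regular_map m Y (sact \<sigma>)"
  by (rule regular_map_scaled[where j = "inv_into UNIV \<sigma>" and c = "\<lambda>_. 1"])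
     (simp_all add: sact_Y sact_apply S_le S_inv, simp add: sym_act_def)

lemma sact_hom: "sact \<in> hom (sym_Y TYPE('a) m k) G"
proof (rule action_hom[OF group_S sact_regular])
  interpret S: group "sym_Y TYPE('a) m k" by (rule group_S)
  fix p assume p: "p \<in> Y"
  show "sact \<one>\<^bsub>sym_Y TYPE('a) m k\<^esub> p = p"
    by (rule point_eqI[OF sact_Y[OF S.one_closed p] p]) (simp add: sact_apply p S_one)
  fix \<sigma> \<tau> assume \<sigma>: "\<sigma> \<in> carrier (sym_Y TYPE('a) m k)" "\<tau> \<in> carrier (sym_Y TYPE('a) m k)"
  have "inv_into UNIV (\<sigma> \<circ> \<tau>) = inv_into UNIV \<tau> \<circ> inv_into UNIV \<sigma>"
    using \<sigma> S_carrier_iff permutes_bij o_inv_distrib by blast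
  then show "sact (\<sigma> \<otimes>\<^bsub>sym_Y TYPE('a) m k\<^esub> \<tau>) p = sact \<sigma> (sact \<tau> p)"
    by (intro point_eqI[OF sact_Y[OF S.m_closed[OF \<sigma>] p] sact_Y[OF \<sigma>(1) sact_Y[OF \<sigma>(2) p]]])
       (simp add: sact_apply p sact_Y \<sigma> S_mult S_le S_inv)
qed

end

section \<open>The structure of the automorphism group\<close>

context suspension
begin

lemma tact_dact: "t \<in> carrier T \<Longrightarrow> s \<in> carrier D \<Longrightarrow> p \<in> Y \<Longrightarrow> tact t (dact s p) = dact s (tact t p)"
  by (rule point_eqI) (simp_all add: tact_Y dact_Y tact_apply dact_apply)

definition TD_aut where "TD_aut = (\<lambda>(t, s). tact t \<otimes>\<^bsub>G\<^esub> dact s)"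

lemma tact_G: "t \<in> carrier T \<Longrightarrow> tact t \<in> carrier G" by (rule hom_in_carrier[OF tact_hom])
lemma dact_G: "s \<in> carrier D \<Longrightarrow> dact s \<in> carrier G" by (rule hom_in_carrier[OF dact_hom])
lemma sact_G: "\<sigma> \<in> carrier (sym_Y TYPE('a) m k) \<Longrightarrow> sact \<sigma> \<in> carrier G" by (rule hom_in_carrier[OF sact_hom])

lemma TD_aut_apply: "t \<in> carrier T \<Longrightarrow> s \<in> carrier D \<Longrightarrow> p \<in> Y \<Longrightarrow> TD_aut (t, s) p = tact t (dact s p)"
  by (simp add: TD_aut_def G_mult_apply tact_G dact_G)

lemma group_TD: "group (T \<times>\<times> D)" by (rule DirProd_group[OF group_T group_D])

lemma TD_aut_G: "t \<in> carrier T \<Longrightarrow> s \<in> carrier D \<Longrightarrow> TD_aut (t, s) \<in> carrier G"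
  using monoid.m_closed[OF group.is_monoid[OF group_G] tact_G dact_G] by (simp add: TD_aut_def)

lemma TD_aut_hom: "TD_aut \<in> hom (T \<times>\<times> D) G"
proof (rule action_hom[OF group_TD])
  interpret T: group T by (rule group_T)
  interpret D: group D by (rule group_D)
  fix x assume "x \<in> carrier (T \<times>\<times> D)"
  then obtain t s where x: "x = (t, s)" "t \<in> carrier T" "s \<in> carrier D" by auto
  show "regular_map m Y (TD_aut x)" using G_regular[OF TD_aut_G[OF x(2,3)]] x(1) by simp
  fix y p assume "y \<in> carrier (T \<times>\<times> D)" and p: "p \<in> Y"
  then obtain t' s' where y: "y = (t', s')" "t' \<in> carrier T" "s' \<in> carrier D" by auto
  have "TD_aut (x \<otimes>\<^bsub>T \<times>\<times> D\<^esub> y) p = tact (t \<otimes>\<^bsub>T\<^esub> t') (dact (s \<otimes>\<^bsub>D\<^esub> s') p)"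
    using x y p by (simp add: TD_aut_apply)
  also have "\<dots> = tact t (tact t' (dact s (dact s' p)))"
    using hom_mult[OF tact_hom x(2) y(2)] hom_mult[OF dact_hom x(3) y(3)] x y p
    by (simp add: G_mult_apply tact_G dact_G dact_Y)
  also have "\<dots> = TD_aut x (TD_aut y p)"
    using x y p by (simp add: TD_aut_apply tact_dact tact_Y dact_Y)
  finally show "TD_aut (x \<otimes>\<^bsub>T \<times>\<times> D\<^esub> y) p = TD_aut x (TD_aut y p)" .
next
  fix p assume p: "p \<in> Y"
  interpret T: group T by (rule group_T)
  interpret D: group D by (rule group_D)
  have "tact \<one>\<^bsub>T\<^esub> = \<one>\<^bsub>G\<^esub>" "dact \<one>\<^bsub>D\<^esub> = \<one>\<^bsub>G\<^esub>"
    using hom_one[OF tact_hom group_T group_G] hom_one[OF dact_hom group_D group_G] .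
  then show "TD_aut \<one>\<^bsub>T \<times>\<times> D\<^esub> p = p" using p by (simp add: TD_aut_apply G_one)
qed

lemma TD_aut_coords:
  assumes "t \<in> carrier T" "s \<in> carrier D" "p \<in> Y"
  shows "TD_aut (t, s) p 0 = s * p 0" "TD_aut (t, s) p 1 = t 1 * (s ^ d * p 1)" "j \<in> {2..m} \<Longrightarrow> TD_aut (t, s) p j = t j * p j"
  using assms m_ge_2 by (simp_all add: TD_aut_apply tact_apply dact_apply dact_Y)

lemma TD_aut_monomial:
  assumes "t \<in> carrier T" "s \<in> carrier D"
  shows "monomial_aut (TD_aut (t, s)) s t id"
  unfolding monomial_aut_def
proof (intro conjI ballI)
  show "t j \<noteq> 0" if "j \<in> {2..m}" for j using assms(1) that unfolding T_carrier_iff by simp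
qed (use assms TD_aut_G TD_aut_coords in auto)

lemma sact_monomial:
  assumes "\<sigma> \<in> carrier (sym_Y TYPE('a) m k)"
  shows "monomial_aut (sact \<sigma>) 1 (\<lambda>_. 1) (inv_into UNIV \<sigma>)"
  unfolding monomial_aut_def
proof (intro conjI ballI)
  note f = S_fixes[OF S_inv[OF assms]]
  show "sact \<sigma> \<in> carrier G" by (rule sact_G[OF assms])
  show "bij_betw (inv_into UNIV \<sigma>) {2..m} {2..m}" by (rule f(3))
  fix p assume p: "p \<in> Y"
  show "sact \<sigma> p 0 = 1 * p 0" using f(1) p by (simp add: sact_apply)
  show "sact \<sigma> p j = 1 * p (inv_into UNIV \<sigma> j)" if "j \<in> {2..m}" for j
    using that p by (simp add: sact_apply)
qed simp

lemma conj_by_mult: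
  assumes "g \<in> carrier G" "u \<in> carrier G"
  shows "conj_by G g u \<otimes>\<^bsub>G\<^esub> g = g \<otimes>\<^bsub>G\<^esub> u"
proof -
  interpret G: group G by (rule group_G)
  show ?thesis using assms by (simp add: conj_by_def G.m_assoc)
qed

text \<open>At these points an element of the torus shows its entries, and two of them on one fibre with
  different \<open>z\<close> show the element of the quasitorus.\<close>

lemma test_point:
  obtains p where "p \<in> Y" "p 0 = z" "\<And>j. j \<in> {2..m} \<Longrightarrow> p j = 1"
proof -
  obtain p where p: "p \<in> Y" "\<And>i. i \<in> idx \<Longrightarrow> p i = (\<lambda>i. if i = 0 then z else 1) i"
    by (rule point_exists[of "\<lambda>i. if i = 0 then z else 1"]) auto
  show ?thesis
  proof (rule that[OF p(1)])
    show "p 0 = z" using p(2)[of 0] by simp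
    show "p j = 1" if "j \<in> {2..m}" for j using p(2)[of j] that by auto
  qed
qed

lemma U_TD_trivial:
  assumes t: "t \<in> carrier T" and s: "s \<in> carrier D" and u: "u \<in> z_shifts"
    and eq: "u \<otimes>\<^bsub>G\<^esub> TD_aut (t, s) = \<one>\<^bsub>G\<^esub>"
  shows "t = \<one>\<^bsub>T\<^esub>" "s = 1"
proof -
  have at: "u (TD_aut (t, s) p) = p" if "p \<in> Y" for p
    using fun_cong[OF eq, of p] that z_shiftsD(1)[OF u] TD_aut_G[OF t s] by (simp add: G_mult_apply G_one)
  obtain p where p: "p \<in> Y" "p 0 = 0" "\<And>j. j \<in> {2..m} \<Longrightarrow> p j = 1" using test_point[of 0] by metis
  obtain q where q: "q \<in> Y" "q 0 = 1" "\<And>j. j \<in> {2..m} \<Longrightarrow> q j = 1" using test_point[of 1] by metis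
  note inY = G_in_Y[OF TD_aut_G[OF t s]]
  have tj: "t j = 1" if "j \<in> {2..m}" for j
    using z_shiftsD(2)[OF u inY[OF p(1)] that] TD_aut_coords(3)[OF t s p(1) that] p(3)[OF that]
    unfolding at[OF p(1)] by simp
  have "M t = 1" by (rule M_one) (rule tj)
  then have t1: "t 1 = 1" using t unfolding T_carrier_iff by simp
  show "t = \<one>\<^bsub>T\<^esub>"
  proof
    fix i
    consider "i = 1" | "i \<in> {2..m}" | "i \<notin> {1..m}" by fastforce
    then show "t i = \<one>\<^bsub>T\<^esub> i"
      by cases (use t t1 tj m_ge_2 in \<open>auto simp: T_one T_carrier_iff extensional_def\<close>)
  qed
  have "u (TD_aut (t, s) p) 0 - TD_aut (t, s) p 0 = u (TD_aut (t, s) q) 0 - TD_aut (t, s) q 0"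
    by (rule z_shiftsD(3)[OF u inY[OF p(1)] inY[OF q(1)]])
       (simp add: TD_aut_coords(3)[OF t s] p q)
  then show "s = 1"
    unfolding at[OF p(1)] at[OF q(1)] TD_aut_coords(1)[OF t s p(1)] TD_aut_coords(1)[OF t s q(1)] p(2) q(2) by simp
qed

lemma U_action: "conjugation_action G U (T \<times>\<times> D) (\<lambda>u. u) TD_aut (TD_conj m k P)"
proof -
  have conj: "TD_conj m k P (t, s) = (\<lambda>u\<in>z_shifts. conj_by G (TD_aut (t, s)) u)" for t s
    unfolding TD_conj_def carrier_U TD_aut_def by simp
  show ?thesis
  proof (intro conjugation_action.intro conjugation_action_axioms.intro group_G group_U group_TD TD_aut_hom)
    show "(\<lambda>u. u) \<in> hom U G"
      unfolding big_unipotent_eq hom_def using z_shiftsD(1) by auto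
    fix b assume "b \<in> carrier (T \<times>\<times> D)"
    then obtain t s where b: "b = (t, s)" "t \<in> carrier T" "s \<in> carrier D" by auto
    show "TD_conj m k P b \<in> extensional (carrier U)" unfolding b(1) conj carrier_U by (rule restrict_extensional)
    fix u assume "u \<in> carrier U"
    then have u: "u \<in> z_shifts" unfolding carrier_U .
    show "TD_conj m k P b u \<in> carrier U"
      unfolding b(1) conj carrier_U using monomial_aut_normalizes[OF TD_aut_monomial[OF b(2,3)] u] u by simp
    show "TD_conj m k P b u \<otimes>\<^bsub>G\<^esub> TD_aut b = TD_aut b \<otimes>\<^bsub>G\<^esub> u"
      unfolding b(1) conj using conj_by_mult[OF TD_aut_G[OF b(2,3)] z_shiftsD(1)[OF u]] u by simp
  qed simp
qed

abbreviation TDU' where "TDU' \<equiv> TDU m k P"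

definition TDU_aut where "TDU_aut = (\<lambda>(b, u). u \<otimes>\<^bsub>G\<^esub> TD_aut b)"

lemma carrier_TDU: "carrier TDU' = (carrier T \<times> carrier D) \<times> z_shifts"
  by (simp add: TDU_def semidirect_def carrier_U)

lemma TDU_embedding:
  shows "group TDU'" "TDU_aut \<in> hom TDU' G" "inj_on TDU_aut (carrier TDU')"
proof -
  interpret U: conjugation_action G U "T \<times>\<times> D" "\<lambda>u. u" TD_aut "TD_conj m k P" by (rule U_action)
  have TDU_aut: "U.embed = TDU_aut" by (simp add: U.embed_def TDU_aut_def)
  show "group TDU'" unfolding TDU_def by (rule U.group_semidirect)
  show "TDU_aut \<in> hom TDU' G" unfolding TDU_def TDU_aut[symmetric] by (rule U.embed_hom)
  show "inj_on TDU_aut (carrier TDU')" unfolding TDU_def TDU_aut[symmetric]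
  proof (rule U.embed_inj)
    fix b u assume "b \<in> carrier (T \<times>\<times> D)" and u: "u \<in> carrier U" and eq: "u \<otimes>\<^bsub>G\<^esub> TD_aut b = \<one>\<^bsub>G\<^esub>"
    then obtain t s where b: "b = (t, s)" "t \<in> carrier T" "s \<in> carrier D" by auto
    show "b = \<one>\<^bsub>T \<times>\<times> D\<^esub>"
      using U_TD_trivial[OF b(2,3) _ eq[unfolded b(1)]] u carrier_U b(1) by (simp add: D_one)
  qed
qed

lemma sym_conj_apply:
  assumes "t \<in> carrier T" "s \<in> carrier D" "u \<in> z_shifts"
  shows "sym_conj m k P \<sigma> ((t, s), u) = ((\<lambda>i\<in>{1..m}. t (inv_into UNIV \<sigma> i), s), conj_by G (sact \<sigma>) u)"
  using assms by (simp add: sym_conj_def carrier_TDU)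

lemma permuted_torus:
  assumes \<sigma>: "\<sigma> \<in> carrier (sym_Y TYPE('a) m k)" and t: "t \<in> carrier T"
  shows "(\<lambda>i\<in>{1..m}. t (inv_into UNIV \<sigma> i)) \<in> carrier T" (is "?t \<in> _")
proof -
  have inv: "inv_into UNIV \<sigma> permutes {1..m}" using S_inv[OF \<sigma>] S_carrier_iff by blast
  have "y_monomial m k ?t = y_monomial m k (t \<circ> inv_into UNIV \<sigma>)"
    by (rule y_monomial_cong) simp
  also have "\<dots> = y_monomial m k t" using S_inv[OF \<sigma>] S_carrier_iff by blast
  also have "\<dots> = 1" using t by (simp add: y_monomial_M T_carrier_iff)
  finally have "?t 1 * M ?t = 1" unfolding y_monomial_M .
  moreover have "?t i \<noteq> 0" if "i \<in> {1..m}" for i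
    using that t permutes_in_image[OF inv, of i] unfolding T_carrier_iff by simp
  ultimately show ?thesis unfolding T_carrier_iff by blast
qed

text \<open>The symmetric group fixes \<open>y\<^sub>1\<close> and \<open>z\<close>, the only coordinates on which the quasitorus acts.\<close>

lemma sact_TD_aut:
  assumes \<sigma>: "\<sigma> \<in> carrier (sym_Y TYPE('a) m k)" and t: "t \<in> carrier T" and s: "s \<in> carrier D"
  shows "TD_aut (\<lambda>i\<in>{1..m}. t (inv_into UNIV \<sigma> i), s) \<otimes>\<^bsub>G\<^esub> sact \<sigma> = sact \<sigma> \<otimes>\<^bsub>G\<^esub> TD_aut (t, s)"
    (is "TD_aut (?t, s) \<otimes>\<^bsub>G\<^esub> _ = _")
proof -
  interpret G: group G by (rule group_G)
  note t' = permuted_torus[OF \<sigma> t]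
  note f = S_fixes[OF S_inv[OF \<sigma>]]
  have G: "TD_aut (?t, s) \<in> carrier G" "sact \<sigma> \<in> carrier G" "TD_aut (t, s) \<in> carrier G"
    using TD_aut_G[OF t' s] TD_aut_G[OF t s] sact_G[OF \<sigma>] by simp_all
  show ?thesis
  proof (rule G_ext)
    fix p assume p: "p \<in> Y"
    note sp = G_in_Y[OF G(2) p] and tp = G_in_Y[OF G(3) p]
    have "TD_aut (?t, s) (sact \<sigma> p) = sact \<sigma> (TD_aut (t, s) p)"
    proof (rule point_eqI[OF G_in_Y[OF G(1) sp] G_in_Y[OF G(2) tp]])
      fix i assume i: "i \<le> m"
      consider "i = 0" | "i = 1" | "i \<in> {2..m}" using i by fastforce
      then show "TD_aut (?t, s) (sact \<sigma> p) i = sact \<sigma> (TD_aut (t, s) p) i"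
      proof cases
        case 1
        show ?thesis unfolding 1 TD_aut_coords(1)[OF t' s sp] sact_apply[OF tp le0] sact_apply[OF p le0] f(1)
          by (rule TD_aut_coords(1)[OF t s p, symmetric])
      next
        case 2
        have m1: "1 \<le> m" using m_ge_2 by simp
        show ?thesis unfolding 2 TD_aut_coords(2)[OF t' s sp] sact_apply[OF tp m1] sact_apply[OF p m1] f(2)
          using TD_aut_coords(2)[OF t s p] m1 f(2) by simp
      next
        case 3
        then have "inv_into UNIV \<sigma> i \<in> {2..m}" using bij_betwE[OF f(3)] by blast
        then show ?thesis unfolding TD_aut_coords(3)[OF t' s sp 3] sact_apply[OF tp i] sact_apply[OF p i]
          using TD_aut_coords(3)[OF t s p] 3 by simp
      qed
    qed
    then show "(TD_aut (?t, s) \<otimes>\<^bsub>G\<^esub> sact \<sigma>) p = (sact \<sigma> \<otimes>\<^bsub>G\<^esub> TD_aut (t, s)) p"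
      unfolding G_mult_apply[OF G(1,2) p] G_mult_apply[OF G(2,3) p] .
  qed (use G in simp_all)
qed

lemma TDU_action: "conjugation_action G TDU' (sym_Y TYPE('a) m k) TDU_aut sact (sym_conj m k P)"
proof (intro conjugation_action.intro conjugation_action_axioms.intro group_G group_S sact_hom TDU_embedding)
  interpret G: group G by (rule group_G)
  fix \<sigma> assume \<sigma>: "\<sigma> \<in> carrier (sym_Y TYPE('a) m k)"
  show "sym_conj m k P \<sigma> \<in> extensional (carrier TDU')" unfolding sym_conj_def by (rule restrict_extensional)
  fix h assume "h \<in> carrier TDU'"
  then obtain t s u where h: "h = ((t, s), u)" "t \<in> carrier T" "s \<in> carrier D" "u \<in> z_shifts"
    unfolding carrier_TDU by blast
  note uG = z_shiftsD(1)[OF h(4)] and cu = monomial_aut_normalizes[OF sact_monomial[OF \<sigma>] h(4)]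
  show "sym_conj m k P \<sigma> h \<in> carrier TDU'"
    unfolding h(1) sym_conj_apply[OF h(2-4)] carrier_TDU using permuted_torus[OF \<sigma> h(2)] h(3) cu by blast
  let ?t = "\<lambda>i\<in>{1..m}. t (inv_into UNIV \<sigma> i)"
  note cuG = z_shiftsD(1)[OF cu] and tG = TD_aut_G[OF permuted_torus[OF \<sigma> h(2)] h(3)] and tG' = TD_aut_G[OF h(2,3)]
    and \<sigma>G = sact_G[OF \<sigma>]
  have "TDU_aut (sym_conj m k P \<sigma> h) \<otimes>\<^bsub>G\<^esub> sact \<sigma> = conj_by G (sact \<sigma>) u \<otimes>\<^bsub>G\<^esub> (TD_aut (?t, s) \<otimes>\<^bsub>G\<^esub> sact \<sigma>)"
    unfolding h(1) sym_conj_apply[OF h(2-4)] TDU_aut_def using G.m_assoc[OF cuG tG \<sigma>G] by simp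
  also have "\<dots> = (conj_by G (sact \<sigma>) u \<otimes>\<^bsub>G\<^esub> sact \<sigma>) \<otimes>\<^bsub>G\<^esub> TD_aut (t, s)"
    unfolding sact_TD_aut[OF \<sigma> h(2,3)] by (rule G.m_assoc[OF cuG \<sigma>G tG', symmetric])
  also have "\<dots> = sact \<sigma> \<otimes>\<^bsub>G\<^esub> (u \<otimes>\<^bsub>G\<^esub> TD_aut (t, s))"
    unfolding conj_by_mult[OF \<sigma>G uG] by (rule G.m_assoc[OF \<sigma>G uG tG'])
  also have "\<dots> = sact \<sigma> \<otimes>\<^bsub>G\<^esub> TDU_aut h" unfolding h(1) TDU_aut_def by simp
  finally show "TDU_aut (sym_conj m k P \<sigma> h) \<otimes>\<^bsub>G\<^esub> sact \<sigma> = sact \<sigma> \<otimes>\<^bsub>G\<^esub> TDU_aut h" .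
qed

text \<open>The product multiplies the coordinates \<open>y\<^sub>2, \<dots>, y\<^sub>m\<close> by scalars after permuting them. Points whose
  coordinates are all \<open>1\<close>, or all but one, show that the permutation is trivial.\<close>

lemma TDU_S_trivial:
  assumes \<sigma>: "\<sigma> \<in> carrier (sym_Y TYPE('a) m k)" and h: "h \<in> carrier TDU'"
    and eq: "TDU_aut h \<otimes>\<^bsub>G\<^esub> sact \<sigma> = \<one>\<^bsub>G\<^esub>"
  shows "\<sigma> = id"
proof -
  interpret G: group G by (rule group_G)
  obtain t s u where h: "h = ((t, s), u)" "t \<in> carrier T" "s \<in> carrier D" "u \<in> z_shifts"
    using h unfolding carrier_TDU by blast
  note uG = z_shiftsD(1)[OF h(4)] and tG = TD_aut_G[OF h(2,3)] and \<sigma>G = sact_G[OF \<sigma>]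
  let ?\<tau> = "inv_into UNIV \<sigma>"
  note f = S_fixes[OF S_inv[OF \<sigma>]]
  have at: "p j = t j * p (?\<tau> j)" if p: "p \<in> Y" and j: "j \<in> {2..m}" for p j
  proof -
    note sp = G_in_Y[OF \<sigma>G p]
    have "u (TD_aut (t, s) (sact \<sigma> p)) = p"
      using fun_cong[OF eq, of p] p uG tG \<sigma>G sp by (simp add: h(1) TDU_aut_def G_mult_apply G_one)
    then have "p j = TD_aut (t, s) (sact \<sigma> p) j" using z_shiftsD(2)[OF h(4) G_in_Y[OF tG sp] j] by simp
    also have "\<dots> = t j * p (?\<tau> j)" using TD_aut_coords(3)[OF h(2,3) sp j] sact_apply[OF p] j by simp
    finally show ?thesis .
  qed
  have \<tau>: "?\<tau> j = j" if j: "j \<in> {2..m}" for j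
  proof (rule ccontr)
    assume ne: "?\<tau> j \<noteq> j"
    have \<tau>j: "?\<tau> j \<in> {2..m}" using bij_betwE[OF f(3)] j by blast
    obtain q where q: "q \<in> Y" "q 0 = 0" "\<And>j. j \<in> {2..m} \<Longrightarrow> q j = 1" using test_point[of 0] by metis
    obtain p where p: "p \<in> Y" "\<And>i. i \<in> idx \<Longrightarrow> p i = (\<lambda>i. if i = j then 2 else 1) i"
      by (rule point_exists[of "\<lambda>i. if i = j then 2 else 1"]) auto
    have "t j = 1" using at[OF q(1) j] q(3)[OF j] q(3)[OF \<tau>j] by simp
    moreover have "p j = 2" "p (?\<tau> j) = 1" using p(2)[of j] p(2)[of "?\<tau> j"] j \<tau>j ne by auto
    ultimately show False using at[OF p(1) j] by simp
  qed
  have perm: "\<sigma> permutes {1..m}" "?\<tau> permutes {1..m}" using \<sigma> S_inv[OF \<sigma>] S_carrier_iff by blast+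
  have "?\<tau> i = i" for i
  proof -
    consider "i = 1" | "i \<in> {2..m}" | "i \<notin> {1..m}" by fastforce
    then show ?thesis by cases (use f(2) \<tau> permutes_not_in[OF perm(2)] in auto)
  qed
  then have "?\<tau> = id" by (simp add: fun_eq_iff)
  then show "\<sigma> = id" using permutes_inv_o(1)[OF perm(1)] by simp
qed

text \<open>Every automorphism acts on \<open>y\<^sub>2, \<dots>, y\<^sub>m\<close> by scalars and a permutation, and on \<open>z\<close> by a scalar
  up to a shift. Dividing by the corresponding elements of the torus, the quasitorus and the
  symmetric group leaves an element of the big unipotent subgroup.\<close>

lemma G_decomposition:
  assumes \<phi>: "\<phi> \<in> carrier G"
  obtains \<sigma> h where "\<sigma> \<in> carrier (sym_Y TYPE('a) m k)" "h \<in> carrier TDU'" "\<phi> = TDU_aut h \<otimes>\<^bsub>G\<^esub> sact \<sigma>"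
proof -
  interpret G: group G by (rule group_G)
  obtain a F f \<tau> c where *: "a \<noteq> 0" "F \<in> B" "rep f F"
    "\<forall>p\<in>Y. \<phi> p 0 = a * p 0 + M p * f p"
    "\<forall>z. poly P (a * z) = a ^ d * poly P z" "inj_on \<tau> {2..m}"
    "\<forall>j\<in>{2..m}. \<tau> j \<in> {2..m} \<and> k (\<tau> j) = k j \<and> c j \<noteq> 0"
    "\<forall>p\<in>Y. \<forall>j\<in>{2..m}. \<phi> p j = c j * p (\<tau> j)"
    by (rule aut_coordinates[OF \<phi>])
  have coords: "\<phi> p j = c j * p (\<tau> j)" if "p \<in> Y" "j \<in> {2..m}" for p j
    using *(8) that by blast
  have bij: "bij_betw \<tau> {2..m} {2..m}"
    using *(6,7) by (intro bij_betw_imageI endo_inj_surj) auto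
  define \<rho> where "\<rho> i = (if i \<in> {2..m} then \<tau> i else i)" for i
  have bij\<rho>: "bij_betw \<rho> {2..m} {2..m}"
    using bij by (subst bij_betw_cong[of _ _ \<tau>]) (auto simp: \<rho>_def)
  have "\<rho> permutes {2..m}" using bij\<rho> by (rule bij_imp_permutes) (auto simp: \<rho>_def)
  then have perm: "\<rho> permutes {1..m}" by (rule permutes_subset) auto
  have \<rho>S: "\<rho> \<in> carrier (sym_Y TYPE('a) m k)"
    unfolding S_carrier_iff
  proof (intro conjI allI perm)
    fix y :: "nat \<Rightarrow> 'a"
    have "M (y \<circ> \<rho>) = (\<Prod>j\<in>{2..m}. y (\<tau> j) ^ k (\<tau> j))"
      unfolding M_def using *(7) by (intro prod.cong) (auto simp: \<rho>_def)
    also have "\<dots> = M y" unfolding M_def by (rule prod.reindex_bij_betw[OF bij])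
    finally show "y_monomial m k (y \<circ> \<rho>) = y_monomial m k y" unfolding y_monomial_M by (simp add: \<rho>_def)
  qed
  define \<sigma> where "\<sigma> = inv_into UNIV \<rho>"
  have \<sigma>S: "\<sigma> \<in> carrier (sym_Y TYPE('a) m k)" unfolding \<sigma>_def by (rule S_inv[OF \<rho>S])
  have inv\<sigma>: "inv_into UNIV \<sigma> = \<rho>" unfolding \<sigma>_def by (rule inv_inv_eq[OF permutes_bij[OF perm]])
  define t where "t = (\<lambda>i\<in>{1..m}. if i = 1 then inverse (M c) else c i)"
  have Mc: "M c \<noteq> 0" unfolding M_def using *(7) by simp
  have tj: "t j = c j" if "j \<in> {2..m}" for j using that by (auto simp: t_def)
  have t: "t \<in> carrier T" unfolding T_carrier_iff
  proof (intro conjI ballI)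
    show "t \<in> extensional {1..m}" by (simp add: t_def)
    show "t i \<noteq> 0" if "i \<in> {1..m}" for i
    proof (cases "i = 1")
      case False
      then have "i \<in> {2..m}" using that by auto
      then show ?thesis using tj *(7) by simp
    qed (use Mc m_ge_2 in \<open>simp add: t_def\<close>)
    have "M t = M c" using tj by (rule M_cong)
    then show "t 1 * M t = 1" using Mc m_ge_2 by (simp add: t_def)
  qed
  have a: "a \<in> carrier D" using *(1,5) D_carrier_iff by blast
  define g where "g = TD_aut (t, a) \<otimes>\<^bsub>G\<^esub> sact \<sigma>"
  note tG = TD_aut_G[OF t a] and \<sigma>G = sact_G[OF \<sigma>S]
  have gG: "g \<in> carrier G" unfolding g_def using tG \<sigma>G by simp
  have g0: "g p 0 = a * p 0" and gj: "\<And>j. j \<in> {2..m} \<Longrightarrow> g p j = \<phi> p j" if p: "p \<in> Y" for p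
  proof -
    note sp = G_in_Y[OF \<sigma>G p]
    have gp: "g p = TD_aut (t, a) (sact \<sigma> p)" unfolding g_def by (rule G_mult_apply[OF tG \<sigma>G p])
    show "g p 0 = a * p 0"
      unfolding gp TD_aut_coords(1)[OF t a sp] sact_apply[OF p le0] inv\<sigma> by (simp add: \<rho>_def)
    show "g p j = \<phi> p j" if j: "j \<in> {2..m}" for j
      unfolding gp TD_aut_coords(3)[OF t a sp j] coords[OF p j] tj[OF j]
      using sact_apply[OF p, of j \<sigma>] j by (simp add: inv\<sigma> \<rho>_def)
  qed
  have mon: "monomial_aut g a c \<tau>"
    unfolding monomial_aut_def using gG bij *(7) coords g0 gj by simp
  define u where "u = \<phi> \<otimes>\<^bsub>G\<^esub> inv\<^bsub>G\<^esub> g"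
  have igG: "inv\<^bsub>G\<^esub> g \<in> carrier G" using gG by simp
  have uG: "u \<in> carrier G" unfolding u_def using \<phi> gG by simp
  have at: "u p = \<phi> ((inv\<^bsub>G\<^esub> g) p)" if "p \<in> Y" for p
    unfolding u_def by (rule G_mult_apply[OF \<phi> igG that])
  have "u \<in> z_shifts"
  proof (rule z_shiftsI[OF uG])
    fix p assume p: "p \<in> Y"
    note q = G_in_Y[OF igG p]
    show "u p j = p j" if "j \<in> {2..m}" for j
      unfolding at[OF p] gj[OF q that, symmetric] G_inv_apply(1)[OF gG p] ..
    fix p' assume p': "p' \<in> Y" and eq: "\<And>j. j \<in> {2..m} \<Longrightarrow> p j = p' j"
    note q' = G_in_Y[OF igG p']
    have diff: "u x 0 - x 0 = M ((inv\<^bsub>G\<^esub> g) x) * f ((inv\<^bsub>G\<^esub> g) x)" if x: "x \<in> Y" for x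
      using bspec[OF *(4) G_in_Y[OF igG x]] g0[OF G_in_Y[OF igG x]] unfolding at[OF x] G_inv_apply(1)[OF gG x] by simp
    have same: "(inv\<^bsub>G\<^esub> g) p j = (inv\<^bsub>G\<^esub> g) p' j" if "j \<in> {2..m}" for j
      by (rule monomial_aut_fibres[OF mon q q' _ that])
         (simp add: eq G_inv_apply(1)[OF gG p] G_inv_apply(1)[OF gG p'])
    have "M ((inv\<^bsub>G\<^esub> g) p) = M ((inv\<^bsub>G\<^esub> g) p')" using same by (rule M_cong)
    moreover have "f ((inv\<^bsub>G\<^esub> g) p) = f ((inv\<^bsub>G\<^esub> g) p')" using same by (rule rep_B_cong[OF *(3,2) q q'])
    ultimately show "u p 0 - p 0 = u p' 0 - p' 0" unfolding diff[OF p] diff[OF p'] by simp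
  qed
  then have h: "((t, a), u) \<in> carrier TDU'" unfolding carrier_TDU using t a by blast
  have "\<phi> = u \<otimes>\<^bsub>G\<^esub> g" unfolding u_def using \<phi> gG by (simp add: G.m_assoc)
  also have "\<dots> = TDU_aut ((t, a), u) \<otimes>\<^bsub>G\<^esub> sact \<sigma>"
    unfolding g_def TDU_aut_def using G.m_assoc[OF uG tG \<sigma>G] by simp
  finally show ?thesis using \<sigma>S h by (intro that)
qed

end

theorem theorem6p4:
  fixes P :: "'a::{alg_closed_field, field_char_0} poly"
    and m :: nat and k :: "nat \<Rightarrow> nat"
  assumes "m \<ge> 2"
    and "\<forall>i\<in>{2..m}. k i \<ge> 2"
    and "lead_coeff P = 1"
    and "degree P \<ge> 2"
    and "coeff P (degree P - 1) = 0"
  shows "TD_conj m k P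
           \<in> hom (proper_torus m k \<times>\<times> quasitorus P) (AutoGroup (big_unipotent m k P))
    \<and> sym_conj m k P \<in> hom (sym_Y TYPE('a) m k) (AutoGroup (TDU m k P))
    \<and> Aut_Y m k P \<cong> semidirect (sym_Y TYPE('a) m k) (TDU m k P) (sym_conj m k P)"
proof -
  interpret suspension P m k using assms by unfold_locales
  interpret U: conjugation_action G U "T \<times>\<times> D" "\<lambda>u. u" TD_aut "TD_conj m k P" by (rule U_action)
  interpret S: conjugation_action G TDU' "sym_Y TYPE('a) m k" TDU_aut sact "sym_conj m k P" by (rule TDU_action)
  have inj: "inj_on S.embed (carrier (semidirect (sym_Y TYPE('a) m k) TDU' (sym_conj m k P)))"
    by (rule S.embed_inj) (simp add: TDU_S_trivial S_one)
  have "carrier G \<subseteq> S.embed ` carrier (semidirect (sym_Y TYPE('a) m k) TDU' (sym_conj m k P))"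
  proof
    fix \<phi> assume "\<phi> \<in> carrier G"
    then obtain \<sigma> h where *: "\<sigma> \<in> carrier (sym_Y TYPE('a) m k)" "h \<in> carrier TDU'" "\<phi> = TDU_aut h \<otimes>\<^bsub>G\<^esub> sact \<sigma>"
      by (rule G_decomposition)
    then have "\<phi> = S.embed (\<sigma>, h)" by (simp add: S.embed_def)
    moreover have "(\<sigma>, h) \<in> carrier (semidirect (sym_Y TYPE('a) m k) TDU' (sym_conj m k P))"
      unfolding S.semidirect_carrier using * by simp
    ultimately show "\<phi> \<in> S.embed ` carrier (semidirect (sym_Y TYPE('a) m k) TDU' (sym_conj m k P))" by (rule image_eqI)
  qed
  then have "S.embed \<in> iso (semidirect (sym_Y TYPE('a) m k) TDU' (sym_conj m k P)) G"
    using S.embed_hom inj hom_in_carrier[OF S.embed_hom] unfolding iso_def bij_betw_def by blast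
  then have "semidirect (sym_Y TYPE('a) m k) TDU' (sym_conj m k P) \<cong> G" by (rule is_isoI)
  then have "G \<cong> semidirect (sym_Y TYPE('a) m k) TDU' (sym_conj m k P)"
    by (rule group.iso_sym[OF S.group_semidirect])
  then show ?thesis using U.\<theta>_hom S.\<theta>_hom by blast
qed

end
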